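(* Let $T$ be a complete stable first-order theory with sufficiently saturated model $\mathbb{U}$, and let $\mathop{\perp}$ denote non-forking independence in $T$. Suppose that $T$ admits a weak notion of independence $\mathop{\perp}^{1}$ which satisfies Stationarity over models. Then $\mathop{\perp}^{1}$ agrees with non-forking independence over elementary substructures: if $M\subset B$ is an elementary substructure and $A$ is a set, then $$A\mathop{\perp}_M B \quad\text{if and only if}\quad M\cup A\mathop{\perp}^{1}_M B.$$ Furthermore, assume that the weak notion of independence $\mathop{\perp}^{1}$ satisfies Basedness, Monotonicity, Base Monotonicity, Transitivity, Stationarity over models, as well as Weak Extension. Then $\mathop{\perp}^{1}$ agrees with non-forking independence over all algebraically closed subsets: if $C\subset B$ with $C$ algebraically closed and $A$ is a set, then $$A\mathop{\perp}_C B \quad\text{if and only if}\quad C\cup A\mathop{\perp}^{1}_C B.$$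
   Context: All tuples and subsets are (small and) taken inside the real sort of the sufficiently saturated model $\mathbb{U}$ of $T$ (no imaginaries); elementary substructures are elementary substructures of $\mathbb{U}$; $\operatorname{acl}$ is model-theoretic algebraic closure in the real sort, and $C$ is algebraically closed if $\operatorname{acl}(C)=C$. The notation $A\equiv_C A'$ means that $A$ and $A'$ have the same type over $C$ (with respect to some enumerations). Non-forking independence: for a finite tuple $a$ and sets $C\subset B$, $a\mathop{\perp}_C B$ means that $\operatorname{tp}(a/B)$ is a non-forking extension of $\operatorname{tp}(a/C)$; for a set $A$ and $C\subset B$, $A\mathop{\perp}_C B$ means $a\mathop{\perp}_C B$ for every finite tuple $a$ in $A$. An (abstract) independence relation $\mathop{\perp}^{1}$ is a ternary relation on subsets $A,B,C$ of $\mathbb{U}$ with $C\subset A\cap B$, written $A\mathop{\perp}^{1}_C B$. If $C$ is not a subset of $A\cap B$, the notation $A\mathop{\perp}^{1}_C B$ means $C\cup A\mathop{\perp}^{1}_C C\cup B$. Properties (with $C\subset A\cap B$ implicitly assumed where relevant): - Invariance: if $ABC\equiv A'B'C'$ (same type with respect to some enumeration) and $A\mathop{\perp}^{1}_C B$, then $A'\mathop{\perp}^{1}_{C'}B'$. - Monotonicity: given $C\subset B\subset D$, if $A\mathop{\perp}^{1}_C D$, then $A\mathop{\perp}^{1}_C B$. - Base Monotonicity: given $C\subset B\subset D$, if $A\mathop{\perp}^{1}_C D$, then $A\cup B\mathop{\perp}^{1}_B D$. - Transitivity: given $C\subset B\subset D$, if $A\mathop{\perp}^{1}_C B$ and $A\cup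 B\mathop{\perp}^{1}_B D$, then $A\mathop{\perp}^{1}_C D$. - Stationarity over models: whenever $A$ and $A'$ have the same type over an elementary substructure $M\subset B$, if both $M\cup A\mathop{\perp}^{1}_M B$ and $M\cup A'\mathop{\perp}^{1}_M B$ hold, then $A\equiv_B A'$. - Basedness: for all subsets $A$ and $B$, $A\cup B\mathop{\perp}^{1}_B \operatorname{acl}(B)$. - Weak Extension: for all subsets $A$, $B$ and $C\subset B$ with $C$ algebraically closed, there is some $A'\equiv_C A$ such that $C\cup A'\mathop{\perp}^{1}_C B$. A weak notion of independence is an independence relation $\mathop{\perp}^{1}$ satisfying Invariance such that $A\mathop{\perp}_M B$ (non-forking) implies $M\cup A\mathop{\perp}^{1}_M B$ for all subsets $A$, $B$ and $M\subset B$ with $M$ an elementary substructure. *)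

theory Defs
  imports Main
begin

unbundle cardinal_syntax

datatype 'f tm = Var nat | App 'f "'f tm list"

datatype ('f, 'r) fm =
    Eq "'f tm" "'f tm"
  | Rel 'r "'f tm list"
  | Neg "('f, 'r) fm"
  | Conj "('f, 'r) fm" "('f, 'r) fm"
  | Ex nat "('f, 'r) fm"

text \<open>The symbols of a language are given by sets rather than by whole types, since types are never
  empty but languages may have no function symbols or no relation symbols.\<close>

record ('f, 'r) lang =
  funs :: "'f set"
  rels :: "'r set"
  farity :: "'f \<Rightarrow> nat"
  rarity :: "'r \<Rightarrow> nat"

fun wf_tm :: "('f, 'r) lang \<Rightarrow> 'f tm \<Rightarrow> bool" where
  "wf_tm L (Var n) = True"
| "wf_tm L (App f ts) = (f \<in> funs L \<and> length ts = farity L f \<and> (\<forall>t\<in>set ts. wf_tm L t))"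

fun wf_fm :: "('f, 'r) lang \<Rightarrow> ('f, 'r) fm \<Rightarrow> bool" where
  "wf_fm L (Eq s t) = (wf_tm L s \<and> wf_tm L t)"
| "wf_fm L (Rel r ts) = (r \<in> rels L \<and> length ts = rarity L r \<and> (\<forall>t\<in>set ts. wf_tm L t))"
| "wf_fm L (Neg \<phi>) = wf_fm L \<phi>"
| "wf_fm L (Conj \<phi> \<psi>) = (wf_fm L \<phi> \<and> wf_fm L \<psi>)"
| "wf_fm L (Ex n \<phi>) = wf_fm L \<phi>"

fun fv_tm :: "'f tm \<Rightarrow> nat set" where
  "fv_tm (Var n) = {n}"
| "fv_tm (App f ts) = (\<Union>t\<in>set ts. fv_tm t)"

fun fv :: "('f, 'r) fm \<Rightarrow> nat set" where
  "fv (Eq s t) = fv_tm s \<union> fv_tm t"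
| "fv (Rel r ts) = (\<Union>t\<in>set ts. fv_tm t)"
| "fv (Neg \<phi>) = fv \<phi>"
| "fv (Conj \<phi> \<psi>) = fv \<phi> \<union> fv \<psi>"
| "fv (Ex n \<phi>) = fv \<phi> - {n}"

record ('f, 'r, 'a) struct =
  univ :: "'a set"
  fint :: "'f \<Rightarrow> 'a list \<Rightarrow> 'a"
  rint :: "'r \<Rightarrow> 'a list \<Rightarrow> bool"

definition is_struct :: "('f, 'r) lang \<Rightarrow> ('f, 'r, 'a) struct \<Rightarrow> bool" where
  "is_struct L M \<longleftrightarrow> univ M \<noteq> {} \<and>
     (\<forall>f\<in>funs L. \<forall>xs\<in>lists (univ M). length xs = farity L f \<longrightarrow> fint M f xs \<in> univ M)"

fun eval :: "('f, 'r, 'a) struct \<Rightarrow> (nat \<Rightarrow> 'a) \<Rightarrow> 'f tm \<Rightarrow> 'a" where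
  "eval M e (Var n) = e n"
| "eval M e (App f ts) = fint M f (map (eval M e) ts)"

fun sat :: "('f, 'r, 'a) struct \<Rightarrow> (nat \<Rightarrow> 'a) \<Rightarrow> ('f, 'r) fm \<Rightarrow> bool" where
  "sat M e (Eq s t) \<longleftrightarrow> eval M e s = eval M e t"
| "sat M e (Rel r ts) \<longleftrightarrow> rint M r (map (eval M e) ts)"
| "sat M e (Neg \<phi>) \<longleftrightarrow> \<not> sat M e \<phi>"
| "sat M e (Conj \<phi> \<psi>) \<longleftrightarrow> sat M e \<phi> \<and> sat M e \<psi>"
| "sat M e (Ex n \<phi>) \<longleftrightarrow> (\<exists>x\<in>univ M. sat M (e(n := x)) \<phi>)"

definition elem_sub :: "('f, 'r) lang \<Rightarrow> ('f, 'r, 'a) struct \<Rightarrow> 'a set \<Rightarrow> bool" where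
  "elem_sub L U M \<longleftrightarrow> M \<subseteq> univ U \<and> is_struct L (U\<lparr>univ := M\<rparr>) \<and>
     (\<forall>\<phi> e. wf_fm L \<phi> \<and> range e \<subseteq> M \<longrightarrow> (sat (U\<lparr>univ := M\<rparr>) e \<phi> \<longleftrightarrow> sat U e \<phi>))"

definition sentence :: "('f, 'r) lang \<Rightarrow> ('f, 'r) fm \<Rightarrow> bool" where
  "sentence L \<sigma> \<longleftrightarrow> wf_fm L \<sigma> \<and> fv \<sigma> = {}"

definition model :: "('f, 'r) lang \<Rightarrow> ('f, 'r) fm set \<Rightarrow> ('f, 'r, 'a) struct \<Rightarrow> bool" where
  "model L T M \<longleftrightarrow> is_struct L M \<and> (\<forall>\<sigma>\<in>T. \<forall>e. range e \<subseteq> univ M \<longrightarrow> sat M e \<sigma>)"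

text \<open>HOL cannot quantify over all models of all cardinalities at once. Where all models of a theory
  are meant, the definitions below range over the models whose universe is a subset of the type
  \<open>('f, 'r) fm\<close>. This type has at least \<open>|L| + \<aleph>\<^sub>0\<close> elements, so by the Loewenheim-Skolem theorem
  nothing is lost.\<close>

definition entails :: "('f, 'r) lang \<Rightarrow> ('f, 'r) fm set \<Rightarrow> ('f, 'r) fm \<Rightarrow> bool" where
  "entails L T \<sigma> \<longleftrightarrow>
     (\<forall>M :: ('f, 'r, ('f, 'r) fm) struct. model L T M \<longrightarrow> model L {\<sigma>} M)"

definition complete_theory :: "('f, 'r) lang \<Rightarrow> ('f, 'r) fm set \<Rightarrow> bool" where
  "complete_theory L T \<longleftrightarrow> (\<forall>\<sigma>\<in>T. sentence L \<sigma>) \<and>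
     (\<exists>M :: ('f, 'r, ('f, 'r) fm) struct. model L T M) \<and>
     (\<forall>\<sigma>. sentence L \<sigma> \<longrightarrow> entails L T \<sigma> \<or> entails L T (Neg \<sigma>))"

text \<open>A formula \<open>\<phi>(x; y)\<close> with \<open>|x| = m\<close> and \<open>|y| = n\<close> is a formula in the variables \<open>0, ..., m + n - 1\<close>,
  the first \<open>m\<close> of which form \<open>x\<close>. Accordingly \<open>\<phi>(a; b)\<close> is evaluated at the assignment
  \<open>(!) (a @ b)\<close>; its values beyond the length of \<open>a @ b\<close> are irrelevant.\<close>

definition order_property ::
  "('f, 'r) lang \<Rightarrow> ('f, 'r, 'a) struct \<Rightarrow> nat \<Rightarrow> nat \<Rightarrow> ('f, 'r) fm \<Rightarrow> bool" where
  "order_property L M m n \<phi> \<longleftrightarrow> wf_fm L \<phi> \<and> fv \<phi> \<subseteq> {..<m + n} \<and>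
     (\<exists>a b :: nat \<Rightarrow> 'a list.
        (\<forall>i. a i \<in> lists (univ M) \<and> length (a i) = m) \<and>
        (\<forall>j. b j \<in> lists (univ M) \<and> length (b j) = n) \<and>
        (\<forall>i j. sat M ((!) (a i @ b j)) \<phi> \<longleftrightarrow> i < j))"

definition stable_theory :: "('f, 'r) lang \<Rightarrow> ('f, 'r) fm set \<Rightarrow> bool" where
  "stable_theory L T \<longleftrightarrow>
     (\<forall>M :: ('f, 'r, ('f, 'r) fm) struct. model L T M \<longrightarrow> (\<forall>m n \<phi>. \<not> order_property L M m n \<phi>))"

text \<open>A formula \<open>\<phi>(x, b)\<close> in \<open>n\<close> variables \<open>x\<close> with parameters \<open>b\<close> is the pair \<open>(\<phi>, b)\<close>.\<close>

definition fms_over ::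
  "('f, 'r) lang \<Rightarrow> 'a set \<Rightarrow> nat \<Rightarrow> (('f, 'r) fm \<times> 'a list) set" where
  "fms_over L B n = {(\<phi>, b). wf_fm L \<phi> \<and> b \<in> lists B \<and> fv \<phi> \<subseteq> {..<n + length b}}"

definition holds_at :: "('f, 'r, 'a) struct \<Rightarrow> 'a list \<Rightarrow> ('f, 'r) fm \<times> 'a list \<Rightarrow> bool" where
  "holds_at U x \<theta> \<longleftrightarrow> sat U ((!) (x @ snd \<theta>)) (fst \<theta>)"

definition tuples :: "'a set \<Rightarrow> nat \<Rightarrow> 'a list set" where
  "tuples A n = {x \<in> lists A. length x = n}"

definition small :: "('f, 'r, 'a) struct \<Rightarrow> 'k rel \<Rightarrow> 'a set \<Rightarrow> bool" where
  "small U \<kappa> A \<longleftrightarrow> A \<subseteq> univ U \<and> |A| <o \<kappa>"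

definition saturated :: "('f, 'r) lang \<Rightarrow> ('f, 'r, 'a) struct \<Rightarrow> 'k rel \<Rightarrow> bool" where
  "saturated L U \<kappa> \<longleftrightarrow> (\<forall>B p. small U \<kappa> B \<and> p \<subseteq> fms_over L B 1 \<and>
     (\<forall>q. finite q \<and> q \<subseteq> p \<longrightarrow> (\<exists>x\<in>univ U. \<forall>\<theta>\<in>q. holds_at U [x] \<theta>)) \<longrightarrow>
     (\<exists>x\<in>univ U. \<forall>\<theta>\<in>p. holds_at U [x] \<theta>))"

text \<open>\<open>\<kappa>\<close> is a cardinal greater than \<open>|L| + \<aleph>\<^sub>0\<close>, the number of \<open>L\<close>-formulas.\<close>

definition sufficiently_saturated ::
  "('f, 'r) lang \<Rightarrow> ('f, 'r, 'a) struct \<Rightarrow> 'k rel \<Rightarrow> bool" where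
  "sufficiently_saturated L U \<kappa> \<longleftrightarrow>
     Card_order \<kappa> \<and> |{\<phi> :: ('f, 'r) fm. wf_fm L \<phi>}| <o \<kappa> \<and> saturated L U \<kappa>"

definition acl :: "('f, 'r) lang \<Rightarrow> ('f, 'r, 'a) struct \<Rightarrow> 'a set \<Rightarrow> 'a set" where
  "acl L U C = {a \<in> univ U. \<exists>\<theta>\<in>fms_over L C 1.
     holds_at U [a] \<theta> \<and> finite {x \<in> univ U. holds_at U [x] \<theta>}}"

text \<open>The families \<open>(a\<^sub>i)\<close> and \<open>(a'\<^sub>i)\<close>, \<open>i \<in> I\<close>, have the same type over \<open>C\<close>. A formula over \<open>C\<close> in the
  variables \<open>(x\<^sub>i)\<close>, \<open>i \<in> I\<close>, is represented by \<open>\<phi>\<close> and a map \<open>s\<close> that replaces each free variable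
  of \<open>\<phi>\<close> by some \<open>x\<^sub>i\<close> (\<open>Inl i\<close>) or by a parameter \<open>c \<in> C\<close> (\<open>Inr c\<close>).\<close>

definition same_type :: "('f, 'r) lang \<Rightarrow> ('f, 'r, 'a) struct \<Rightarrow> 'a set \<Rightarrow> 'i set \<Rightarrow>
    ('i \<Rightarrow> 'a) \<Rightarrow> ('i \<Rightarrow> 'a) \<Rightarrow> bool" where
  "same_type L U C I a a' \<longleftrightarrow> (\<forall>\<phi> s. wf_fm L \<phi> \<and> s ` fv \<phi> \<subseteq> I <+> C \<longrightarrow>
     (sat U (\<lambda>v. case_sum a id (s v)) \<phi> \<longleftrightarrow> sat U (\<lambda>v. case_sum a' id (s v)) \<phi>))"

text \<open>\<open>A \<equiv>\<^sub>C A'\<close> for sets: equality of types with respect to some enumerations, which may have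
  repetitions. Index sets inside the type of elements of \<open>U\<close> suffice.\<close>

definition equiv_over :: "('f, 'r) lang \<Rightarrow> ('f, 'r, 'a) struct \<Rightarrow> 'a set \<Rightarrow>
    'a set \<Rightarrow> 'a set \<Rightarrow> bool" where
  "equiv_over L U C A A' \<longleftrightarrow> (\<exists>(I :: 'a set) a a'. a ` I = A \<and> a' ` I = A' \<and> same_type L U C I a a')"

definition equiv3 :: "('f, 'r) lang \<Rightarrow> ('f, 'r, 'a) struct \<Rightarrow>
    'a set \<Rightarrow> 'a set \<Rightarrow> 'a set \<Rightarrow> 'a set \<Rightarrow> 'a set \<Rightarrow> 'a set \<Rightarrow> bool" where
  "equiv3 L U A B C A' B' C' \<longleftrightarrow> (\<exists>(I :: 'a set) (J :: 'a set) (K :: 'a set) a b c a' b' c'.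
     a ` I = A \<and> b ` J = B \<and> c ` K = C \<and> a' ` I = A' \<and> b' ` J = B' \<and> c' ` K = C' \<and>
     same_type L U {} (I <+> J <+> K)
       (case_sum a (case_sum b c)) (case_sum a' (case_sum b' c')))"

definition divides :: "('f, 'r) lang \<Rightarrow> ('f, 'r, 'a) struct \<Rightarrow> 'a set \<Rightarrow> nat \<Rightarrow>
    ('f, 'r) fm \<times> 'a list \<Rightarrow> bool" where
  "divides L U C n \<theta> \<longleftrightarrow> (case \<theta> of (\<phi>, b) \<Rightarrow> \<exists>k. \<exists>bs :: nat \<Rightarrow> 'a list.
     (\<forall>i. bs i \<in> tuples (univ U) (length b) \<and>
          same_type L U C {..<length b} ((!) b) ((!) (bs i))) \<and>
     (\<forall>S. finite S \<and> card S = k \<longrightarrow>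
          \<not> (\<exists>x\<in>tuples (univ U) n. \<forall>i\<in>S. holds_at U x (\<phi>, bs i))))"

definition forks :: "('f, 'r) lang \<Rightarrow> ('f, 'r, 'a) struct \<Rightarrow> 'a set \<Rightarrow> nat \<Rightarrow>
    ('f, 'r) fm \<times> 'a list \<Rightarrow> bool" where
  "forks L U C n \<theta> \<longleftrightarrow> (\<exists>\<Delta>. finite \<Delta> \<and> \<Delta> \<subseteq> fms_over L (univ U) n \<and>
     (\<forall>\<delta>\<in>\<Delta>. divides L U C n \<delta>) \<and>
     (\<forall>x\<in>tuples (univ U) n. holds_at U x \<theta> \<longrightarrow> (\<exists>\<delta>\<in>\<Delta>. holds_at U x \<delta>)))"

definition tp :: "('f, 'r) lang \<Rightarrow> ('f, 'r, 'a) struct \<Rightarrow> 'a set \<Rightarrow> 'a list \<Rightarrow>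
    (('f, 'r) fm \<times> 'a list) set" where
  "tp L U B a = {\<theta> \<in> fms_over L B (length a). holds_at U a \<theta>}"

text \<open>\<open>A\<close> is independent from \<open>B\<close> over \<open>C\<close>; meant for \<open>C \<subseteq> B\<close>.\<close>

definition nf_indep :: "('f, 'r) lang \<Rightarrow> ('f, 'r, 'a) struct \<Rightarrow> 'a set \<Rightarrow> 'a set \<Rightarrow> 'a set \<Rightarrow> bool"
  where
  "nf_indep L U A C B \<longleftrightarrow> (\<forall>a\<in>lists A. tp L U C a \<subseteq> tp L U B a \<and>
     (\<forall>\<theta>\<in>tp L U B a. \<not> forks L U C (length a) \<theta>))"

text \<open>A ternary relation \<open>ind A C B\<close> stands for the independence of \<open>A\<close> from \<open>B\<close> over \<open>C\<close>. Only its
  values on small sets with \<open>C \<subseteq> A \<inter> B\<close> are meaningful, and only these are used.\<close>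

definition invariance where
  "invariance L U \<kappa> ind \<longleftrightarrow> (\<forall>A B C A' B' C'.
     small U \<kappa> A \<and> small U \<kappa> B \<and> small U \<kappa> C \<and> small U \<kappa> A' \<and> small U \<kappa> B' \<and> small U \<kappa> C' \<and>
     C \<subseteq> A \<inter> B \<and> equiv3 L U A B C A' B' C' \<and> ind A C B \<longrightarrow> ind A' C' B')"

definition monotonicity where
  "monotonicity U \<kappa> ind \<longleftrightarrow> (\<forall>A B C D. small U \<kappa> A \<and> small U \<kappa> D \<and> C \<subseteq> A \<and> C \<subseteq> B \<and> B \<subseteq> D \<and>
     ind A C D \<longrightarrow> ind A C B)"

definition base_monotonicity where
  "base_monotonicity U \<kappa> ind \<longleftrightarrow> (\<forall>A B C D. small U \<kappa> A \<and> small U \<kappa> D \<and> C \<subseteq> A \<and> C \<subseteq> B \<and> B \<subseteq> D \<and>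
     ind A C D \<longrightarrow> ind (A \<union> B) B D)"

definition transitivity where
  "transitivity U \<kappa> ind \<longleftrightarrow> (\<forall>A B C D. small U \<kappa> A \<and> small U \<kappa> D \<and> C \<subseteq> A \<and> C \<subseteq> B \<and> B \<subseteq> D \<and>
     ind A C B \<and> ind (A \<union> B) B D \<longrightarrow> ind A C D)"

definition stationarity_over_models where
  "stationarity_over_models L U \<kappa> ind \<longleftrightarrow> (\<forall>A A' B M. small U \<kappa> A \<and> small U \<kappa> A' \<and> small U \<kappa> B \<and>
     elem_sub L U M \<and> M \<subseteq> B \<and> equiv_over L U M A A' \<and>
     ind (M \<union> A) M B \<and> ind (M \<union> A') M B \<longrightarrow> equiv_over L U B A A')"

definition basedness where
  "basedness L U \<kappa> ind \<longleftrightarrow> (\<forall>A B. small U \<kappa> A \<and> small U \<kappa> B \<longrightarrow> ind (A \<union> B) B (acl L U B))"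

definition weak_extension where
  "weak_extension L U \<kappa> ind \<longleftrightarrow> (\<forall>A B C. small U \<kappa> A \<and> small U \<kappa> B \<and> C \<subseteq> B \<and> acl L U C = C \<longrightarrow>
     (\<exists>A'. small U \<kappa> A' \<and> equiv_over L U C A' A \<and> ind (C \<union> A') C B))"

definition weak_notion_of_independence where
  "weak_notion_of_independence L U \<kappa> ind \<longleftrightarrow> invariance L U \<kappa> ind \<and>
     (\<forall>A B M. small U \<kappa> A \<and> small U \<kappa> B \<and> elem_sub L U M \<and> M \<subseteq> B \<and> nf_indep L U A M B \<longrightarrow>
        ind (M \<union> A) M B)"

end

theory Submission
  imports Defs "HOL-Library.Ramsey"
begin

text \<open>Stability makes types over models definable, and the type of \<open>A\<close> over a model \<open>M\<close> has a
  definable extension to every \<open>B \<supseteq> M\<close>. This extension does not fork over \<open>M\<close>, so by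
  Stationarity it is the only extension that is independent in the sense of either relation, which
  settles the case of models.

  Over an algebraically closed set \<open>C\<close>, a formula that divides over \<open>C\<close> also divides over some
  model containing \<open>C\<close>. If \<open>A\<close> is \<open>ind\<close>-independent from \<open>B\<close> over \<open>C\<close>, it can be moved over \<open>B\<close>
  to be independent from any such models and hence, by Base Monotonicity, over them; so the type of
  \<open>A\<close> over \<open>B\<close> does not fork over \<open>C\<close>. Conversely, let \<open>A\<close> be non-forking independent from \<open>B\<close>
  over \<open>C\<close> and let \<open>f A\<close> be a copy of \<open>A\<close> over \<open>C\<close> that is \<open>ind\<close>-independent from a model
  \<open>M \<supseteq> C\<close>. Non-dividing along a Morley sequence of an \<open>ind\<close>-independent copy of \<open>B\<close>, and symmetry
  over \<open>M\<close>, show that every formula in the type of \<open>(A, B)\<close> over \<open>C\<close> holds of \<open>(f A, y)\<close> for some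
  \<open>y\<close> in \<open>M\<close>. Applying the definition of the type of \<open>f A\<close> over \<open>M\<close> to a suitable copy of \<open>B\<close> then
  produces an \<open>ind\<close>-independent copy of the pair \<open>(A, B)\<close>.\<close>

subsection \<open>Renaming of variables\<close>

text \<open>Uniqueness of independent extensions can therefore be used only over models, and the two
  relations are compared over \<open>C\<close> by way of models that contain \<open>C\<close>, where
  both amount to \<open>def_indep\<close>. A definition over \<open>M\<close> has the same truth
  value at all conjugates of a parameter over \<open>M\<close>. A formula in a definable extension
  would thus hold along a whole sequence witnessing that it divides; this is why such an extension
  does not fork. Weak Extension yields only some copy of \<open>A\<close> over \<open>C\<close>, not
  one over \<open>B\<close>; \<open>ind_extension\<close> supplies the latter. In the converse, no
  stationarity over \<open>C\<close> identifies the chosen copy of \<open>A\<close> with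
  \<open>A\<close>, so it is the copy of \<open>B\<close> that must be fitted to it. Dividing
  concerns the parameters, hence the Morley sequence consists of copies of \<open>B\<close>.
  Stability enters only through the exclusion of ladders. Since whole sets are moved at once, they
  are treated as families indexed by their own elements.\<close>

lemma eval_cong: "(\<And>v. v \<in> fv_tm t \<Longrightarrow> e v = e' v) \<Longrightarrow> eval M e t = eval M e' t"
proof (induction t)
  case (App f ts)
  have "\<forall>t\<in>set ts. eval M e t = eval M e' t" using App by fastforce
  then show ?case by (simp cong: map_cong)
qed auto

lemma sat_cong: "\<forall>v\<in>fv \<phi>. e v = e' v \<Longrightarrow> sat M e \<phi> \<longleftrightarrow> sat M e' \<phi>"
proof (induction \<phi> arbitrary: e e')
  case (Eq s t)
  have "eval M e s = eval M e' s" "eval M e t = eval M e' t"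
    using Eq by (auto intro!: eval_cong)
  then show ?case by (simp only: sat.simps)
next
  case (Rel r ts)
  have "\<forall>t\<in>set ts. eval M e t = eval M e' t" using Rel by (fastforce intro: eval_cong)
  then show ?case by (simp cong: map_cong)
next
  case (Ex n \<phi>)
  have "sat M (e(n := x)) \<phi> \<longleftrightarrow> sat M (e'(n := x)) \<phi>" for x
  proof (rule Ex.IH)
    show "\<forall>v\<in>fv \<phi>. (e(n := x)) v = (e'(n := x)) v" using Ex.prems by auto
  qed
  then show ?case unfolding sat.simps by (intro bex_cong refl)
next
  case (Neg \<phi>)
  then show ?case using Neg.IH[of e e'] by (simp only: sat.simps fv.simps)
next
  case (Conj \<phi>1 \<phi>2)
  have "sat M e \<phi>1 = sat M e' \<phi>1" using Conj.prems by (intro Conj.IH(1)) auto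
  moreover have "sat M e \<phi>2 = sat M e' \<phi>2" using Conj.prems by (intro Conj.IH(2)) auto
  ultimately show ?case by (simp only: sat.simps)
qed
lemma finite_fv_tm [simp]: "finite (fv_tm t)"
  by (induction t) auto

lemma finite_fv [simp]: "finite (fv \<phi>)"
  by (induction \<phi>) auto

fun rename_tm :: "(nat \<Rightarrow> nat) \<Rightarrow> 'f tm \<Rightarrow> 'f tm" where
  "rename_tm f (Var n) = Var (f n)"
| "rename_tm f (App g ts) = App g (map (rename_tm f) ts)"

text \<open>Bound variables are renamed as well, so this is only meaningful for injective maps.\<close>

fun rename_fm :: "(nat \<Rightarrow> nat) \<Rightarrow> ('f, 'r) fm \<Rightarrow> ('f, 'r) fm" where
  "rename_fm f (Eq s t) = Eq (rename_tm f s) (rename_tm f t)"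
| "rename_fm f (Rel r ts) = Rel r (map (rename_tm f) ts)"
| "rename_fm f (Neg \<phi>) = Neg (rename_fm f \<phi>)"
| "rename_fm f (Conj \<phi> \<psi>) = Conj (rename_fm f \<phi>) (rename_fm f \<psi>)"
| "rename_fm f (Ex n \<phi>) = Ex (f n) (rename_fm f \<phi>)"

lemma eval_rename: "eval M e (rename_tm f t) = eval M (e \<circ> f) t"
  by (induction t) (auto simp: o_def cong: map_cong)

lemma wf_rename_tm [simp]: "wf_tm L (rename_tm f t) \<longleftrightarrow> wf_tm L t"
  by (induction t) auto

lemma fv_rename_tm [simp]: "fv_tm (rename_tm f t) = f ` fv_tm t"
  by (induction t) auto

lemma sat_rename: "inj f \<Longrightarrow> sat M e (rename_fm f \<phi>) \<longleftrightarrow> sat M (e \<circ> f) \<phi>"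
proof (induction \<phi> arbitrary: e)
  case (Ex n \<phi>)
  have "(e(f n := x)) \<circ> f = (e \<circ> f)(n := x)" for x
    using Ex.prems by (auto simp: inj_def)
  then show ?case
    unfolding sat.simps rename_fm.simps by (intro bex_cong refl) (simp only: Ex.IH[OF Ex.prems])
qed (auto simp: eval_rename o_def)

lemma wf_rename_fm [simp]: "wf_fm L (rename_fm f \<phi>) \<longleftrightarrow> wf_fm L \<phi>"
  by (induction \<phi>) auto

lemma fv_rename_fm [simp]: "inj f \<Longrightarrow> fv (rename_fm f \<phi>) = f ` fv \<phi>"
  by (induction \<phi>) (auto simp: inj_image_mem_iff inj_def)

text \<open>Instead of substituting below quantifiers, each \<open>v\<close> is bound by a new
  quantifier and equated with \<open>g v\<close>, so nothing can be captured. The values at the new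
  variables must lie in the universe because that quantifier ranges over it only.\<close>

lemma subst_vars:
  assumes "wf_fm L \<phi>" and "finite F" and "g ` F \<inter> F = {}"
  shows "\<exists>\<psi>. wf_fm L \<psi> \<and> fv \<psi> \<subseteq> (fv \<phi> - F) \<union> g ` F \<and>
    (\<forall>e. e ` g ` F \<subseteq> univ U \<longrightarrow> (sat U e \<psi> \<longleftrightarrow> sat U (\<lambda>v. if v \<in> F then e (g v) else e v) \<phi>))"
  using assms(2,3)
proof (induction F)
  case empty
  then show ?case using assms(1) by auto
next
  case (insert v F)
  have "g ` F \<inter> F = {}" using insert.prems by auto
  from insert.IH[OF this] obtain \<psi> where \<psi>: "wf_fm L \<psi>" "fv \<psi> \<subseteq> (fv \<phi> - F) \<union> g ` F"
    "\<And>e. e ` g ` F \<subseteq> univ U \<Longrightarrow> sat U e \<psi> \<longleftrightarrow> sat U (\<lambda>v. if v \<in> F then e (g v) else e v) \<phi>"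
    by blast
  let ?\<psi> = "Ex v (Conj (Eq (Var v) (Var (g v))) \<psi>)"
  have gv: "g v \<noteq> v" "\<And>u. u \<in> F \<Longrightarrow> g u \<noteq> v" using insert.prems by auto
  have "sat U e ?\<psi> \<longleftrightarrow> sat U (\<lambda>u. if u \<in> insert v F then e (g u) else e u) \<phi>"
    if e: "e ` g ` insert v F \<subseteq> univ U" for e
  proof -
    have "sat U e ?\<psi> \<longleftrightarrow> sat U (e(v := e (g v))) \<psi>"
      using gv e by auto
    also have "\<dots> \<longleftrightarrow> sat U (\<lambda>u. if u \<in> F then (e(v := e (g v))) (g u) else (e(v := e (g v))) u) \<phi>"
      using e gv by (intro \<psi>(3)) auto
    also have "(\<lambda>u. if u \<in> F then (e(v := e (g v))) (g u) else (e(v := e (g v))) u) =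
        (\<lambda>u. if u \<in> insert v F then e (g u) else e u)"
      using gv insert.hyps by (auto simp: fun_eq_iff)
    finally show ?thesis .
  qed
  moreover have "wf_fm L ?\<psi>" using \<psi> by simp
  moreover have "fv ?\<psi> \<subseteq> (fv \<phi> - insert v F) \<union> g ` insert v F" using \<psi>(2) by auto
  ultimately show ?case by blast
qed

text \<open>The map \<open>f\<close> may identify variables or send one free variable to another.
  Shifting all variables beyond the targets first makes sources and targets disjoint.\<close>

lemma rename_free_vars:
  assumes "wf_fm L \<phi>"
  shows "\<exists>\<psi>. wf_fm L \<psi> \<and> fv \<psi> \<subseteq> f ` fv \<phi> \<and>
    (\<forall>e. e ` f ` fv \<phi> \<subseteq> univ U \<longrightarrow> (sat U e \<psi> \<longleftrightarrow> sat U (e \<circ> f) \<phi>))"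
proof -
  obtain N where N: "\<And>v. v \<in> fv \<phi> \<Longrightarrow> f v < N"
    using finite_nat_set_iff_bounded[of "f ` fv \<phi>"] by auto
  let ?s = "\<lambda>v. v + N"
  have inj: "inj ?s" by (simp add: inj_def)
  let ?\<phi> = "rename_fm ?s \<phi>" and ?F = "?s ` fv \<phi>" and ?g = "\<lambda>v. f (v - N)"
  have im: "?g ` ?F = f ` fv \<phi>" by (auto simp: image_iff)
  have "?g ` ?F \<inter> ?F = {}" unfolding im using N by fastforce
  from subst_vars[of L ?\<phi> ?F ?g U] this assms
  obtain \<psi> where \<psi>: "wf_fm L \<psi>" "fv \<psi> \<subseteq> (fv ?\<phi> - ?F) \<union> f ` fv \<phi>"
    "\<And>e. e ` f ` fv \<phi> \<subseteq> univ U \<Longrightarrow>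
       sat U e \<psi> \<longleftrightarrow> sat U (\<lambda>v. if v \<in> ?F then e (?g v) else e v) ?\<phi>"
    unfolding im by auto
  have "sat U (\<lambda>v. if v \<in> ?F then e (?g v) else e v) ?\<phi> \<longleftrightarrow> sat U (e \<circ> f) \<phi>" for e
    unfolding sat_rename[OF inj] by (intro sat_cong) auto
  then show ?thesis using \<psi> inj by auto
qed

text \<open>Passes from variables with arbitrary indices to the official format of two consecutive
  tuples; a variable goes to any position at which its index occurs in the lists.\<close>

lemma fm_of_lists:
  fixes U :: "('f, 'r, 'a) struct" and s :: "nat \<Rightarrow> 'i + 'j"
  assumes "wf_fm L \<phi>" and "s ` fv \<phi> \<subseteq> set ms <+> set js"
  shows "\<exists>\<psi>. wf_fm L \<psi> \<and> fv \<psi> \<subseteq> {..<length ms + length js} \<and>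
    (\<forall>a b. a ` set ms \<subseteq> univ U \<longrightarrow> b ` set js \<subseteq> univ U \<longrightarrow>
      (sat U (\<lambda>v. case_sum a b (s v)) \<phi> \<longleftrightarrow> sat U ((!) (map a ms @ map b js)) \<psi>))"
proof -
  have "\<exists>k < length ms + length js. \<forall>(a :: 'i \<Rightarrow> 'a) b. (map a ms @ map b js) ! k = case_sum a b (s v)"
    if "v \<in> fv \<phi>" for v
  proof (cases "s v")
    case (Inl i)
    then have "i \<in> set ms" using assms(2) that by force
    then obtain k where "k < length ms" "ms ! k = i" by (auto simp: in_set_conv_nth)
    then show ?thesis using Inl by (intro exI[of _ k]) (auto simp: nth_append)
  next
    case (Inr j)
    then have "j \<in> set js" using assms(2) that by force
    then obtain k where "k < length js" "js ! k = j" by (auto simp: in_set_conv_nth)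
    then show ?thesis using Inr by (intro exI[of _ "length ms + k"]) (auto simp: nth_append)
  qed
  then have "\<forall>v\<in>fv \<phi>. \<exists>k. k < length ms + length js \<and>
      (\<forall>(a :: 'i \<Rightarrow> 'a) b. (map a ms @ map b js) ! k = case_sum a b (s v))" by blast
  from bchoice[OF this] obtain f where f: "\<And>v. v \<in> fv \<phi> \<Longrightarrow> f v < length ms + length js"
    "\<And>v (a :: 'i \<Rightarrow> 'a) b. v \<in> fv \<phi> \<Longrightarrow> (map a ms @ map b js) ! f v = case_sum a b (s v)"
    by blast
  from rename_free_vars[OF assms(1), of f U]
  obtain \<psi> where \<psi>: "wf_fm L \<psi>" "fv \<psi> \<subseteq> f ` fv \<phi>"
    "\<And>e. e ` f ` fv \<phi> \<subseteq> univ U \<Longrightarrow> sat U e \<psi> \<longleftrightarrow> sat U (e \<circ> f) \<phi>" by blast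
  have "sat U (\<lambda>v. case_sum a b (s v)) \<phi> \<longleftrightarrow> sat U ((!) (map a ms @ map b js)) \<psi>"
    if ab: "a ` set ms \<subseteq> univ U" "b ` set js \<subseteq> univ U" for a b
  proof -
    have "case_sum a b (s v) \<in> univ U" if "v \<in> fv \<phi>" for v
      using that assms(2) ab by (force split: sum.split)
    then have "((!) (map a ms @ map b js)) ` f ` fv \<phi> \<subseteq> univ U"
      using f(2)[of _ a b] by (intro subsetI; elim imageE; hypsubst) (simp only:)
    then have "sat U ((!) (map a ms @ map b js)) \<psi> \<longleftrightarrow> sat U ((!) (map a ms @ map b js) \<circ> f) \<phi>"
      by (rule \<psi>(3))
    also have "\<dots> \<longleftrightarrow> sat U (\<lambda>v. case_sum a b (s v)) \<phi>"
      using f(2) by (intro sat_cong) simp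
    finally show ?thesis by simp
  qed
  then show ?thesis using \<psi>(1,2) f(1) by blast
qed

subsection \<open>Definable predicates and elementary substructures\<close>

lemma case_sum_image_Plus [simp]: "case_sum a b ` (I <+> J) = a ` I \<union> b ` J"
  by (force simp: Plus_def)

lemma sum_image_subset_Plus:
  "f ` A \<subseteq> I <+> J \<longleftrightarrow> (\<forall>x\<in>A. (\<forall>i. f x = Inl i \<longrightarrow> i \<in> I) \<and> (\<forall>j. f x = Inr j \<longrightarrow> j \<in> J))"
proof -
  have "f x \<in> I <+> J \<longleftrightarrow> (\<forall>i. f x = Inl i \<longrightarrow> i \<in> I) \<and> (\<forall>j. f x = Inr j \<longrightarrow> j \<in> J)" for x
    by (cases "f x") auto
  then show ?thesis by auto
qed

lemma case_sum_in:
  assumes "x \<in> I <+> C" and "a ` I \<subseteq> X" and "C \<subseteq> X"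
  shows "case_sum a id x \<in> X"
  using assms by (cases x) auto

locale first_order_structure =
  fixes L :: "('f, 'r) lang" and U :: "('f, 'r, 'a) struct"
  assumes is_struct: "is_struct L U"
begin

abbreviation V :: "'a set" where "V \<equiv> univ U"

text \<open>Formulas in arbitrary index sets of variables are handled through the predicates
  on families \<open>a : I \<rightarrow> V\<close> that they define with parameters in \<open>C\<close>; only the values of the
  predicates on such families matter.\<close>

definition dfn :: "'a set \<Rightarrow> 'i set \<Rightarrow> (('i \<Rightarrow> 'a) \<Rightarrow> bool) \<Rightarrow> bool" where
  "dfn C I P \<longleftrightarrow> (\<exists>\<phi> s. wf_fm L \<phi> \<and> s ` fv \<phi> \<subseteq> I <+> C \<and>
     (\<forall>a. a ` I \<subseteq> V \<longrightarrow> (P a \<longleftrightarrow> sat U (\<lambda>v. case_sum a id (s v)) \<phi>)))"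

lemma univ_nonempty: "V \<noteq> {}"
  using is_struct by (simp add: is_struct_def)

lemma dfnI:
  assumes "wf_fm L \<phi>" and "s ` fv \<phi> \<subseteq> I <+> C"
    and "\<And>a. a ` I \<subseteq> V \<Longrightarrow> P a \<longleftrightarrow> sat U (\<lambda>v. case_sum a id (s v)) \<phi>"
  shows "dfn C I P"
  using assms unfolding dfn_def by blast

lemma dfnE:
  assumes "dfn C I P"
  obtains \<phi> s where "wf_fm L \<phi>" and "s ` fv \<phi> \<subseteq> I <+> C"
    and "\<And>a. a ` I \<subseteq> V \<Longrightarrow> P a \<longleftrightarrow> sat U (\<lambda>v. case_sum a id (s v)) \<phi>"
  using assms unfolding dfn_def by blast

lemma dfn_cong:
  assumes "dfn C I P" and "\<And>a. a ` I \<subseteq> V \<Longrightarrow> P a \<longleftrightarrow> Q a"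
  shows "dfn C I Q"
  using assms unfolding dfn_def by metis

lemma dfn_same:
  assumes P: "dfn C I P" and ab: "\<And>i. i \<in> I \<Longrightarrow> a i = b i" and a: "a ` I \<subseteq> V"
  shows "P a \<longleftrightarrow> P b"
proof -
  have b: "b ` I \<subseteq> V" using a ab by force
  from P obtain \<phi> s where \<phi>: "wf_fm L \<phi>" "s ` fv \<phi> \<subseteq> I <+> C"
    "\<And>a. a ` I \<subseteq> V \<Longrightarrow> P a \<longleftrightarrow> sat U (\<lambda>v. case_sum a id (s v)) \<phi>" by (rule dfnE) (rule that)
  have "sat U (\<lambda>v. case_sum a id (s v)) \<phi> \<longleftrightarrow> sat U (\<lambda>v. case_sum b id (s v)) \<phi>"
    using \<phi>(2) ab by (intro sat_cong) (auto simp: sum_image_subset_Plus split: sum.split)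
  then show ?thesis using \<phi>(3) a b by simp
qed

lemma dfn_mono:
  assumes "dfn C I P" and "C \<subseteq> C'" and "I \<subseteq> I'"
  shows "dfn C' I' P"
proof -
  from assms(1) obtain \<phi> s where \<phi>: "wf_fm L \<phi>" "s ` fv \<phi> \<subseteq> I <+> C"
    "\<And>a. a ` I \<subseteq> V \<Longrightarrow> P a \<longleftrightarrow> sat U (\<lambda>v. case_sum a id (s v)) \<phi>" by (rule dfnE) (rule that)
  have "I <+> C \<subseteq> I' <+> C'" using assms(2,3) by auto
  with \<phi>(2) have "s ` fv \<phi> \<subseteq> I' <+> C'" by (rule order_trans)
  then show ?thesis
  proof (rule dfnI[OF \<phi>(1)])
    fix a assume "a ` I' \<subseteq> V"
    then have "a ` I \<subseteq> V" using assms(3) by blast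
    then show "P a \<longleftrightarrow> sat U (\<lambda>v. case_sum a id (s v)) \<phi>" by (rule \<phi>(3))
  qed
qed

text \<open>The general substitution: \<open>g\<close> sends an index to a new index or to a
  parameter. Reindexing and plugging in parameters are special cases.\<close>

lemma dfn_subst:
  assumes "dfn C I P" and "C \<subseteq> C'" and "g ` I \<subseteq> I' <+> C'" and "C' \<subseteq> V"
  shows "dfn C' I' (\<lambda>a. P (\<lambda>i. case_sum a id (g i)))"
proof -
  from assms(1) obtain \<phi> s where \<phi>: "wf_fm L \<phi>" "s ` fv \<phi> \<subseteq> I <+> C"
    "\<And>a. a ` I \<subseteq> V \<Longrightarrow> P a \<longleftrightarrow> sat U (\<lambda>v. case_sum a id (s v)) \<phi>" by (rule dfnE) (rule that)
  let ?s = "\<lambda>v. case_sum g Inr (s v)"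
  show ?thesis
  proof (rule dfnI[of \<phi> ?s])
    show "?s ` fv \<phi> \<subseteq> I' <+> C'"
      using \<phi>(2) assms(2,3) by (auto simp: sum_image_subset_Plus split: sum.splits)
    fix a assume a: "a ` I' \<subseteq> V"
    have "(\<lambda>i. case_sum a id (g i)) ` I \<subseteq> V"
      using case_sum_in[OF _ a assms(4)] assms(3) by blast
    then have "P (\<lambda>i. case_sum a id (g i)) \<longleftrightarrow>
        sat U (\<lambda>v. case_sum (\<lambda>i. case_sum a id (g i)) id (s v)) \<phi>" by (rule \<phi>(3))
    also have "\<dots> \<longleftrightarrow> sat U (\<lambda>v. case_sum a id (?s v)) \<phi>"
      by (intro sat_cong) (auto split: sum.split)
    finally show "P (\<lambda>i. case_sum a id (g i)) \<longleftrightarrow> sat U (\<lambda>v. case_sum a id (?s v)) \<phi>" .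
  qed (rule \<phi>(1))
qed

lemma dfn_reindex:
  assumes "dfn C I P" and "g ` I \<subseteq> I'" and "C \<subseteq> V"
  shows "dfn C I' (\<lambda>a. P (\<lambda>i. a (g i)))"
  using dfn_subst[OF assms(1) subset_refl, of "\<lambda>i. Inl (g i)" I'] assms(2,3) by auto

lemma dfn_param:
  assumes "dfn C (I <+> J) Q" and "b ` J \<subseteq> C" and "C \<subseteq> V"
  shows "dfn C I (\<lambda>a. Q (case_sum a b))"
proof -
  have eq: "(\<lambda>i. case_sum a id (case_sum Inl (\<lambda>j. Inr (b j)) i)) = case_sum a b" for a
    by (auto split: sum.split)
  have "case_sum Inl (\<lambda>j. Inr (b j)) ` (I <+> J) \<subseteq> I <+> C" using assms(2) by auto
  from dfn_subst[OF assms(1) subset_refl this assms(3)] show ?thesis unfolding eq .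
qed

text \<open>Parameters from \<open>D\<close> become variables indexed by themselves, so the original
  predicate is recovered at the identity family. A parameter that also lies in \<open>C\<close> is
  left in place.\<close>

lemma dfn_abstract:
  assumes "dfn (C \<union> D) I P"
  obtains Q where "dfn C (I <+> D) Q" and "\<And>a. a ` I \<subseteq> V \<Longrightarrow> P a \<longleftrightarrow> Q (case_sum a id)"
proof -
  from assms obtain \<phi> s where \<phi>: "wf_fm L \<phi>" "s ` fv \<phi> \<subseteq> I <+> (C \<union> D)"
    "\<And>a. a ` I \<subseteq> V \<Longrightarrow> P a \<longleftrightarrow> sat U (\<lambda>v. case_sum a id (s v)) \<phi>" by (rule dfnE) (rule that)
  let ?s = "\<lambda>v. case s v of Inl i \<Rightarrow> Inl (Inl i) | Inr c \<Rightarrow> if c \<in> C then Inr c else Inl (Inr c)"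
  let ?Q = "\<lambda>e. sat U (\<lambda>v. case_sum e id (?s v)) \<phi>"
  have "?s ` fv \<phi> \<subseteq> (I <+> D) <+> C"
    using \<phi>(2) by (auto simp: sum_image_subset_Plus split: sum.splits if_splits)
  then have "dfn C (I <+> D) ?Q" by (intro dfnI[OF \<phi>(1)]) auto
  moreover have "sat U (\<lambda>v. case_sum a id (s v)) \<phi> \<longleftrightarrow> ?Q (case_sum a id)" for a
    by (intro sat_cong) (auto split: sum.split)
  ultimately show ?thesis using that \<phi>(3) by blast
qed

section \<open>Closure of definable predicates under connectives and quantifiers\<close>

lemma dfn_not:
  assumes "dfn C I P" shows "dfn C I (\<lambda>a. \<not> P a)"
proof -
  from assms obtain \<phi> s where "wf_fm L \<phi>" "s ` fv \<phi> \<subseteq> I <+> C"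
    "\<And>a. a ` I \<subseteq> V \<Longrightarrow> P a \<longleftrightarrow> sat U (\<lambda>v. case_sum a id (s v)) \<phi>" by (rule dfnE) (rule that)
  then show ?thesis by (intro dfnI[of "Neg \<phi>" s]) auto
qed

lemma dfn_conj:
  assumes "dfn C I P" and "dfn C I Q" shows "dfn C I (\<lambda>a. P a \<and> Q a)"
proof -
  from assms(1) obtain \<phi> s where \<phi>: "wf_fm L \<phi>" "s ` fv \<phi> \<subseteq> I <+> C"
    "\<And>a. a ` I \<subseteq> V \<Longrightarrow> P a \<longleftrightarrow> sat U (\<lambda>v. case_sum a id (s v)) \<phi>" by (rule dfnE) (rule that)
  from assms(2) obtain \<psi> t where \<psi>: "wf_fm L \<psi>" "t ` fv \<psi> \<subseteq> I <+> C"
    "\<And>a. a ` I \<subseteq> V \<Longrightarrow> Q a \<longleftrightarrow> sat U (\<lambda>v. case_sum a id (t v)) \<psi>" by (rule dfnE) (rule that)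
  \<comment> \<open>Even variables carry the first formula and odd ones the second, so that one map
    can interpret both.\<close>
  let ?e = "\<lambda>n::nat. 2 * n" and ?o = "\<lambda>n::nat. Suc (2 * n)"
  have inj: "inj ?e" "inj ?o" by (auto simp: inj_def)
  let ?s = "\<lambda>n. if even n then s (n div 2) else t (n div 2)"
  have s: "?s (2 * n) = s n" "?s (2 * n + 1) = t n" for n by auto
  show ?thesis
  proof (rule dfnI[of "Conj (rename_fm ?e \<phi>) (rename_fm ?o \<psi>)" ?s])
    show "?s ` fv (Conj (rename_fm ?e \<phi>) (rename_fm ?o \<psi>)) \<subseteq> I <+> C"
      using \<phi>(2) \<psi>(2) by (auto simp: fv_rename_fm[OF inj(1)] fv_rename_fm[OF inj(2)] image_subset_iff)
    fix a assume a: "a ` I \<subseteq> V"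
    have "sat U (\<lambda>v. case_sum a id (?s v)) (rename_fm ?e \<phi>) \<longleftrightarrow> P a"
      unfolding sat_rename[OF inj(1)] \<phi>(3)[OF a] by (intro sat_cong) auto
    moreover have "sat U (\<lambda>v. case_sum a id (?s v)) (rename_fm ?o \<psi>) \<longleftrightarrow> Q a"
      unfolding sat_rename[OF inj(2)] \<psi>(3)[OF a] by (intro sat_cong) auto
    ultimately show "(P a \<and> Q a) \<longleftrightarrow>
        sat U (\<lambda>v. case_sum a id (?s v)) (Conj (rename_fm ?e \<phi>) (rename_fm ?o \<psi>))" by simp
  qed (use \<phi>(1) \<psi>(1) in simp)
qed

lemma dfn_imp:
  assumes "dfn C I P" and "dfn C I Q" shows "dfn C I (\<lambda>a. P a \<longrightarrow> Q a)"
  using dfn_not[OF dfn_conj[OF assms(1) dfn_not[OF assms(2)]]] by simp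

lemma dfn_iff:
  assumes "dfn C I P" and "dfn C I Q" shows "dfn C I (\<lambda>a. P a \<longleftrightarrow> Q a)"
  using dfn_conj[OF dfn_imp[OF assms] dfn_imp[OF assms(2,1)]] by (rule dfn_cong) blast

lemma dfn_True: "dfn C I (\<lambda>a. True)"
  using univ_nonempty by (intro dfnI[of "Ex 0 (Eq (Var 0) (Var 0))"]) auto

lemma dfn_const: "dfn C I (\<lambda>a. b)"
  using dfn_True[of C I] dfn_not[OF dfn_True[of C I]] by (cases b) auto

lemma dfn_ball:
  assumes "finite S" and "\<And>k. k \<in> S \<Longrightarrow> dfn C I (P k)" shows "dfn C I (\<lambda>a. \<forall>k\<in>S. P k a)"
  using assms
proof (induction S)
  case empty
  then show ?case by (simp add: dfn_True)
next
  case (insert k S)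
  then have "dfn C I (\<lambda>a. P k a \<and> (\<forall>k\<in>S. P k a))" by (intro dfn_conj) auto
  then show ?case by simp
qed

lemma dfn_bex:
  assumes "finite S" and "\<And>k. k \<in> S \<Longrightarrow> dfn C I (P k)" shows "dfn C I (\<lambda>a. \<exists>k\<in>S. P k a)"
  using dfn_not[OF dfn_ball[OF assms(1) dfn_not[OF assms(2)]]] by simp

lemma dfn_eq: "i \<in> I \<Longrightarrow> j \<in> I \<Longrightarrow> dfn C I (\<lambda>a. a i = a j)"
  by (intro dfnI[of "Eq (Var 0) (Var 1)" "\<lambda>v. if v = 0 then Inl i else Inl j"]) auto

lemma dfn_eq_param: "i \<in> I \<Longrightarrow> c \<in> C \<Longrightarrow> dfn C I (\<lambda>a. a i = c)"
  by (intro dfnI[of "Eq (Var 0) (Var 1)" "\<lambda>v. if v = 0 then Inl i else Inr c"]) auto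

text \<open>Prepares a quantifier over the coordinate \<open>i\<close>: several variables of the
  formula may stand for \<open>i\<close>, so they are merged into one fresh variable
  \<open>n\<close>.\<close>

lemma dfn_upd:
  assumes "dfn C I P"
  obtains \<psi> n s where "wf_fm L \<psi>" and "s ` (fv \<psi> - {n}) \<subseteq> (I - {i}) <+> C"
    and "\<And>a x. a ` (I - {i}) \<subseteq> V \<Longrightarrow> x \<in> V \<Longrightarrow>
      P (a(i := x)) \<longleftrightarrow> sat U ((\<lambda>v. case_sum a id (s v))(n := x)) \<psi>"
proof -
  from assms obtain \<phi> s where \<phi>: "wf_fm L \<phi>" "s ` fv \<phi> \<subseteq> I <+> C"
    "\<And>a. a ` I \<subseteq> V \<Longrightarrow> P a \<longleftrightarrow> sat U (\<lambda>v. case_sum a id (s v)) \<phi>" by (rule dfnE) (rule that)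
  let ?F = "{v \<in> fv \<phi>. s v = Inl i}"
  obtain n where n: "n \<notin> fv \<phi>" using finite_fv ex_new_if_finite infinite_UNIV_nat by blast
  have "finite ?F" "(\<lambda>_. n) ` ?F \<inter> ?F = {}" using n by auto
  from subst_vars[OF \<phi>(1) this, of U] obtain \<psi> where \<psi>: "wf_fm L \<psi>"
    "fv \<psi> \<subseteq> (fv \<phi> - ?F) \<union> (\<lambda>_. n) ` ?F"
    "\<And>e. e ` (\<lambda>_. n) ` ?F \<subseteq> V \<Longrightarrow> sat U e \<psi> \<longleftrightarrow> sat U (\<lambda>v. if v \<in> ?F then e n else e v) \<phi>"
    by blast
  have "P (a(i := x)) \<longleftrightarrow> sat U ((\<lambda>v. case_sum a id (s v))(n := x)) \<psi>" (is "_ \<longleftrightarrow> sat U ?e _")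
    if a: "a ` (I - {i}) \<subseteq> V" and x: "x \<in> V" for a x
  proof -
    have "sat U ?e \<psi> \<longleftrightarrow> sat U (\<lambda>v. if v \<in> ?F then ?e n else ?e v) \<phi>"
      using x by (intro \<psi>(3)) auto
    also have "\<dots> \<longleftrightarrow> sat U (\<lambda>v. case_sum (a(i := x)) id (s v)) \<phi>"
      using n by (intro sat_cong) (auto split: sum.split)
    also have "\<dots> \<longleftrightarrow> P (a(i := x))" using a x by (intro \<phi>(3)[symmetric]) auto
    finally show ?thesis by simp
  qed
  moreover have "s ` (fv \<psi> - {n}) \<subseteq> (I - {i}) <+> C"
    using \<psi>(2) \<phi>(2) by (auto simp: sum_image_subset_Plus)
  ultimately show ?thesis using that \<psi>(1) by blast
qed

lemma dfn_ex:
  assumes "dfn C I P"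
  shows "dfn C (I - {i}) (\<lambda>a. \<exists>x\<in>V. P (a(i := x)))"
proof -
  obtain \<psi> n s where \<psi>: "wf_fm L \<psi>" "s ` (fv \<psi> - {n}) \<subseteq> (I - {i}) <+> C"
    "\<And>a x. a ` (I - {i}) \<subseteq> V \<Longrightarrow> x \<in> V \<Longrightarrow>
      P (a(i := x)) \<longleftrightarrow> sat U ((\<lambda>v. case_sum a id (s v))(n := x)) \<psi>"
    by (rule dfn_upd[OF assms]) (rule that)
  show ?thesis
    by (rule dfnI[of "Ex n \<psi>" s]) (use \<psi> in auto)
qed

lemma dfn_support:
  assumes "dfn C I P"
  obtains F P' where "finite F" and "F \<subseteq> I" and "dfn C F P'" and "\<And>a. a ` I \<subseteq> V \<Longrightarrow> P a \<longleftrightarrow> P' a"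
proof -
  from assms obtain \<phi> s where \<phi>: "wf_fm L \<phi>" "s ` fv \<phi> \<subseteq> I <+> C"
    "\<And>a. a ` I \<subseteq> V \<Longrightarrow> P a \<longleftrightarrow> sat U (\<lambda>v. case_sum a id (s v)) \<phi>" by (rule dfnE) (rule that)
  let ?F = "{i. Inl i \<in> s ` fv \<phi>}"
  have "finite (Inl -` (s ` fv \<phi>))" by (intro finite_vimageI) auto
  then have "finite ?F" by (simp add: vimage_def)
  moreover have "?F \<subseteq> I" using \<phi>(2) by auto
  moreover have "dfn C ?F (\<lambda>a. sat U (\<lambda>v. case_sum a id (s v)) \<phi>)"
    using \<phi>(1,2) by (intro dfnI[of \<phi> s]) (auto simp: sum_image_subset_Plus, metis imageI)
  ultimately show ?thesis using that \<phi>(3) by blast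
qed

text \<open>Infinitely many coordinates can be quantified away because only the finitely many in the
  support need a quantifier; the others receive an arbitrary element of the nonempty
  universe.\<close>

lemma dfn_proj:
  assumes P: "dfn C I P" and J: "J \<subseteq> I"
  shows "dfn C J (\<lambda>a. \<exists>b. b ` I \<subseteq> V \<and> (\<forall>j\<in>J. b j = a j) \<and> P b)"
proof -
  have *: "dfn C (F - G) (\<lambda>a. \<exists>b. b ` F \<subseteq> V \<and> (\<forall>j\<in>F - G. b j = a j) \<and> P b)"
    if "dfn C F P" "finite G" for F G and P :: "('b \<Rightarrow> 'a) \<Rightarrow> bool"
    using that(2)
  proof (induction G)
    case empty
    show ?case
    proof (rule dfn_cong)
      show "dfn C (F - {}) P" using that(1) by simp
      fix a :: "'b \<Rightarrow> 'a" assume "a ` (F - {}) \<subseteq> V"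
      then have a: "a ` F \<subseteq> V" by simp
      have "P a" if "b ` F \<subseteq> V" "\<forall>j\<in>F. b j = a j" "P b" for b
        using dfn_same[OF \<open>dfn C F P\<close>, of b a] that by simp
      then show "P a \<longleftrightarrow> (\<exists>b. b ` F \<subseteq> V \<and> (\<forall>j\<in>F - {}. b j = a j) \<and> P b)"
        using a by auto
    qed
  next
    case (insert i G)
    from dfn_ex[OF insert.IH, of i]
    have "dfn C (F - insert i G)
        (\<lambda>a. \<exists>x\<in>V. \<exists>b. b ` F \<subseteq> V \<and> (\<forall>j\<in>F - G. b j = (a(i := x)) j) \<and> P b)"
      by (simp add: Diff_insert[symmetric] del: fun_upd_apply)
    then show ?case
    proof (rule dfn_cong)
      fix a :: "'b \<Rightarrow> 'a" assume "a ` (F - insert i G) \<subseteq> V"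
      obtain v where v: "v \<in> V" using univ_nonempty by auto
      show "(\<exists>x\<in>V. \<exists>b. b ` F \<subseteq> V \<and> (\<forall>j\<in>F - G. b j = (a(i := x)) j) \<and> P b) \<longleftrightarrow>
          (\<exists>b. b ` F \<subseteq> V \<and> (\<forall>j\<in>F - insert i G. b j = a j) \<and> P b)" (is "?l \<longleftrightarrow> ?r")
      proof
        assume ?l
        then obtain x b where b: "b ` F \<subseteq> V" "\<forall>j\<in>F - G. b j = (a(i := x)) j" "P b" by blast
        then have "\<forall>j\<in>F - insert i G. b j = a j" by auto
        then show ?r using b by blast
      next
        assume ?r
        then obtain b where b: "b ` F \<subseteq> V" "\<forall>j\<in>F - insert i G. b j = a j" "P b" by blast
        show ?l
          using b v by (intro bexI[of _ "if i \<in> F then b i else v"] exI[of _ b]) auto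
      qed
    qed
  qed
  from P obtain F P' where F: "finite F" "F \<subseteq> I" "dfn C F P'"
    "\<And>a. a ` I \<subseteq> V \<Longrightarrow> P a \<longleftrightarrow> P' a" using dfn_support by blast
  from *[OF F(3), of "F - J"] F(1) have
    "dfn C (F - (F - J)) (\<lambda>a. \<exists>b. b ` F \<subseteq> V \<and> (\<forall>j\<in>F - (F - J). b j = a j) \<and> P' b)" by simp
  then have "dfn C J (\<lambda>a. \<exists>b. b ` F \<subseteq> V \<and> (\<forall>j\<in>F - (F - J). b j = a j) \<and> P' b)"
    by (rule dfn_mono) auto
  then show ?thesis
  proof (rule dfn_cong)
    fix a :: "'b \<Rightarrow> 'a" assume a: "a ` J \<subseteq> V"
    obtain v where v: "v \<in> V" using univ_nonempty by auto
    show "(\<exists>b. b ` F \<subseteq> V \<and> (\<forall>j\<in>F - (F - J). b j = a j) \<and> P' b) \<longleftrightarrow>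
        (\<exists>b. b ` I \<subseteq> V \<and> (\<forall>j\<in>J. b j = a j) \<and> P b)" (is "?l \<longleftrightarrow> ?r")
    proof
      assume ?l
      then obtain b where b: "b ` F \<subseteq> V" "\<forall>j\<in>F - (F - J). b j = a j" "P' b" by blast
      let ?b = "\<lambda>i. if i \<in> J then a i else if i \<in> F then b i else v"
      have I: "?b ` I \<subseteq> V" using a b(1) v by auto
      have "P' b \<longleftrightarrow> P' ?b" using b(1,2) by (intro dfn_same[OF F(3)]) auto
      then have "P ?b" using b(3) F(4) I by blast
      then show ?r using I by (intro exI[of _ ?b]) auto
    next
      assume ?r
      then obtain b where b: "b ` I \<subseteq> V" "\<forall>j\<in>J. b j = a j" "P b" by blast
      then show ?l using F(2,4) by (intro exI[of _ b]) auto
    qed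
  qed
qed

lemma dfn_ex_family:
  assumes "dfn C (I <+> J) Q" and "C \<subseteq> V"
  shows "dfn C I (\<lambda>a. \<exists>b. b ` J \<subseteq> V \<and> Q (case_sum a b))"
proof -
  have "dfn C (Inl ` I) (\<lambda>a. \<exists>b. b ` (I <+> J) \<subseteq> V \<and> (\<forall>j\<in>Inl ` I. b j = a j) \<and> Q b)"
    by (rule dfn_proj[OF assms(1)]) (auto simp: Plus_def)
  from dfn_reindex[OF this, of projl I] assms(2)
  have "dfn C I (\<lambda>a. \<exists>b. b ` (I <+> J) \<subseteq> V \<and> (\<forall>j\<in>Inl ` I. b j = a (projl j)) \<and> Q b)"
    by (simp only: image_image sum.sel image_ident subset_refl)
  then show ?thesis
  proof (rule dfn_cong)
    fix a assume a: "a ` I \<subseteq> V"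
    show "(\<exists>b. b ` (I <+> J) \<subseteq> V \<and> (\<forall>j\<in>Inl ` I. b j = a (projl j)) \<and> Q b) \<longleftrightarrow>
        (\<exists>b. b ` J \<subseteq> V \<and> Q (case_sum a b))" (is "?l \<longleftrightarrow> ?r")
    proof
      assume ?l
      then obtain b where b: "b ` (I <+> J) \<subseteq> V" "\<forall>j\<in>Inl ` I. b j = a (projl j)" "Q b" by blast
      have "Q b \<longleftrightarrow> Q (case_sum a (\<lambda>j. b (Inr j)))"
        using b(1,2) by (intro dfn_same[OF assms(1)]) (auto simp: Plus_def)
      then show ?r using b by (intro exI[of _ "\<lambda>j. b (Inr j)"]) (auto simp: Plus_def)
    next
      assume ?r
      then obtain b where "b ` J \<subseteq> V" "Q (case_sum a b)" by blast
      then show ?l using a by (intro exI[of _ "case_sum a b"]) auto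
    qed
  qed
qed

section \<open>Elementary substructures and the Tarski-Vaught test\<close>

lemma elem_subset: "elem_sub L U M \<Longrightarrow> M \<subseteq> V"
  by (simp add: elem_sub_def)

lemma elem_nonempty: "elem_sub L U M \<Longrightarrow> M \<noteq> {}"
  by (simp add: elem_sub_def is_struct_def)

lemma elem_witness_one:
  assumes M: "elem_sub L U M" and P: "dfn M I P" and a: "a ` (I - {i}) \<subseteq> M"
    and x: "x \<in> V" "P (a(i := x))"
  shows "\<exists>x\<in>M. P (a(i := x))"
proof -
  obtain m where m: "m \<in> M" using elem_nonempty[OF M] by auto
  have MV: "M \<subseteq> V" using M by (rule elem_subset)
  obtain \<psi> n s where \<psi>: "wf_fm L \<psi>" "s ` (fv \<psi> - {n}) \<subseteq> (I - {i}) <+> M"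
    "\<And>a x. a ` (I - {i}) \<subseteq> V \<Longrightarrow> x \<in> V \<Longrightarrow>
      P (a(i := x)) \<longleftrightarrow> sat U ((\<lambda>v. case_sum a id (s v))(n := x)) \<psi>"
    by (rule dfn_upd[OF P]) (rule that)
  \<comment> \<open>\<open>elem_sub\<close> asks for an environment with all its values in
    \<open>M\<close>, so irrelevant variables get the dummy value \<open>m\<close>.\<close>
  let ?e = "\<lambda>v. if v \<in> fv \<psi> - {n} then case_sum a id (s v) else m"
  have e: "range ?e \<subseteq> M" using case_sum_in[OF _ a subset_refl] \<psi>(2) m by auto
  have eq: "P (a(i := x)) \<longleftrightarrow> sat U (?e(n := x)) \<psi>" if "x \<in> V" for x
  proof -
    have "P (a(i := x)) \<longleftrightarrow> sat U ((\<lambda>v. case_sum a id (s v))(n := x)) \<psi>"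
      using a MV that by (intro \<psi>(3)) auto
    also have "\<dots> \<longleftrightarrow> sat U (?e(n := x)) \<psi>" by (intro sat_cong) auto
    finally show ?thesis .
  qed
  have "sat U ?e (Ex n \<psi>)" using x eq by auto
  moreover have "wf_fm L (Ex n \<psi>)" using \<psi>(1) by simp
  ultimately have "sat (U\<lparr>univ := M\<rparr>) ?e (Ex n \<psi>)"
    using M e unfolding elem_sub_def by blast
  then obtain y where y: "y \<in> M" "sat (U\<lparr>univ := M\<rparr>) (?e(n := y)) \<psi>" by auto
  have "range (?e(n := y)) \<subseteq> M" using e y(1) by auto
  then have "sat U (?e(n := y)) \<psi>"
    using M \<psi>(1) y(2) unfolding elem_sub_def by blast
  then show ?thesis using eq[of y] y(1) MV by blast
qed

text \<open>Within the finite support, coordinates are chosen one at a time: the induction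
  hypothesis is applied to the predicate with the coordinate \<open>i\<close> quantified, and
  \<open>i\<close> is then filled in from \<open>M\<close>.\<close>

lemma elem_witness:
  assumes M: "elem_sub L U M" and P: "dfn M I P" and a: "a ` I \<subseteq> V" "P a"
  obtains m where "m ` I \<subseteq> M" and "P m"
proof -
  have MV: "M \<subseteq> V" using M by (rule elem_subset)
  have *: "\<exists>m. m ` F \<subseteq> M \<and> P m"
    if "finite F" "dfn M F P" "a ` F \<subseteq> V" "P a" for F P and a :: "'b \<Rightarrow> 'a"
    using that
  proof (induction F arbitrary: P a)
    case empty
    then show ?case by auto
  next
    case (insert i F)
    have "insert i F - {i} = F" using insert.hyps by auto
    then have "dfn M F (\<lambda>a. \<exists>x\<in>V. P (a(i := x)))"
      using dfn_ex[OF insert.prems(1), of i] by (simp only:)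
    moreover have "\<exists>x\<in>V. P (a(i := x))"
      using insert.prems by (intro bexI[of _ "a i"]) auto
    ultimately obtain m x where m: "m ` F \<subseteq> M" "x \<in> V" "P (m(i := x))"
      using insert.IH[of "\<lambda>a. \<exists>x\<in>V. P (a(i := x))" a] insert.prems by auto
    have "m ` (insert i F - {i}) \<subseteq> M" using m(1) insert.hyps by auto
    from elem_witness_one[OF M insert.prems(1) this m(2,3)]
    obtain y where y: "y \<in> M" "P (m(i := y))" by blast
    have "(m(i := y)) ` insert i F \<subseteq> M" using y(1) m(1) by auto
    then show ?case using y(2) by blast
  qed
  from P obtain F P' where F: "finite F" "F \<subseteq> I" "dfn M F P'"
    "\<And>a. a ` I \<subseteq> V \<Longrightarrow> P a \<longleftrightarrow> P' a" using dfn_support by blast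
  then obtain m where m: "m ` F \<subseteq> M" "P' m" using *[OF F(1,3), of a] a by blast
  obtain z where z: "z \<in> M" using elem_nonempty[OF M] by auto
  let ?m = "\<lambda>i. if i \<in> F then m i else z"
  have I: "?m ` I \<subseteq> M" using m(1) z by auto
  have "P' m \<longleftrightarrow> P' ?m" using m(1) MV by (intro dfn_same[OF F(3)]) auto
  then have "P ?m" using m(2) F(4)[of ?m] I MV by blast
  then show ?thesis using that I by blast
qed

lemma elem_all:
  assumes M: "elem_sub L U M" and P: "dfn M I P" and m: "\<And>m. m ` I \<subseteq> M \<Longrightarrow> P m" and a: "a ` I \<subseteq> V"
  shows "P a"
proof (rule ccontr)
  assume "\<not> P a"
  from elem_witness[OF M dfn_not[OF P] a this] m show False by blast
qed

lemma tarski_vaught: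
  assumes MV: "M \<subseteq> V" and ne: "M \<noteq> {}"
    and wit: "\<And>\<phi> n e. wf_fm L \<phi> \<Longrightarrow> range e \<subseteq> M \<Longrightarrow> \<exists>x\<in>V. sat U (e(n := x)) \<phi> \<Longrightarrow>
      \<exists>x\<in>M. sat U (e(n := x)) \<phi>"
  shows "elem_sub L U M"
proof -
  have ev: "eval (U\<lparr>univ := M\<rparr>) e t = eval U e t" for e t
    by (induction t) (auto cong: map_cong)
  have sat: "sat (U\<lparr>univ := M\<rparr>) e \<phi> \<longleftrightarrow> sat U e \<phi>" if "wf_fm L \<phi>" "range e \<subseteq> M" for \<phi> e
    using that
  proof (induction \<phi> arbitrary: e)
    case (Ex n \<phi>)
    have "sat (U\<lparr>univ := M\<rparr>) (e(n := x)) \<phi> \<longleftrightarrow> sat U (e(n := x)) \<phi>" if "x \<in> M" for x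
      using Ex.prems that by (intro Ex.IH) auto
    moreover have "(\<exists>x\<in>V. sat U (e(n := x)) \<phi>) \<longleftrightarrow> (\<exists>x\<in>M. sat U (e(n := x)) \<phi>)"
      using wit[of \<phi> e n] Ex.prems MV by auto
    ultimately show ?case by (auto simp del: fun_upd_apply)
  next
    case (Eq s t)
    then show ?case by (simp add: ev)
  next
    case (Rel r ts)
    show ?case by (simp add: ev cong: map_cong)
  qed auto
  have "fint U f xs \<in> M" if f: "f \<in> funs L" "xs \<in> lists M" "length xs = farity L f" for f xs
  proof -
    obtain z where z: "z \<in> M" using ne by auto
    let ?k = "length xs" and ?e = "\<lambda>v. if v < length xs then xs ! v else z"
    \<comment> \<open>Closure under functions is another instance of the witness property: the value
      of \<open>f\<close> at \<open>xs\<close> is the only solution of this equation.\<close>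
    let ?\<phi> = "Eq (Var ?k) (App f (map Var [0..<?k]))"
    have "wf_fm L ?\<phi>" using f by auto
    moreover have e: "range ?e \<subseteq> M" using f(2) z by (auto simp: in_lists_conv_set)
    moreover have sat: "sat U (?e(?k := x)) ?\<phi> \<longleftrightarrow> x = fint U f xs" for x
    proof -
      have "map (eval U (?e(?k := x))) (map Var [0..<?k]) = xs"
        by (rule nth_equalityI) auto
      then show ?thesis by (simp del: map_map)
    qed
    moreover have "fint U f xs \<in> V"
    proof -
      have "xs \<in> lists V" using f(2) MV by (auto simp: in_lists_conv_set)
      then show ?thesis using is_struct f(1,3) unfolding is_struct_def by blast
    qed
    ultimately show ?thesis using wit[of ?\<phi> ?e ?k] by auto
  qed
  then show ?thesis using MV ne sat unfolding elem_sub_def is_struct_def by auto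
qed

end

subsection \<open>Loewenheim-Skolem and elementary maps\<close>

lemma finite_bound:
  assumes r: "Cinfinite r" and A: "finite A"
  shows "|A| <o r"
  using A ordLess_ordLeq_trans[OF _ natLeq_ordLeq_cinfinite[OF r]]
  by (simp add: finite_iff_ordLess_natLeq)

lemma nat_bound:
  assumes "Cinfinite r" shows "|UNIV :: nat set| \<le>o r"
  using ordIso_ordLeq_trans[OF card_of_nat natLeq_ordLeq_cinfinite[OF assms]] .

lemma card_lists_bound:
  assumes r: "Cinfinite r" and A: "|A| \<le>o r"
  shows "|lists A| \<le>o r"
proof -
  have len: "|{l \<in> lists A. length l = n}| \<le>o r" for n
  proof (induction n)
    case 0
    have "{l \<in> lists A. length l = 0} = {[]}" by auto
    then show ?case using ordLess_imp_ordLeq[OF finite_bound[OF r, of "{[]}"]] by simp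
  next
    case (Suc n)
    let ?X = "{l \<in> lists A. length l = n}"
    have "{l \<in> lists A. length l = Suc n} = (\<lambda>(x, l). x # l) ` (A \<times> ?X)"
      by (auto simp: image_iff length_Suc_conv Cons_in_lists_iff)
    moreover have "|A \<times> ?X| \<le>o r"
      using r A Suc card_of_Times_ordLeq_infinite_Field unfolding cinfinite_def by blast
    from ordLeq_transitive[OF card_of_image this]
    have "|(\<lambda>(x, l). x # l) ` (A \<times> ?X)| \<le>o r" .
    ultimately show ?case by simp
  qed
  have "lists A = (\<Union>n\<in>UNIV. {l \<in> lists A. length l = n})" by auto
  then show ?thesis using UNION_Cinfinite_bound[OF nat_bound[OF r] _ r, of "\<lambda>n. {l \<in> lists A. length l = n}"] len
    by simp
qed

lemma infinite_wf_fms: "infinite {\<phi>. wf_fm L \<phi>}"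
proof -
  have "inj (\<lambda>n. Eq (Var n) (Var n))" by (auto simp: inj_def)
  then have "infinite (range (\<lambda>n. Eq (Var n) (Var n)))" using range_inj_infinite by blast
  moreover have "range (\<lambda>n. Eq (Var n) (Var n)) \<subseteq> {\<phi>. wf_fm L \<phi>}" by auto
  ultimately show ?thesis using finite_subset by blast
qed

context first_order_structure
begin

lemma downward_loewenheim_skolem:
  assumes r: "Cinfinite r" and C: "|C| \<le>o r" "C \<subseteq> V" and Fm: "|{\<phi>. wf_fm L \<phi>}| \<le>o r"
  obtains M where "elem_sub L U M" and "C \<subseteq> M" and "|M| \<le>o r"
proof -
  obtain z where z: "z \<in> V" using univ_nonempty by auto
  \<comment> \<open>Finite lists code environments, with the dummy value \<open>z\<close> beyond the
    list. \<open>W\<close> below is a Skolem function for all formulas at once.\<close>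
  define env where "env = (\<lambda>l v. if v < length l then l ! v else z)"
  define W where "W = (\<lambda>(\<phi>, n, l). if \<exists>x\<in>V. sat U ((env l)(n := x)) \<phi>
      then SOME x. x \<in> V \<and> sat U ((env l)(n := x)) \<phi> else z)"
  have W: "W (\<phi>, n, l) \<in> V" "\<exists>x\<in>V. sat U ((env l)(n := x)) \<phi> \<Longrightarrow> sat U ((env l)(n := W (\<phi>, n, l))) \<phi>"
    for \<phi> n l
  proof -
    have "W (\<phi>, n, l) \<in> V \<and> ((\<exists>x\<in>V. sat U ((env l)(n := x)) \<phi>) \<longrightarrow>
        sat U ((env l)(n := W (\<phi>, n, l))) \<phi>)"
    proof (cases "\<exists>x\<in>V. sat U ((env l)(n := x)) \<phi>")
      case True
      then have "\<exists>x. x \<in> V \<and> sat U ((env l)(n := x)) \<phi>" by blast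
      from someI_ex[OF this] True show ?thesis by (simp add: W_def)
    next
      case False
      then show ?thesis using z by (simp add: W_def)
    qed
    then show "W (\<phi>, n, l) \<in> V" "\<exists>x\<in>V. sat U ((env l)(n := x)) \<phi> \<Longrightarrow>
        sat U ((env l)(n := W (\<phi>, n, l))) \<phi>" by blast+
  qed
  define S where "S = (\<lambda>X. X \<union> W ` ({\<phi>. wf_fm L \<phi>} \<times> UNIV \<times> lists X))"
  define X where "X = (\<lambda>k. (S ^^ k) (insert z C))"
  have X0: "X 0 = insert z C" and XS: "X (Suc k) = S (X k)" for k by (simp_all add: X_def)
  have mono: "X j \<subseteq> X k" if "j \<le> k" for j k
    using that by (rule lift_Suc_mono_le[rotated]) (auto simp: XS S_def)
  have sing: "|{z}| \<le>o r" by (rule ordLess_imp_ordLeq[OF finite_bound[OF r]]) simp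
  note nat = nat_bound[OF r]
  have card: "|X k| \<le>o r" for k
  proof (induction k)
    case 0
    show ?case using Un_Cinfinite_bound[OF sing C(1) r] by (simp add: X0)
  next
    case (Suc k)
    have "|UNIV \<times> lists (X k) :: (nat \<times> 'a list) set| \<le>o r"
      using r nat card_lists_bound[OF r Suc] card_of_Times_ordLeq_infinite_Field
      unfolding cinfinite_def by blast
    then have "|{\<phi>. wf_fm L \<phi>} \<times> (UNIV :: nat set) \<times> lists (X k)| \<le>o r"
      using r Fm card_of_Times_ordLeq_infinite_Field unfolding cinfinite_def by blast
    then have "|W ` ({\<phi>. wf_fm L \<phi>} \<times> UNIV \<times> lists (X k))| \<le>o r"
      using card_of_image ordLeq_transitive by blast
    then show ?case using Un_Cinfinite_bound[OF Suc _ r] by (simp add: XS S_def)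
  qed
  define M where "M = (\<Union>k. X k)"
  have "|M| \<le>o r" unfolding M_def using card by (intro UNION_Cinfinite_bound[OF nat _ r]) auto
  moreover have "C \<subseteq> M" using X0 unfolding M_def by blast
  moreover have "elem_sub L U M"
  proof (rule tarski_vaught)
    have "X k \<subseteq> V" for k
      by (induction k) (use z C(2) W(1) in \<open>auto simp: X0 XS S_def\<close>)
    then show "M \<subseteq> V" unfolding M_def by blast
    show "M \<noteq> {}" using X0 unfolding M_def by blast
    fix \<phi> n e assume \<phi>: "wf_fm L \<phi>" "range e \<subseteq> M" "\<exists>x\<in>V. sat U (e(n := x)) \<phi>"
    obtain N where N: "\<And>v. v \<in> fv \<phi> \<Longrightarrow> v < N"
      using finite_nat_set_iff_bounded[of "fv \<phi>"] by auto
    let ?l = "map e [0..<N]"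
    have "\<exists>k. \<forall>v < N'. e v \<in> X k" for N'
    proof (induction N')
      case (Suc N')
      then obtain k where "\<forall>v < N'. e v \<in> X k" by blast
      moreover obtain k' where "e N' \<in> X k'" using \<phi>(2) unfolding M_def by blast
      moreover have "X k \<subseteq> X (max k k')" "X k' \<subseteq> X (max k k')" by (auto intro!: mono)
      ultimately show ?case by (intro exI[of _ "max k k'"]) (auto simp: less_Suc_eq)
    qed simp
    then obtain k where k: "\<forall>v < N. e v \<in> X k" by blast
    have eq: "sat U (e(n := x)) \<phi> \<longleftrightarrow> sat U ((env ?l)(n := x)) \<phi>" for x
      by (intro sat_cong) (auto simp: env_def dest: N)
    have "\<exists>x\<in>V. sat U ((env ?l)(n := x)) \<phi>" using \<phi>(3) unfolding eq .
    then have "sat U (e(n := W (\<phi>, n, ?l))) \<phi>" using W(2) unfolding eq by blast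
    moreover have "W (\<phi>, n, ?l) \<in> X (Suc k)"
      using k \<phi>(1) by (auto simp: XS S_def in_lists_conv_set)
    ultimately show "\<exists>x\<in>M. sat U (e(n := x)) \<phi>" unfolding M_def by blast
  qed
  ultimately show ?thesis using that by blast
qed

section \<open>Partial elementary maps\<close>

definition emap :: "'a set \<Rightarrow> ('a \<Rightarrow> 'a) \<Rightarrow> bool" where
  "emap X f \<longleftrightarrow> X \<subseteq> V \<and> f ` X \<subseteq> V \<and>
     (\<forall>\<phi> s. wf_fm L \<phi> \<and> s ` fv \<phi> \<subseteq> X \<longrightarrow> (sat U s \<phi> \<longleftrightarrow> sat U (\<lambda>v. f (s v)) \<phi>))"

lemma emapD: "emap X f \<Longrightarrow> X \<subseteq> V" "emap X f \<Longrightarrow> f ` X \<subseteq> V"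
  "emap X f \<Longrightarrow> wf_fm L \<phi> \<Longrightarrow> s ` fv \<phi> \<subseteq> X \<Longrightarrow> sat U s \<phi> \<longleftrightarrow> sat U (\<lambda>v. f (s v)) \<phi>"
  by (auto simp: emap_def)

lemma emap_dfn:
  assumes f: "emap X f" "\<And>c. c \<in> C \<Longrightarrow> f c = c" "C \<subseteq> X" and P: "dfn C I P" and a: "a ` I \<subseteq> X"
  shows "P a \<longleftrightarrow> P (\<lambda>i. f (a i))"
proof -
  from P obtain \<phi> s where \<phi>: "wf_fm L \<phi>" "s ` fv \<phi> \<subseteq> I <+> C"
    "\<And>a. a ` I \<subseteq> V \<Longrightarrow> P a \<longleftrightarrow> sat U (\<lambda>v. case_sum a id (s v)) \<phi>" by (rule dfnE) (rule that)
  have "(\<lambda>v. case_sum a id (s v)) ` fv \<phi> \<subseteq> X"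
    using case_sum_in[OF _ a f(3)] \<phi>(2) by blast
  then have "sat U (\<lambda>v. case_sum a id (s v)) \<phi> \<longleftrightarrow> sat U (\<lambda>v. f (case_sum a id (s v))) \<phi>"
    by (rule emapD(3)[OF f(1) \<phi>(1)])
  also have "\<dots> \<longleftrightarrow> sat U (\<lambda>v. case_sum (\<lambda>i. f (a i)) id (s v)) \<phi>"
    using \<phi>(2) f(2) by (intro sat_cong) (auto simp: sum_image_subset_Plus split: sum.split)
  also have "\<dots> \<longleftrightarrow> P (\<lambda>i. f (a i))" using a emapD(2)[OF f(1)] by (intro \<phi>(3)[symmetric]) auto
  finally show ?thesis using \<phi>(3)[of a] a emapD(1)[OF f(1)] by auto
qed

lemma emap_subset: "emap X f \<Longrightarrow> Y \<subseteq> X \<Longrightarrow> emap Y f"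
  unfolding emap_def by (meson image_mono order_trans)

lemma emap_cong:
  assumes f: "emap X f" and g: "\<And>x. x \<in> X \<Longrightarrow> f x = g x"
  shows "emap X g"
proof -
  have "sat U s \<phi> \<longleftrightarrow> sat U (\<lambda>v. g (s v)) \<phi>" if "wf_fm L \<phi>" "s ` fv \<phi> \<subseteq> X" for \<phi> s
  proof -
    have "sat U s \<phi> \<longleftrightarrow> sat U (\<lambda>v. f (s v)) \<phi>" using emapD(3)[OF f that] .
    also have "\<dots> \<longleftrightarrow> sat U (\<lambda>v. g (s v)) \<phi>" using that(2) g by (intro sat_cong) auto
    finally show ?thesis .
  qed
  then show ?thesis using f g by (auto simp: emap_def)
qed

lemma emap_comp:
  assumes f: "emap X f" and g: "emap (f ` X) g"
  shows "emap X (\<lambda>x. g (f x))"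
proof -
  have "sat U s \<phi> \<longleftrightarrow> sat U (\<lambda>v. g (f (s v))) \<phi>" if "wf_fm L \<phi>" "s ` fv \<phi> \<subseteq> X" for \<phi> s
    using emapD(3)[OF f that] emapD(3)[OF g that(1), of "\<lambda>v. f (s v)"] that(2) by auto
  then show ?thesis using emapD(1)[OF f] emapD(2)[OF g] by (auto simp: emap_def)
qed

lemma emap_inj:
  assumes f: "emap X f" shows "inj_on f X"
proof (rule inj_onI)
  fix x y assume xy: "x \<in> X" "y \<in> X" "f x = f y"
  have "sat U (\<lambda>v. if v = 0 then x else y) (Eq (Var 0) (Var 1)) \<longleftrightarrow>
      sat U (\<lambda>v. f (if v = 0 then x else y)) (Eq (Var 0) (Var 1))"
    using xy by (intro emapD(3)[OF f]) auto
  then show "x = y" using xy(3) by simp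
qed

lemma emap_inv:
  assumes f: "emap X f"
  shows "emap (f ` X) (inv_into X f)"
proof -
  have i: "inj_on f X" using f by (rule emap_inj)
  have "sat U s \<phi> \<longleftrightarrow> sat U (\<lambda>v. inv_into X f (s v)) \<phi>"
    if "wf_fm L \<phi>" "s ` fv \<phi> \<subseteq> f ` X" for \<phi> s
  proof -
    have "(\<lambda>v. inv_into X f (s v)) ` fv \<phi> \<subseteq> X" using that(2) by (auto intro!: inv_into_into)
    from emapD(3)[OF f that(1) this]
    have "sat U (\<lambda>v. inv_into X f (s v)) \<phi> \<longleftrightarrow> sat U (\<lambda>v. f (inv_into X f (s v))) \<phi>" .
    also have "\<dots> \<longleftrightarrow> sat U s \<phi>"
      using that(2) by (intro sat_cong) (auto simp: f_inv_into_f)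
    finally show ?thesis by simp
  qed
  then show ?thesis using emapD(1,2)[OF f] i by (auto simp: emap_def)
qed

text \<open>An environment in the image is pulled back to \<open>M\<close>; the image of a witness
  found there is a witness.\<close>

lemma emap_elem_sub:
  assumes f: "emap X f" and M: "elem_sub L U M" "M \<subseteq> X"
  shows "elem_sub L U (f ` M)"
proof (rule tarski_vaught)
  show "f ` M \<subseteq> V" using emapD(2)[OF f] M(2) by blast
  show "f ` M \<noteq> {}" using elem_nonempty[OF M(1)] by blast
  fix \<phi> n e assume \<phi>: "wf_fm L \<phi>" "range e \<subseteq> f ` M" "\<exists>x\<in>V. sat U (e(n := x)) \<phi>"
  have "\<forall>v. \<exists>m\<in>M. e v = f m" using \<phi>(2) by blast
  then obtain d where d: "\<And>v. d v \<in> M" "\<And>v. e v = f (d v)" by metis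
  have sub: "s ` fv \<psi> \<subseteq> X" if "range s \<subseteq> M" for s and \<psi> :: "('f, 'r) fm"
    using that M(2) by blast
  have rd: "range d \<subseteq> M" using d(1) by blast
  have ed: "e = (\<lambda>v. f (d v))" using d(2) by blast
  have "wf_fm L (Ex n \<phi>)" using \<phi>(1) by simp
  from emapD(3)[OF f this sub[OF rd]]
  have "sat U d (Ex n \<phi>)" using \<phi>(3) by (simp only: ed sat.simps)
  then have "sat (U\<lparr>univ := M\<rparr>) d (Ex n \<phi>)"
    using M(1) rd \<phi>(1) unfolding elem_sub_def by (metis wf_fm.simps(5))
  then obtain m where m: "m \<in> M" "sat (U\<lparr>univ := M\<rparr>) (d(n := m)) \<phi>" by auto
  have rm: "range (d(n := m)) \<subseteq> M" using rd m(1) by auto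
  then have "sat U (d(n := m)) \<phi>" using M(1) m(2) \<phi>(1) unfolding elem_sub_def by blast
  then have "sat U (\<lambda>v. f ((d(n := m)) v)) \<phi>" using emapD(3)[OF f \<phi>(1) sub[OF rm]] by blast
  moreover have "(\<lambda>v. f ((d(n := m)) v)) = e(n := f m)" using d(2) by auto
  ultimately show "\<exists>x\<in>f ` M. sat U (e(n := x)) \<phi>" using m(1) by auto
qed

lemma same_type_dfn:
  assumes "same_type L U C I a a'" and P: "dfn C I P" and "a ` I \<subseteq> V" "a' ` I \<subseteq> V"
  shows "P a \<longleftrightarrow> P a'"
proof -
  from P obtain \<phi> s where \<phi>: "wf_fm L \<phi>" "s ` fv \<phi> \<subseteq> I <+> C"
    "\<And>a. a ` I \<subseteq> V \<Longrightarrow> P a \<longleftrightarrow> sat U (\<lambda>v. case_sum a id (s v)) \<phi>" by (rule dfnE) (rule that)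
  then show ?thesis using assms unfolding same_type_def by simp
qed

lemma same_typeI:
  assumes "\<And>P. dfn C I P \<Longrightarrow> P a \<Longrightarrow> P a'"
  shows "same_type L U C I a a'"
  unfolding same_type_def
proof (intro allI impI)
  fix \<phi> s assume \<phi>: "wf_fm L \<phi> \<and> s ` fv \<phi> \<subseteq> I <+> C"
  let ?P = "\<lambda>a. sat U (\<lambda>v. case_sum a id (s v)) \<phi>"
  have P: "dfn C I ?P" using \<phi> by (intro dfnI[of \<phi> s]) auto
  show "?P a \<longleftrightarrow> ?P a'" using assms[OF P] assms[OF dfn_not[OF P]] by blast
qed

lemma emap_same_type:
  assumes "emap X f" "\<And>c. c \<in> C \<Longrightarrow> f c = c" "C \<subseteq> X" "a ` I \<subseteq> X"
  shows "same_type L U C I a (\<lambda>i. f (a i))"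
  using emap_dfn[OF assms(1-3) _ assms(4)] by (intro same_typeI) blast

text \<open>Equality is expressible, so \<open>a i = a j\<close> forces \<open>a' i = a' j\<close>,
  and \<open>a i\<close> in \<open>C\<close> forces \<open>a' i = a i\<close>. Hence the
  correspondence of the two families is a well-defined map that fixes \<open>C\<close>.\<close>

lemma same_type_emap:
  assumes st: "same_type L U C I a a'" and a: "a ` I \<subseteq> V" "a' ` I \<subseteq> V" and C: "C \<subseteq> V"
  obtains f where "emap (C \<union> a ` I) f" and "\<And>c. c \<in> C \<Longrightarrow> f c = c" and "\<And>i. i \<in> I \<Longrightarrow> f (a i) = a' i"
proof -
  define ix where "ix = (\<lambda>x. SOME i. i \<in> I \<and> a i = x)"
  have ix: "ix (a i) \<in> I" "a (ix (a i)) = a i" if "i \<in> I" for i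
    using someI[of "\<lambda>j. j \<in> I \<and> a j = a i" i] that by (auto simp: ix_def)
  define f where "f = (\<lambda>x. if x \<in> C then x else a' (ix x))"
  have fi: "f (a i) = a' i" if i: "i \<in> I" for i
  proof (cases "a i \<in> C")
    case True
    have "dfn C I (\<lambda>e. e i = a i)" by (rule dfn_eq_param[OF i True])
    from same_type_dfn[OF st this a] show ?thesis using True by (simp add: f_def)
  next
    case False
    have "dfn C I (\<lambda>e. e (ix (a i)) = e i)" by (rule dfn_eq[OF ix(1)[OF i] i])
    from same_type_dfn[OF st this a] show ?thesis using False ix(2)[OF i] by (simp add: f_def)
  qed
  have "emap (C \<union> a ` I) f"
    unfolding emap_def
  proof (intro conjI allI impI)
    show "C \<union> a ` I \<subseteq> V" using a(1) C by blast
    have "f x \<in> V" if "x \<in> C" for x using that C by (auto simp: f_def)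
    moreover have "f (a i) \<in> V" if "i \<in> I" for i using fi[OF that] a(2) that by auto
    ultimately have "f x \<in> V" if "x \<in> C \<union> a ` I" for x using that by blast
    then show "f ` (C \<union> a ` I) \<subseteq> V" by blast
    fix \<phi> s assume \<phi>: "wf_fm L \<phi> \<and> s ` fv \<phi> \<subseteq> C \<union> a ` I"
    let ?s = "\<lambda>v. if s v \<in> C then Inr (s v) else Inl (ix (s v))"
    have s: "?s ` fv \<phi> \<subseteq> I <+> C" using \<phi> ix(1) by (auto simp: image_subset_iff)
    let ?P = "\<lambda>a. sat U (\<lambda>v. case_sum a id (?s v)) \<phi>"
    have "dfn C I ?P" using \<phi> s by (intro dfnI[of \<phi> ?s]) auto
    then have "?P a \<longleftrightarrow> ?P a'" by (rule same_type_dfn[OF st _ a])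
    moreover have "?P a \<longleftrightarrow> sat U s \<phi>" using \<phi> ix(2) by (intro sat_cong) auto
    moreover have "?P a' \<longleftrightarrow> sat U (\<lambda>v. f (s v)) \<phi>" by (intro sat_cong) (auto simp: f_def)
    ultimately show "sat U s \<phi> \<longleftrightarrow> sat U (\<lambda>v. f (s v)) \<phi>" by blast
  qed
  then show ?thesis using that fi by (auto simp: f_def)
qed

end

text \<open>\<open>stable_theory\<close> speaks only of models whose universe lies in the type of
  formulas. A ladder in \<open>U\<close> has countably many entries, so it lies in an elementary
  substructure small enough to be copied into that type along an injection \<open>g\<close>.\<close>

lemma order_property_copy:
  fixes U :: "('f, 'r, 'a) struct" and T :: "('f, 'r) fm set"
  assumes U: "model L T U" and T: "\<And>\<sigma>. \<sigma> \<in> T \<Longrightarrow> wf_fm L \<sigma>" and op: "order_property L U m n \<phi>"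
  shows "\<exists>N :: ('f, 'r, ('f, 'r) fm) struct. model L T N \<and> order_property L N m n \<phi>"
proof -
  interpret first_order_structure L U
    by unfold_locales (use U in \<open>simp add: model_def\<close>)
  have \<phi>: "wf_fm L \<phi>" "fv \<phi> \<subseteq> {..<m + n}" using op by (auto simp: order_property_def)
  obtain a b :: "nat \<Rightarrow> 'a list" where *: "(\<forall>i. a i \<in> lists V \<and> length (a i) = m) \<and>
      (\<forall>j. b j \<in> lists V \<and> length (b j) = n) \<and> (\<forall>i j. sat U ((!) (a i @ b j)) \<phi> \<longleftrightarrow> i < j)"
    using op unfolding order_property_def by (elim conjE exE, intro that conjI)
  then have a: "\<And>i. a i \<in> lists V" "\<And>i. length (a i) = m"
    and b: "\<And>j. b j \<in> lists V" "\<And>j. length (b j) = n"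
    and ab: "\<And>i j. sat U ((!) (a i @ b j)) \<phi> \<longleftrightarrow> i < j" by simp_all
  let ?C = "\<Union>i. set (a i) \<union> set (b i)"
  let ?r = "|UNIV :: ('f, 'r) fm set|"
  have inf: "infinite (UNIV :: ('f, 'r) fm set)"
    using infinite_wf_fms[of L] finite_subset subset_UNIV by blast
  then have r: "Cinfinite ?r" by (simp add: cinfinite_def card_of_card_order_on Field_card_of)
  have fin: "|set (a i) \<union> set (b i)| \<le>o ?r" for i
    by (rule ordLess_imp_ordLeq, rule finite_bound[OF r]) simp
  have C: "|?C| \<le>o ?r"
    by (rule UNION_Cinfinite_bound[OF nat_bound[OF r] _ r]) (use fin in auto)
  have CV: "?C \<subseteq> V" using a(1) b(1) by (auto simp: in_lists_conv_set)
  obtain M where M: "elem_sub L U M" "?C \<subseteq> M" "|M| \<le>o ?r"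
    by (rule downward_loewenheim_skolem[OF r C CV card_of_mono1[OF subset_UNIV]])
  obtain g :: "'a \<Rightarrow> ('f, 'r) fm" where g: "inj_on g M"
    using M(3) unfolding card_of_ordLeq[symmetric] by (elim exE conjE) (rule that)
  define h where "h = inv_into M g"
  have hg: "h (g x) = x" if "x \<in> M" for x using g that by (simp add: h_def)
  let ?K = "U\<lparr>univ := M\<rparr>"
  have K: "is_struct L ?K" using M(1) by (simp add: elem_sub_def)
  define N :: "('f, 'r, ('f, 'r) fm) struct" where
    "N = \<lparr>univ = g ` M, fint = \<lambda>f xs. g (fint U f (map h xs)), rint = \<lambda>r xs. rint U r (map h xs)\<rparr>"
  have Nu: "univ N = g ` M" and Nf: "fint N f xs = g (fint U f (map h xs))"
    and Nr: "rint N r xs \<longleftrightarrow> rint U r (map h xs)" for f r xs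
    by (simp_all add: N_def)
  have ev: "eval N e t \<in> g ` M \<and> h (eval N e t) = eval U (\<lambda>v. h (e v)) t \<and>
      eval U (\<lambda>v. h (e v)) t \<in> M"
    if "wf_tm L t" "range e \<subseteq> g ` M" for e t
    using that
  proof (induction t)
    case (Var v)
    then have "e v \<in> g ` M" by blast
    then show ?case using hg by auto
  next
    case (App f ts)
    have IH: "eval N e t \<in> g ` M" "h (eval N e t) = eval U (\<lambda>v. h (e v)) t"
      "eval U (\<lambda>v. h (e v)) t \<in> M" if "t \<in> set ts" for t
      using App.IH[OF that] App.prems that by auto
    have m: "map h (map (eval N e) ts) = map (eval U (\<lambda>v. h (e v))) ts"
      using IH(2) by simp
    have "fint U f (map (eval U (\<lambda>v. h (e v))) ts) \<in> M"
      using K App.prems(1) IH(3) by (auto simp: is_struct_def in_lists_conv_set)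
    then show ?case unfolding eval.simps Nf m using hg by simp
  qed
  have sat: "sat N e \<psi> \<longleftrightarrow> sat ?K (\<lambda>v. h (e v)) \<psi>" if "wf_fm L \<psi>" "range e \<subseteq> g ` M" for e \<psi>
    using that
  proof (induction \<psi> arbitrary: e)
    case (Eq s t)
    have inj: "inj_on h (g ` M)" using g by (simp add: h_def inj_on_inv_into)
    have "eval ?K e' t = eval U e' t" for e' and t :: "'f tm" by (induction t) (auto cong: map_cong)
    moreover have "eval N e s = eval N e t \<longleftrightarrow> h (eval N e s) = h (eval N e t)"
      using inj_on_eq_iff[OF inj, of "eval N e s" "eval N e t"] ev[of s e] ev[of t e] Eq by simp
    ultimately show ?case using ev[of s e] ev[of t e] Eq by simp
  next
    case (Rel r ts)
    have K: "eval ?K e' t = eval U e' t" for e' and t :: "'f tm" by (induction t) (auto cong: map_cong)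
    have m: "map h (map (eval N e) ts) = map (eval ?K (\<lambda>v. h (e v))) ts"
      using ev[of _ e] Rel K by auto
    show ?case unfolding sat.simps Nr m by simp
  next
    case (Ex k \<psi>)
    have "sat N (e(k := g x)) \<psi> \<longleftrightarrow> sat ?K ((\<lambda>v. h (e v))(k := x)) \<psi>" if "x \<in> M" for x
    proof -
      have "sat N (e(k := g x)) \<psi> \<longleftrightarrow> sat ?K (\<lambda>v. h ((e(k := g x)) v)) \<psi>"
        by (rule Ex.IH) (use Ex.prems that in auto)
      also have "(\<lambda>v. h ((e(k := g x)) v)) = (\<lambda>v. h (e v))(k := x)" using hg[OF that] by auto
      finally show ?thesis .
    qed
    then show ?case unfolding sat.simps Nu by (simp del: fun_upd_apply)
  qed auto
  have "is_struct L N"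
    unfolding is_struct_def
  proof (intro conjI ballI impI)
    show "univ N \<noteq> {}" using elem_nonempty[OF M(1)] by (simp add: Nu)
    fix f xs assume f: "f \<in> funs L" "xs \<in> lists (univ N)" "length xs = farity L f"
    have "map h xs \<in> lists M" using f(2) hg by (auto simp: Nu in_lists_conv_set)
    then have "fint U f (map h xs) \<in> M" using K f(1,3) by (simp add: is_struct_def)
    then show "fint N f xs \<in> univ N" by (simp add: Nu Nf)
  qed
  moreover have "sat N e \<sigma>" if "\<sigma> \<in> T" "range e \<subseteq> univ N" for \<sigma> e
  proof -
    have r: "range (\<lambda>v. h (e v)) \<subseteq> M" using that(2) hg by (auto simp: Nu)
    have "\<forall>e. range e \<subseteq> V \<longrightarrow> sat U e \<sigma>" using U that(1) by (simp add: model_def)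
    from this[rule_format, OF order_trans[OF r elem_subset[OF M(1)]]]
    have "sat ?K (\<lambda>v. h (e v)) \<sigma>"
      using M(1) T[OF that(1)] r unfolding elem_sub_def by blast
    then show ?thesis using sat[OF T[OF that(1)], of e] that(2) by (simp add: Nu)
  qed
  ultimately have "model L T N" by (simp add: model_def)
  moreover have "order_property L N m n \<phi>"
    unfolding order_property_def
  proof (intro conjI exI allI \<phi>)
    fix i j
    show "map g (a i) \<in> lists (univ N)" "map g (b i) \<in> lists (univ N)"
      using M(2) by (auto simp: Nu in_lists_conv_set)
    show "length (map g (a i)) = m" "length (map g (b i)) = n" using a b by auto
    obtain z where z: "z \<in> M" using elem_nonempty[OF M(1)] by auto
    let ?l = "a i @ b j"
    let ?e = "\<lambda>v. if v < m + n then g (?l ! v) else g z"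
    have l: "?l ! v \<in> M" if "v < m + n" for v
      using that M(2) a(2) b(2) nth_mem[of v ?l] by fastforce
    have e: "range ?e \<subseteq> g ` M" using l z by auto
    have "sat N ((!) (map g (a i) @ map g (b j))) \<phi> \<longleftrightarrow> sat N ?e \<phi>"
    proof (intro sat_cong ballI)
      fix v assume "v \<in> fv \<phi>"
      then have "v < m + n" using \<phi>(2) by blast
      then show "(map g (a i) @ map g (b j)) ! v = ?e v"
        using a(2) b(2) by (simp flip: map_append)
    qed
    also have "\<dots> \<longleftrightarrow> sat ?K (\<lambda>v. h (?e v)) \<phi>" by (rule sat[OF \<phi>(1) e])
    also have "\<dots> \<longleftrightarrow> sat U (\<lambda>v. h (?e v)) \<phi>"
    proof -
      have "range (\<lambda>v. h (?e v)) \<subseteq> M" using l z hg by auto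
      then show ?thesis using M(1) \<phi>(1) unfolding elem_sub_def by blast
    qed
    also have "\<dots> \<longleftrightarrow> sat U ((!) ?l) \<phi>"
      using l hg \<phi>(2) by (intro sat_cong) auto
    finally show "sat N ((!) (map g (a i) @ map g (b j))) \<phi> \<longleftrightarrow> i < j" using ab by simp
  qed
  ultimately show ?thesis by blast
qed

subsection \<open>Realising types\<close>

context first_order_structure
begin

lemma dfn_sat_lists:
  assumes "wf_fm L \<phi>" and "fv \<phi> \<subseteq> {..<m + n}"
  shows "dfn {} ({..<m} <+> {..<n})
    (\<lambda>e. sat U ((!) (map (\<lambda>i. e (Inl i)) [0..<m] @ map (\<lambda>j. e (Inr j)) [0..<n])) \<phi>)"
proof (rule dfnI[OF assms(1)])
  let ?s = "\<lambda>v. if v < m then Inl (Inl v) else Inl (Inr (v - m))"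
  show "?s ` fv \<phi> \<subseteq> ({..<m} <+> {..<n}) <+> {}"
    using assms(2) by (force simp: sum_image_subset_Plus split: if_splits)
  fix e :: "nat + nat \<Rightarrow> 'a"
  show "sat U ((!) (map (\<lambda>i. e (Inl i)) [0..<m] @ map (\<lambda>j. e (Inr j)) [0..<n])) \<phi> \<longleftrightarrow>
      sat U (\<lambda>v. case_sum e id (?s v)) \<phi>"
  proof (intro sat_cong ballI)
    fix v assume "v \<in> fv \<phi>"
    then have "v < m + n" using assms(2) by blast
    then show "(map (\<lambda>i. e (Inl i)) [0..<m] @ map (\<lambda>j. e (Inr j)) [0..<n]) ! v = case_sum e id (?s v)"
      by (cases "v < m") (auto simp: nth_append)
  qed
qed

lemma dfn_holds_at:
  assumes "(\<phi>, b) \<in> fms_over L C n" and "C \<subseteq> V"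
  shows "dfn C {..<n} (\<lambda>x. holds_at U (map x [0..<n]) (\<phi>, b))"
proof -
  have \<phi>: "wf_fm L \<phi>" "fv \<phi> \<subseteq> {..<n + length b}" "b \<in> lists C" using assms(1) by (auto simp: fms_over_def)
  have "dfn C {..<n} (\<lambda>a. sat U ((!) (map (\<lambda>i. case_sum a ((!) b) (Inl i)) [0..<n] @
      map (\<lambda>j. case_sum a ((!) b) (Inr j)) [0..<length b])) \<phi>)"
  proof (rule dfn_param[OF dfn_mono[OF dfn_sat_lists[OF \<phi>(1,2)]]])
    show "(!) b ` {..<length b} \<subseteq> C" using \<phi>(3) nth_mem[of _ b] by (auto simp: in_lists_conv_set)
  qed (use assms(2) in auto)
  then show ?thesis by (simp add: holds_at_def map_nth)
qed

text \<open>The finitely many variables that occur are listed, which turns a definable predicate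
  into a formula at two tuples. Distinctness of \<open>ms\<close> lets a tuple of values be read
  back as a family.\<close>

lemma dfn_lists:
  assumes "dfn {} (I <+> J) W"
  obtains ms js \<phi> where "set ms \<subseteq> I" and "set js \<subseteq> J" and "distinct ms" and "wf_fm L \<phi>"
    and "fv \<phi> \<subseteq> {..<length ms + length js}"
    and "\<And>a b. a ` I \<subseteq> V \<Longrightarrow> b ` J \<subseteq> V \<Longrightarrow>
      W (case_sum a b) \<longleftrightarrow> sat U ((!) (map a ms @ map b js)) \<phi>"
proof -
  from assms obtain \<phi> s where \<phi>: "wf_fm L \<phi>" "s ` fv \<phi> \<subseteq> (I <+> J) <+> {}"
    "\<And>a. a ` (I <+> J) \<subseteq> V \<Longrightarrow> W a \<longleftrightarrow> sat U (\<lambda>v. case_sum a id (s v)) \<phi>" by (rule dfnE) (rule that)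
  have s: "\<And>v. v \<in> fv \<phi> \<Longrightarrow> s v = Inl (projl (s v)) \<and> projl (s v) \<in> I <+> J"
    using \<phi>(2) by (fastforce simp: Plus_def)
  let ?s = "\<lambda>v. projl (s v)"
  have "finite {i. Inl i \<in> ?s ` fv \<phi>}" "finite {j. Inr j \<in> ?s ` fv \<phi>}"
    using finite_vimageI[of "?s ` fv \<phi>" Inl] finite_vimageI[of "?s ` fv \<phi>" Inr]
    by (simp_all add: vimage_def)
  then obtain ms js where ij: "set ms = {i. Inl i \<in> ?s ` fv \<phi>}" "distinct ms"
    "set js = {j. Inr j \<in> ?s ` fv \<phi>}" using finite_distinct_list by metis
  have sub: "set ms \<subseteq> I" "set js \<subseteq> J" unfolding ij using s by force+
  have "?s ` fv \<phi> \<subseteq> set ms <+> set js"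
    unfolding sum_image_subset_Plus ij by (metis imageI mem_Collect_eq)
  from fm_of_lists[OF \<phi>(1) this, of U] obtain \<psi> where \<psi>: "wf_fm L \<psi>"
    "fv \<psi> \<subseteq> {..<length ms + length js}"
    "\<forall>a b. a ` set ms \<subseteq> V \<longrightarrow> b ` set js \<subseteq> V \<longrightarrow>
      (sat U (\<lambda>v. case_sum a b (?s v)) \<phi> \<longleftrightarrow> sat U ((!) (map a ms @ map b js)) \<psi>)" by auto
  show ?thesis
  proof (rule that[OF sub ij(2) \<psi>(1,2)])
    fix a b assume ab: "a ` I \<subseteq> V" "b ` J \<subseteq> V"
    then have "W (case_sum a b) \<longleftrightarrow> sat U (\<lambda>v. case_sum (case_sum a b) id (s v)) \<phi>"
      by (intro \<phi>(3)) auto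
    also have "\<dots> \<longleftrightarrow> sat U (\<lambda>v. case_sum a b (?s v)) \<phi>"
    proof (intro sat_cong ballI)
      fix v assume "v \<in> fv \<phi>"
      from s[OF this] show "case_sum (case_sum a b) id (s v) = case_sum a b (?s v)"
        by (metis sum.case(1))
    qed
    also have "\<dots> \<longleftrightarrow> sat U ((!) (map a ms @ map b js)) \<psi>"
    proof -
      have "a ` set ms \<subseteq> V" "b ` set js \<subseteq> V" using ab sub by (blast+)
      then show ?thesis using \<psi>(3)[rule_format] by blast
    qed
    finally show "W (case_sum a b) \<longleftrightarrow> sat U ((!) (map a ms @ map b js)) \<psi>" .
  qed
qed

lemma dfn_unit_holds_at:
  assumes P: "dfn C (UNIV :: unit set) (\<lambda>a. P (a ()))" and C: "C \<subseteq> V"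
  obtains \<theta> where "\<theta> \<in> fms_over L C 1" and "\<And>x. x \<in> V \<Longrightarrow> P x \<longleftrightarrow> holds_at U [x] \<theta>"
proof -
  from P have "dfn ({} \<union> C) (UNIV :: unit set) (\<lambda>a. P (a ()))" by simp
  then obtain Q where Q: "dfn {} ((UNIV :: unit set) <+> C) Q"
    "\<And>a. a ` (UNIV :: unit set) \<subseteq> V \<Longrightarrow> P (a ()) \<longleftrightarrow> Q (case_sum a id)" by (rule dfn_abstract) (rule that)
  from Q(1) obtain ms js \<phi> where \<phi>: "set ms \<subseteq> (UNIV :: unit set)" "set js \<subseteq> C" "distinct ms" "wf_fm L \<phi>"
    "fv \<phi> \<subseteq> {..<length ms + length js}"
    "\<And>a b. a ` (UNIV :: unit set) \<subseteq> V \<Longrightarrow> b ` C \<subseteq> V \<Longrightarrow>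
      Q (case_sum a b) \<longleftrightarrow> sat U ((!) (map a ms @ map b js)) \<phi>" by (rule dfn_lists) (rule that)
  \<comment> \<open>\<open>ms\<close> may be empty, while the official format reserves exactly one
    place for the variable; all of \<open>ms\<close> is sent to that place.\<close>
  let ?s = "\<lambda>v. if v < length ms then Inl () else Inr (js ! (v - length ms))"
  have "?s ` fv \<phi> \<subseteq> set [()] <+> set js"
    using \<phi>(5) by (force simp: sum_image_subset_Plus split: if_splits)
  from fm_of_lists[OF \<phi>(4) this, of U] obtain \<psi> where \<psi>: "wf_fm L \<psi>" "fv \<psi> \<subseteq> {..<1 + length js}"
    "\<forall>a b. a ` set [()] \<subseteq> V \<longrightarrow> b ` set js \<subseteq> V \<longrightarrow>
      (sat U (\<lambda>v. case_sum a b (?s v)) \<phi> \<longleftrightarrow> sat U ((!) (map a [()] @ map b js)) \<psi>)" by auto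
  show ?thesis
  proof (rule that[of "(\<psi>, js)"])
    show "(\<psi>, js) \<in> fms_over L C 1" using \<psi> \<phi>(2) by (auto simp: fms_over_def)
    fix x assume x: "x \<in> V"
    have "P x \<longleftrightarrow> Q (case_sum (\<lambda>_. x) id)" using Q(2)[of "\<lambda>_. x"] x by simp
    also have "\<dots> \<longleftrightarrow> sat U ((!) (map (\<lambda>_. x) ms @ map id js)) \<phi>"
      using x C by (intro \<phi>(6)) auto
    also have "\<dots> \<longleftrightarrow> sat U (\<lambda>v. case_sum (\<lambda>_. x) id (?s v)) \<phi>"
      using \<phi>(5) by (intro sat_cong) (auto simp: nth_append)
    also have "\<dots> \<longleftrightarrow> sat U ((!) (map (\<lambda>_. x) [()] @ map id js)) \<psi>"
      using \<psi>(3) x \<phi>(2) C by auto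
    finally show "P x \<longleftrightarrow> holds_at U [x] (\<psi>, js)" by (simp add: holds_at_def)
  qed
qed

end

locale monster = first_order_structure L U
  for L :: "('f, 'r) lang" and U :: "('f, 'r, 'a) struct" +
  fixes \<kappa> :: "'k rel"
  assumes sufficiently_saturated: "sufficiently_saturated L U \<kappa>"
begin

lemma Cinfinite_kappa: "Cinfinite \<kappa>"
proof -
  have \<kappa>: "Card_order \<kappa>" "|{\<phi>. wf_fm L \<phi>}| <o \<kappa>"
    using sufficiently_saturated by (auto simp: sufficiently_saturated_def)
  have "cinfinite |{\<phi>. wf_fm L \<phi>}|" using infinite_wf_fms by (simp add: cinfinite_def Field_card_of)
  then show ?thesis using cinfinite_mono ordLess_imp_ordLeq \<kappa> by blast
qed

lemma card_fms: "|{\<phi>. wf_fm L \<phi>}| <o \<kappa>"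
  using sufficiently_saturated by (auto simp: sufficiently_saturated_def)

lemma card_nat: "|UNIV :: nat set| <o \<kappa>"
proof -
  have "|UNIV :: nat set| \<le>o |{\<phi>. wf_fm L \<phi>}|"
    using infinite_wf_fms infinite_iff_card_of_nat by blast
  then show ?thesis using card_fms ordLeq_ordLess_trans by blast
qed

lemma card_less_subset: "|B| <o \<kappa> \<Longrightarrow> A \<subseteq> B \<Longrightarrow> |A| <o \<kappa>"
  using card_of_mono1 ordLeq_ordLess_trans by blast

lemma card_less_image: "|A| <o \<kappa> \<Longrightarrow> |f ` A| <o \<kappa>"
  using card_of_image ordLeq_ordLess_trans by blast

lemma card_less_Plus:
  assumes "|A| <o \<kappa>" and "|B| <o \<kappa>" shows "|A <+> B| <o \<kappa>"
  using assms Cinfinite_kappa card_of_Plus_ordLess_infinite_Field unfolding cinfinite_def by blast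

lemma small_subset: "small U \<kappa> B \<Longrightarrow> A \<subseteq> B \<Longrightarrow> small U \<kappa> A"
  using card_less_subset by (auto simp: small_def)

lemma small_Un: "small U \<kappa> A \<Longrightarrow> small U \<kappa> B \<Longrightarrow> small U \<kappa> (A \<union> B)"
  using Un_Cinfinite_bound_strict[OF _ _ Cinfinite_kappa] by (auto simp: small_def)

lemma small_finite: "finite A \<Longrightarrow> A \<subseteq> V \<Longrightarrow> small U \<kappa> A"
  using finite_bound[OF Cinfinite_kappa] by (simp add: small_def)

lemma small_image: "|I| <o \<kappa> \<Longrightarrow> f ` I \<subseteq> V \<Longrightarrow> small U \<kappa> (f ` I)"
  using card_less_image by (simp add: small_def)

lemma small_UN_finite:
  assumes "finite I" and "\<And>i. i \<in> I \<Longrightarrow> small U \<kappa> (A i)" shows "small U \<kappa> (\<Union>i\<in>I. A i)"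
  using assms by (induction I) (auto intro: small_Un small_finite)

lemma small_UN_nat:
  assumes "\<And>i::nat. finite (A i)" and "\<And>i. A i \<subseteq> V" shows "small U \<kappa> (\<Union>i. A i)"
proof -
  have r: "Cinfinite |{\<phi>. wf_fm L \<phi>}|"
    using infinite_wf_fms by (simp add: cinfinite_def Field_card_of card_of_card_order_on)
  have "|\<Union>i. A i| \<le>o |{\<phi>. wf_fm L \<phi>}|"
    by (rule UNION_Cinfinite_bound[OF nat_bound[OF r] _ r])
      (use finite_bound[OF r] assms(1) ordLess_imp_ordLeq in blast)
  then show ?thesis using card_fms ordLeq_ordLess_trans assms(2) unfolding small_def by blast
qed

lemma small_V: "small U \<kappa> A \<Longrightarrow> A \<subseteq> V" and small_card: "small U \<kappa> A \<Longrightarrow> |A| <o \<kappa>"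
  by (auto simp: small_def)

lemma small_model:
  assumes "small U \<kappa> C"
  obtains M where "elem_sub L U M" and "C \<subseteq> M" and "small U \<kappa> M"
proof -
  let ?X = "C <+> {\<phi>. wf_fm L \<phi>}"
  have "infinite ?X" using infinite_wf_fms[of L] by (simp add: finite_Plus_iff)
  then have r: "Cinfinite |?X|" by (simp add: cinfinite_def Field_card_of card_of_card_order_on)
  have "|C| \<le>o |?X|" "|{\<phi>. wf_fm L \<phi>}| \<le>o |?X|" by (rule card_of_Plus1, rule card_of_Plus2)
  from downward_loewenheim_skolem[OF r this(1) _ this(2)] small_V[OF assms]
  obtain M where M: "elem_sub L U M" "C \<subseteq> M" "|M| \<le>o |?X|" by blast
  have "|?X| <o \<kappa>" using card_less_Plus[OF small_card[OF assms] card_fms] .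
  then have "|M| <o \<kappa>" using M(3) ordLeq_ordLess_trans by blast
  then show ?thesis using that M elem_subset[OF M(1)] by (auto simp: small_def)
qed

section \<open>Saturation for types in many variables\<close>

lemma realize_one:
  assumes B: "small U \<kappa> B" and \<Sigma>: "\<And>P. P \<in> \<Sigma> \<Longrightarrow> dfn B (UNIV :: unit set) (\<lambda>a. P (a ()))"
    and fin: "\<And>\<Sigma>0. finite \<Sigma>0 \<Longrightarrow> \<Sigma>0 \<subseteq> \<Sigma> \<Longrightarrow> \<exists>x\<in>V. \<forall>P\<in>\<Sigma>0. P x"
  shows "\<exists>x\<in>V. \<forall>P\<in>\<Sigma>. P x"
proof -
  have "\<forall>P\<in>\<Sigma>. \<exists>\<theta>. \<theta> \<in> fms_over L B 1 \<and> (\<forall>x\<in>V. P x \<longleftrightarrow> holds_at U [x] \<theta>)"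
  proof
    fix P assume "P \<in> \<Sigma>"
    from dfn_unit_holds_at[OF \<Sigma>[OF this] small_V[OF B]]
    show "\<exists>\<theta>. \<theta> \<in> fms_over L B 1 \<and> (\<forall>x\<in>V. P x \<longleftrightarrow> holds_at U [x] \<theta>)" by metis
  qed
  from bchoice[OF this] obtain \<theta> where \<theta>: "\<And>P. P \<in> \<Sigma> \<Longrightarrow> \<theta> P \<in> fms_over L B 1"
    "\<And>P x. P \<in> \<Sigma> \<Longrightarrow> x \<in> V \<Longrightarrow> P x \<longleftrightarrow> holds_at U [x] (\<theta> P)" by blast
  have "\<exists>x\<in>V. \<forall>\<eta>\<in>q. holds_at U [x] \<eta>" if q: "finite q" "q \<subseteq> \<theta> ` \<Sigma>" for q
  proof -
    obtain \<Sigma>0 where \<Sigma>0: "finite \<Sigma>0" "\<Sigma>0 \<subseteq> \<Sigma>" "q = \<theta> ` \<Sigma>0"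
      using finite_subset_image[OF q] by blast
    from fin[OF this(1,2)] obtain x where "x \<in> V" "\<forall>P\<in>\<Sigma>0. P x" by blast
    then show ?thesis using \<theta>(2) \<Sigma>0 by blast
  qed
  moreover have "\<theta> ` \<Sigma> \<subseteq> fms_over L B 1" using \<theta>(1) by blast
  moreover have "saturated L U \<kappa>"
    using sufficiently_saturated by (simp add: sufficiently_saturated_def)
  from this[unfolded saturated_def, THEN spec, THEN spec, THEN mp, of B "\<theta> ` \<Sigma>"]
  have "small U \<kappa> B \<and> \<theta> ` \<Sigma> \<subseteq> fms_over L B 1 \<and>
      (\<forall>q. finite q \<and> q \<subseteq> \<theta> ` \<Sigma> \<longrightarrow> (\<exists>x\<in>V. \<forall>\<eta>\<in>q. holds_at U [x] \<eta>)) \<Longrightarrow>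
      \<exists>x\<in>V. \<forall>\<eta>\<in>\<theta> ` \<Sigma>. holds_at U [x] \<eta>" .
  ultimately obtain x where "x \<in> V" "\<forall>\<eta>\<in>\<theta> ` \<Sigma>. holds_at U [x] \<eta>" using B by blast
  then show ?thesis using \<theta>(2) by blast
qed

text \<open>Zorn's lemma yields a maximal partial realisation that extends to a realisation of every
  finite part of \<open>\<Sigma>\<close>; saturation for one variable shows that it is total.\<close>

lemma realize:
  assumes B: "small U \<kappa> B" and I: "|I| <o \<kappa>" and \<Sigma>: "\<And>P. P \<in> \<Sigma> \<Longrightarrow> dfn B I P"
    and fin: "\<And>\<Sigma>0. finite \<Sigma>0 \<Longrightarrow> \<Sigma>0 \<subseteq> \<Sigma> \<Longrightarrow> \<exists>a. a ` I \<subseteq> V \<and> (\<forall>P\<in>\<Sigma>0. P a)"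
  shows "\<exists>a. a ` I \<subseteq> V \<and> (\<forall>P\<in>\<Sigma>. P a)"
proof -
  \<comment> \<open>Partial families are kept as graphs, so that inclusion orders them. They may be
    infinite but are tested against finite parts of \<open>\<Sigma>\<close> only.\<close>
  define good where "good = (\<lambda>g :: ('b \<times> 'a) set. g \<subseteq> I \<times> V \<and>
    (\<forall>\<Sigma>0. finite \<Sigma>0 \<and> \<Sigma>0 \<subseteq> \<Sigma> \<longrightarrow>
      (\<exists>a. a ` I \<subseteq> V \<and> (\<forall>(i, x)\<in>g. a i = x) \<and> (\<forall>P\<in>\<Sigma>0. P a))))"
  have goodD: "\<exists>a. a ` I \<subseteq> V \<and> (\<forall>(i, x)\<in>g. a i = x) \<and> (\<forall>P\<in>\<Sigma>0. P a)"
    if "good g" "finite \<Sigma>0" "\<Sigma>0 \<subseteq> \<Sigma>" for g \<Sigma>0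
    using that unfolding good_def by blast
  have dconj: "dfn B I (\<lambda>a. \<forall>P\<in>\<Sigma>0. P a)" if "finite \<Sigma>0" "\<Sigma>0 \<subseteq> \<Sigma>" for \<Sigma>0
    using that \<Sigma> by (intro dfn_ball) auto
  have "\<exists>g\<in>Collect good. \<forall>h\<in>Collect good. g \<subseteq> h \<longrightarrow> h = g"
  proof (rule subset_Zorn_nonempty)
    have "good {}" using fin by (simp add: good_def)
    then show "Collect good \<noteq> {}" by blast
    fix \<C> assume ne: "\<C> \<noteq> {}" and ch: "subset.chain (Collect good) \<C>"
    have good: "good g" if "g \<in> \<C>" for g using ch that unfolding subset.chain_def by blast
    have lin: "g \<subseteq> h \<or> h \<subseteq> g" if "g \<in> \<C>" "h \<in> \<C>" for g h
      using ch that unfolding subset_chain_def by blast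
    have sv: "x = y" if xy: "(i, x) \<in> \<Union>\<C>" "(i, y) \<in> \<Union>\<C>" for i x y
    proof -
      obtain g h where gh: "g \<in> \<C>" "(i, x) \<in> g" "h \<in> \<C>" "(i, y) \<in> h" using xy by blast
      then obtain k where k: "k \<in> \<C>" "(i, x) \<in> k" "(i, y) \<in> k" using lin[OF gh(1,3)] by blast
      from goodD[OF good[OF k(1)], of "{}"] obtain a :: "'b \<Rightarrow> 'a"
        where a: "\<forall>(i, x)\<in>k. a i = x" by auto
      show ?thesis using a[THEN bspec, OF k(2)] a[THEN bspec, OF k(3)] by simp
    qed
    have "\<exists>a. a ` I \<subseteq> V \<and> (\<forall>(i, x)\<in>\<Union>\<C>. a i = x) \<and> (\<forall>P\<in>\<Sigma>0. P a)"
      if \<Sigma>0: "finite \<Sigma>0" "\<Sigma>0 \<subseteq> \<Sigma>" for \<Sigma>0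
    proof -
      \<comment> \<open>\<open>\<Sigma>0\<close> depends on finitely many coordinates, and one
        member of the chain already fixes all of those that the union fixes. Its solution can be
        overwritten by the union without a change on these coordinates.\<close>
      from dconj[OF \<Sigma>0] obtain F P' where F: "finite F" "F \<subseteq> I" "dfn B F P'"
        "\<And>a. a ` I \<subseteq> V \<Longrightarrow> (\<forall>P\<in>\<Sigma>0. P a) \<longleftrightarrow> P' a" by (rule dfn_support) (rule that)
      have "\<exists>k\<in>\<C>. \<forall>i\<in>F. \<forall>x. (i, x) \<in> \<Union>\<C> \<longrightarrow> (i, x) \<in> k" using F(1)
      proof (induction F)
        case empty
        then show ?case using ne by auto
      next
        case (insert i F)
        then obtain k where k: "k \<in> \<C>" "\<forall>i\<in>F. \<forall>x. (i, x) \<in> \<Union>\<C> \<longrightarrow> (i, x) \<in> k" by blast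
        show ?case
        proof (cases "\<exists>x. (i, x) \<in> \<Union>\<C>")
          case True
          then obtain x h where h: "h \<in> \<C>" "(i, x) \<in> h" by blast
          have *: "\<forall>y. (i, y) \<in> \<Union>\<C> \<longrightarrow> y = x" using sv[of i _ x] h by blast
          show ?thesis using lin[OF k(1) h(1)] k h * by (metis insert_iff subsetD)
        next
          case False
          then show ?thesis using k by (intro bexI[of _ k]) auto
        qed
      qed
      then obtain k where k: "k \<in> \<C>" "\<And>i x. i \<in> F \<Longrightarrow> (i, x) \<in> \<Union>\<C> \<Longrightarrow> (i, x) \<in> k" by blast
      from goodD[OF good[OF k(1)] \<Sigma>0] obtain a where
        a: "a ` I \<subseteq> V" "\<forall>(i, x)\<in>k. a i = x" "\<forall>P\<in>\<Sigma>0. P a" by blast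
      define a' where "a' = (\<lambda>i. if \<exists>x. (i, x) \<in> \<Union>\<C> then THE x. (i, x) \<in> \<Union>\<C> else a i)"
      have a'1: "a' i = x" if "(i, x) \<in> \<Union>\<C>" for i x
      proof -
        have "(THE x. (i, x) \<in> \<Union>\<C>) = x" using that sv by (intro the_equality) blast+
        then show ?thesis using that unfolding a'_def by auto
      qed
      have a'2: "a' i = a i" if "i \<in> F" for i
      proof (cases "\<exists>x. (i, x) \<in> \<Union>\<C>")
        case True
        then obtain x where x: "(i, x) \<in> \<Union>\<C>" by blast
        then show ?thesis using a'1[OF x] k(2)[OF that x] a(2) by blast
      qed (simp add: a'_def)
      have "\<Union>\<C> \<subseteq> I \<times> V" using good unfolding good_def by blast
      have a'V: "a' i \<in> V" if "i \<in> I" for i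
      proof (cases "\<exists>x. (i, x) \<in> \<Union>\<C>")
        case True
        then obtain x where x: "(i, x) \<in> \<Union>\<C>" by blast
        then have "x \<in> V" using \<open>\<Union>\<C> \<subseteq> I \<times> V\<close> by blast
        then show ?thesis using a'1[OF x] by simp
      next
        case False
        then have "a' i = a i" by (simp add: a'_def)
        then show ?thesis using a(1) that by auto
      qed
      then have a'V: "a' ` I \<subseteq> V" by blast
      have "P' a \<longleftrightarrow> P' a'" using a'2 a(1) F(2) by (intro dfn_same[OF F(3)]) auto
      then have "\<forall>P\<in>\<Sigma>0. P a'" using F(4)[OF a(1)] F(4)[OF a'V] a(3) by blast
      then show ?thesis using a'V a'1 by blast
    qed
    moreover have "\<Union>\<C> \<subseteq> I \<times> V" using good unfolding good_def by blast
    ultimately show "\<Union>\<C> \<in> Collect good" unfolding good_def by blast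
  qed
  then obtain g where g: "good g" and max: "\<And>h. good h \<Longrightarrow> g \<subseteq> h \<Longrightarrow> h = g" by blast
  have gIV: "g \<subseteq> I \<times> V" using g by (simp add: good_def)
  obtain g0 where g0: "\<And>i x. (i, x) \<in> g \<Longrightarrow> g0 i = x" using goodD[OF g, of "{}"] by fastforce
  have "I \<subseteq> Domain g"
  proof (rule ccontr)
    assume "\<not> I \<subseteq> Domain g"
    then obtain i where i: "i \<in> I" "i \<notin> Domain g" by blast
    let ?D = "Domain g" and ?G = "B \<union> g0 ` Domain g"
    \<comment> \<open>\<open>T \<Sigma>0 x\<close> says that \<open>x\<close> is admissible as the
      value at \<open>i\<close> as far as \<open>\<Sigma>0\<close> is concerned. The condition is
      definable over the small set of parameters and values of \<open>g\<close>; finitely many such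
      conditions are met together by solving the union of their sets.\<close>
    define T where "T = (\<lambda>\<Sigma>0 x. \<exists>a. a ` I \<subseteq> V \<and> (\<forall>(j, y)\<in>g. a j = y) \<and> a i = x \<and> (\<forall>P\<in>\<Sigma>0. P a))"
    have g0V: "g0 ` ?D \<subseteq> V" using g0 gIV by auto
    have "?D \<subseteq> I" using gIV by auto
    then have G: "small U \<kappa> ?G" using B I g0V by (intro small_Un small_image card_less_subset[OF I]) auto
    have GV: "?G \<subseteq> V" using G by (rule small_V)
    have T: "dfn ?G (UNIV :: unit set) (\<lambda>a. T \<Sigma>0 (a ()))" if \<Sigma>0: "finite \<Sigma>0" "\<Sigma>0 \<subseteq> \<Sigma>" for \<Sigma>0
    proof -
      let ?s = "\<lambda>j. if j \<in> ?D then Inr (g0 j) else Inl j"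
      have "dfn ?G (I - ?D) (\<lambda>a. \<forall>P\<in>\<Sigma>0. P (\<lambda>j. case_sum a id (?s j)))"
        by (rule dfn_subst[OF dconj[OF \<Sigma>0] _ _ GV]) auto
      from dfn_proj[OF this, of "{i}"] i
      have "dfn ?G {i} (\<lambda>a. \<exists>b. b ` (I - ?D) \<subseteq> V \<and> (\<forall>j\<in>{i}. b j = a j) \<and>
          (\<forall>P\<in>\<Sigma>0. P (\<lambda>j. case_sum b id (?s j))))" by blast
      from dfn_reindex[OF this, of "\<lambda>_. ()" UNIV] GV
      have "dfn ?G (UNIV :: unit set) (\<lambda>a. \<exists>b. b ` (I - ?D) \<subseteq> V \<and> (\<forall>j\<in>{i}. b j = a ()) \<and>
          (\<forall>P\<in>\<Sigma>0. P (\<lambda>j. case_sum b id (?s j))))" by blast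
      then show ?thesis
      proof (rule dfn_cong)
        fix a :: "unit \<Rightarrow> 'a"
        show "(\<exists>b. b ` (I - ?D) \<subseteq> V \<and> (\<forall>j\<in>{i}. b j = a ()) \<and>
          (\<forall>P\<in>\<Sigma>0. P (\<lambda>j. case_sum b id (?s j)))) \<longleftrightarrow> T \<Sigma>0 (a ())" (is "?l \<longleftrightarrow> ?r")
        proof
          assume ?l
          then obtain b where b: "b ` (I - ?D) \<subseteq> V" "b i = a ()"
            "\<forall>P\<in>\<Sigma>0. P (\<lambda>j. case_sum b id (?s j))" by blast
          let ?a = "\<lambda>j. case_sum b id (?s j)"
          have "?a ` I \<subseteq> V" using b(1) g0V by (force simp: image_subset_iff)
          moreover have "\<forall>(j, y)\<in>g. ?a j = y" using g0 by auto
          moreover have "?a i = a ()" using b(2) i by auto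
          ultimately show ?r unfolding T_def using b(3) by blast
        next
          assume ?r
          then obtain b where b: "b ` I \<subseteq> V" "\<forall>(j, y)\<in>g. b j = y" "b i = a ()" "\<forall>P\<in>\<Sigma>0. P b"
            unfolding T_def by blast
          have "(\<lambda>j. case_sum b id (?s j)) = b"
            using b(2) g0 by (auto simp: fun_eq_iff)
          then show ?l using b by (intro exI[of _ b]) auto
        qed
      qed
    qed
    have fin1: "\<exists>x\<in>V. \<forall>P\<in>\<Theta>. P x" if \<Theta>: "finite \<Theta>" "\<Theta> \<subseteq> T ` {\<Sigma>0. finite \<Sigma>0 \<and> \<Sigma>0 \<subseteq> \<Sigma>}" for \<Theta>
    proof -
      obtain S where S: "finite S" "S \<subseteq> {\<Sigma>0. finite \<Sigma>0 \<and> \<Sigma>0 \<subseteq> \<Sigma>}" "\<Theta> = T ` S"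
        using finite_subset_image[OF \<Theta>] by blast
      have "finite (\<Union>S)" "\<Union>S \<subseteq> \<Sigma>" using S by auto
      from goodD[OF g this] obtain a where a: "a ` I \<subseteq> V" "\<forall>(j, y)\<in>g. a j = y" "\<forall>P\<in>\<Union>S. P a" by blast
      have "T \<Sigma>0 (a i)" if "\<Sigma>0 \<in> S" for \<Sigma>0 unfolding T_def using a that by blast
      then show ?thesis using a(1) i(1) S(3) by blast
    qed
    have "dfn ?G (UNIV :: unit set) (\<lambda>a. P (a ()))"
      if "P \<in> T ` {\<Sigma>0. finite \<Sigma>0 \<and> \<Sigma>0 \<subseteq> \<Sigma>}" for P using that T by force
    from realize_one[OF G this fin1]
    have "\<exists>x\<in>V. \<forall>P\<in>T ` {\<Sigma>0. finite \<Sigma>0 \<and> \<Sigma>0 \<subseteq> \<Sigma>}. P x" .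
    then obtain x where x: "x \<in> V" "\<And>\<Sigma>0. finite \<Sigma>0 \<Longrightarrow> \<Sigma>0 \<subseteq> \<Sigma> \<Longrightarrow> T \<Sigma>0 x" by auto
    have "good (insert (i, x) g)"
      unfolding good_def
    proof (intro conjI allI impI)
      show "insert (i, x) g \<subseteq> I \<times> V" using gIV i(1) x(1) by blast
      fix \<Sigma>0 assume "finite \<Sigma>0 \<and> \<Sigma>0 \<subseteq> \<Sigma>"
      then have "T \<Sigma>0 x" using x(2) by blast
      then obtain a where "a ` I \<subseteq> V" "\<forall>(j, y)\<in>g. a j = y" "a i = x" "\<forall>P\<in>\<Sigma>0. P a"
        unfolding T_def by (elim exE conjE) (rule that)
      then show "\<exists>a. a ` I \<subseteq> V \<and> (\<forall>(j, y)\<in>insert (i, x) g. a j = y) \<and> (\<forall>P\<in>\<Sigma>0. P a)"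
        by (intro exI[of _ a]) simp
    qed
    from max[OF this] i(2) show False by blast
  qed
  have gI: "(i, g0 i) \<in> g" if "i \<in> I" for i using \<open>I \<subseteq> Domain g\<close> that g0 by (metis DomainE subsetD)
  have g0V: "g0 ` I \<subseteq> V" using gI gIV by auto
  moreover have "P g0" if P: "P \<in> \<Sigma>" for P
  proof -
    from goodD[OF g, of "{P}"] P obtain a where a: "a ` I \<subseteq> V" "\<forall>(i, x)\<in>g. a i = x" "P a" by auto
    have "a i = g0 i" if "i \<in> I" for i using a(2)[THEN bspec, OF gI[OF that]] by simp
    then have "P a \<longleftrightarrow> P g0" using a(1) by (rule dfn_same[OF \<Sigma>[OF P]])
    then show ?thesis using a(3) by blast
  qed
  ultimately show ?thesis by blast
qed

lemma dfn_swap: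
  assumes "dfn C (I <+> J) Q" and "C \<subseteq> V"
  shows "dfn C (J <+> I) (\<lambda>e. Q (case_sum (\<lambda>i. e (Inr i)) (\<lambda>j. e (Inl j))))"
proof -
  have "(\<lambda>k. e (case_sum Inr Inl k)) = case_sum (\<lambda>i. e (Inr i)) (\<lambda>j. e (Inl j))"
    for e :: "'c + 'b \<Rightarrow> 'a" by (auto split: sum.split)
  then show ?thesis using dfn_reindex[OF assms(1), of "case_sum Inr Inl" "J <+> I"] assms(2)
    by auto
qed

text \<open>The type of \<open>Y\<close> over \<open>X\<close>, transported by \<open>f\<close>, can
  be realised: that finitely many of its formulas have a common solution is itself a property of
  \<open>X\<close>, which \<open>f\<close> preserves.\<close>

lemma emap_extend:
  assumes f: "emap X f" and X: "small U \<kappa> X" and Y: "small U \<kappa> Y"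
  obtains g where "emap (X \<union> Y) g" and "\<And>x. x \<in> X \<Longrightarrow> g x = f x"
proof -
  have XV: "X \<subseteq> V" "Y \<subseteq> V" "f ` X \<subseteq> V" using X Y small_V emapD(2)[OF f] by auto
  let ?Q = "{Q. dfn {} (Y <+> X) Q \<and> Q (case_sum id id)}"
  let ?\<Sigma> = "(\<lambda>Q y. Q (case_sum y f)) ` ?Q"
  have fin: "\<exists>y. y ` Y \<subseteq> V \<and> (\<forall>P\<in>\<Sigma>0. P y)" if \<Sigma>0: "finite \<Sigma>0" "\<Sigma>0 \<subseteq> ?\<Sigma>" for \<Sigma>0
  proof -
    obtain S where S: "finite S" "S \<subseteq> ?Q" "\<Sigma>0 = (\<lambda>Q y. Q (case_sum y f)) ` S"
      using finite_subset_image[OF \<Sigma>0] by blast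
    have "dfn {} (Y <+> X) (\<lambda>e. \<forall>Q\<in>S. Q e)" using S by (intro dfn_ball) auto
    from dfn_ex_family[OF dfn_swap[OF this]]
    have E: "dfn {} X (\<lambda>a. \<exists>y. y ` Y \<subseteq> V \<and> (\<forall>Q\<in>S. Q (case_sum y a)))" by simp
    have "\<exists>y. y ` Y \<subseteq> V \<and> (\<forall>Q\<in>S. Q (case_sum y id))" using XV S(2) by (intro exI[of _ id]) auto
    then have "\<exists>y. y ` Y \<subseteq> V \<and> (\<forall>Q\<in>S. Q (case_sum y (\<lambda>x. f (id x))))"
      using emap_dfn[OF f _ _ E, of id] by simp
    then show ?thesis using S(3) by auto
  qed
  have D: "dfn (f ` X) Y P" if P: "P \<in> ?\<Sigma>" for P
  proof -
    obtain Q where Q: "dfn {} (Y <+> X) Q" "P = (\<lambda>y. Q (case_sum y f))" using P by blast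
    show ?thesis unfolding Q(2) by (rule dfn_param[OF dfn_mono[OF Q(1)]]) (use XV in auto)
  qed
  have "\<exists>y. y ` Y \<subseteq> V \<and> (\<forall>P\<in>?\<Sigma>. P y)"
    by (rule realize[OF small_image[OF small_card[OF X] XV(3)] small_card[OF Y] D fin])
  then obtain y where y: "y ` Y \<subseteq> V" "\<forall>P\<in>?\<Sigma>. P y" by (elim exE conjE) (rule that)
  have st: "same_type L U {} (Y <+> X) (case_sum id id) (case_sum y f)"
    using y(2) by (intro same_typeI) auto
  obtain g where g: "emap ({} \<union> case_sum id id ` (Y <+> X)) g"
    "\<And>i. i \<in> Y <+> X \<Longrightarrow> g (case_sum id id i) = case_sum y f i"
    using same_type_emap[OF st] XV y(1) by auto
  have "emap (X \<union> Y) g" using g(1) by (simp add: Un_commute)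
  moreover have "g x = f x" if "x \<in> X" for x using g(2)[of "Inr x"] that by auto
  ultimately show ?thesis using that by blast
qed

end

subsection \<open>Definability of types\<close>

context first_order_structure
begin

section \<open>Elementary maps that fix a set of parameters pointwise\<close>

definition emap_over :: "'a set \<Rightarrow> 'a set \<Rightarrow> ('a \<Rightarrow> 'a) \<Rightarrow> bool" where
  "emap_over C A f \<longleftrightarrow> emap (C \<union> A) f \<and> (\<forall>c\<in>C. f c = c)"

lemma emap_overD:
  assumes "emap_over C A f"
  shows "emap (C \<union> A) f" "\<And>c. c \<in> C \<Longrightarrow> f c = c" "C \<subseteq> V" "A \<subseteq> V" "f ` A \<subseteq> V"
  using assms emapD(1,2)[of "C \<union> A" f] by (auto simp: emap_over_def)

lemma emap_over_dfn:
  assumes "emap_over C A f" and "dfn C I P" and "a ` I \<subseteq> C \<union> A"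
  shows "P a \<longleftrightarrow> P (\<lambda>i. f (a i))"
  using emap_dfn[OF emap_overD(1,2)[OF assms(1)] _ assms(2,3)] by blast

lemma same_type_emap_over:
  assumes "same_type L U C A id g" and "A \<subseteq> V" "g ` A \<subseteq> V" "C \<subseteq> V"
  obtains f where "emap_over C A f" and "\<And>x. x \<in> A \<Longrightarrow> f x = g x"
proof -
  have "id ` A \<subseteq> V" using assms(2) by simp
  from same_type_emap[OF assms(1) this assms(3,4)] obtain f where f: "emap (C \<union> id ` A) f"
    "\<And>c. c \<in> C \<Longrightarrow> f c = c" "\<And>i. i \<in> A \<Longrightarrow> f (id i) = g i" by blast
  show ?thesis
  proof (rule that)
    show "emap_over C A f" using f(1,2) by (simp add: emap_over_def)
    show "f x = g x" if "x \<in> A" for x using f(3)[OF that] by simp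
  qed
qed

lemma emap_over_mono:
  assumes "emap_over C A f" and "C' \<subseteq> C" and "A' \<subseteq> A \<union> C"
  shows "emap_over C' A' f"
proof -
  have "C' \<union> A' \<subseteq> C \<union> A" using assms(2,3) by blast
  then show ?thesis using assms(1,2) emap_subset unfolding emap_over_def by blast
qed

lemma emap_over_comp:
  assumes f: "emap_over C A f" and g: "emap_over C (f ` A) g"
  shows "emap_over C A (\<lambda>x. g (f x))"
proof -
  have "f ` (C \<union> A) = C \<union> f ` A" using emap_overD(2)[OF f] by force
  then have "emap (f ` (C \<union> A)) g" using emap_overD(1)[OF g] by simp
  from emap_comp[OF emap_overD(1)[OF f] this] show ?thesis
    using emap_overD(2)[OF f] emap_overD(2)[OF g] by (simp add: emap_over_def)
qed

lemma emap_over_inv: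
  assumes f: "emap_over C A f"
  obtains g where "emap_over C (f ` A) g" and "\<And>x. x \<in> A \<Longrightarrow> g (f x) = x"
proof -
  let ?g = "inv_into (C \<union> A) f"
  have i: "inj_on f (C \<union> A)" using emap_inj[OF emap_overD(1)[OF f]] .
  have g: "?g (f x) = x" if "x \<in> C \<union> A" for x using inv_into_f_f[OF i that] .
  have im: "f ` (C \<union> A) = C \<union> f ` A" using emap_overD(2)[OF f] by force
  have "?g c = c" if "c \<in> C" for c using g[of c] emap_overD(2)[OF f that] that by simp
  then have "emap_over C (f ` A) ?g"
    using emap_inv[OF emap_overD(1)[OF f]] unfolding emap_over_def im by blast
  then show ?thesis using that g by blast
qed

lemma emap_holds_at:
  assumes f: "emap X f" and a: "set a \<subseteq> X" and \<theta>: "(\<phi>, b) \<in> fms_over L X (length a)"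
  shows "holds_at U a (\<phi>, b) \<longleftrightarrow> holds_at U (map f a) (\<phi>, map f b)"
proof -
  have \<phi>: "wf_fm L \<phi>" "fv \<phi> \<subseteq> {..<length a + length b}" "set b \<subseteq> X"
    using \<theta> by (auto simp: fms_over_def in_lists_conv_set)
  have "(a @ b) ! v \<in> X" if "v \<in> fv \<phi>" for v
  proof -
    have "v < length (a @ b)" using \<phi>(2) that by auto
    from nth_mem[OF this] show ?thesis using a \<phi>(3) by auto
  qed
  then have "(!) (a @ b) ` fv \<phi> \<subseteq> X" by blast
  from emapD(3)[OF f \<phi>(1) this]
  have "holds_at U a (\<phi>, b) \<longleftrightarrow> sat U (\<lambda>v. f ((a @ b) ! v)) \<phi>" by (simp add: holds_at_def)
  also have "\<dots> \<longleftrightarrow> sat U ((!) (map f a @ map f b)) \<phi>"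
    using \<phi>(2) by (intro sat_cong ballI) (auto simp flip: map_append)
  finally show ?thesis by (simp add: holds_at_def)
qed

end

locale stable_monster = monster L U \<kappa>
  for L :: "('f, 'r) lang" and U :: "('f, 'r, 'a) struct" and \<kappa> :: "'k rel" +
  assumes no_order: "\<And>m n \<phi>. \<not> order_property L U m n \<phi>"
begin

section \<open>Exclusion of ladders and definability of types\<close>

lemma no_ladder_less:
  assumes Q: "dfn {} (I <+> J) Q" and a: "\<And>i::nat. a i ` I \<subseteq> V" and b: "\<And>j::nat. b j ` J \<subseteq> V"
    and ab: "\<And>i j. Q (case_sum (a i) (b j)) \<longleftrightarrow> i < j"
  shows False
proof -
  from Q obtain ms js \<phi> where \<phi>: "set ms \<subseteq> I" "set js \<subseteq> J" "distinct ms" "wf_fm L \<phi>"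
    "fv \<phi> \<subseteq> {..<length ms + length js}"
    "\<And>a b. a ` I \<subseteq> V \<Longrightarrow> b ` J \<subseteq> V \<Longrightarrow>
      Q (case_sum a b) \<longleftrightarrow> sat U ((!) (map a ms @ map b js)) \<phi>" by (rule dfn_lists) (rule that)
  have "\<forall>i j. sat U ((!) (map (a i) ms @ map (b j) js)) \<phi> \<longleftrightarrow> i < j"
    using \<phi>(6)[OF a b] ab by simp
  moreover have "map (a i) ms \<in> lists V" "map (b i) js \<in> lists V" for i
    using \<phi>(1,2) a[of i] b[of i] by (auto simp: in_lists_conv_set image_subset_iff)
  ultimately have "order_property L U (length ms) (length js) \<phi>"
    unfolding order_property_def using \<phi>(4,5)
    by (intro conjI exI[of _ "\<lambda>i. map (a i) ms"] exI[of _ "\<lambda>j. map (b j) js"]) auto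
  then show False using no_order by blast
qed

lemma no_ladder_le:
  assumes Q: "dfn {} (I <+> J) Q" and a: "\<And>i::nat. a i ` I \<subseteq> V" and b: "\<And>j::nat. b j ` J \<subseteq> V"
    and ab: "\<And>i j. Q (case_sum (a i) (b j)) \<longleftrightarrow> i \<le> j"
  shows False
  \<comment> \<open>Shifting the first sequence by one turns \<le> into a strict inequality.\<close>
  by (rule no_ladder_less[OF Q, of "\<lambda>i. a (Suc i)" b]) (use a b ab in auto)

lemma no_ladder_greater:
  assumes Q: "dfn {} (I <+> J) Q" and a: "\<And>i::nat. a i ` I \<subseteq> V" and b: "\<And>j::nat. b j ` J \<subseteq> V"
    and ab: "\<And>i j. Q (case_sum (a i) (b j)) \<longleftrightarrow> j < i"
  shows False
  by (rule no_ladder_le[OF dfn_not[OF Q] a b]) (simp add: ab not_less)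

lemma no_ladder_ge:
  assumes Q: "dfn {} (I <+> J) Q" and a: "\<And>i::nat. a i ` I \<subseteq> V" and b: "\<And>j::nat. b j ` J \<subseteq> V"
    and ab: "\<And>i j. Q (case_sum (a i) (b j)) \<longleftrightarrow> j \<le> i"
  shows False
  by (rule no_ladder_less[OF dfn_not[OF Q] a b]) (simp add: ab not_le)

text \<open>If no finite sequence \<open>ms\<close> works, then one constructs \<open>y\<^sub>n, y'\<^sub>n, m\<^sub>n\<close> in \<open>M\<close> from which
  Ramsey's theorem extracts a ladder for \<open>Q\<close>.\<close>

lemma finite_positive_definition:
  assumes M: "elem_sub L U M" and a: "a ` I \<subseteq> V" and Q: "dfn {} (I <+> J) Q"
  shows "\<exists>n ms. (\<forall>k<n::nat. ms k ` I \<subseteq> M) \<and> (\<forall>y y'. y ` J \<subseteq> M \<longrightarrow> y' ` J \<subseteq> M \<longrightarrow>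
    Q (case_sum a y) \<longrightarrow> (\<forall>k<n. Q (case_sum (ms k) y) \<longrightarrow> Q (case_sum (ms k) y')) \<longrightarrow>
    Q (case_sum a y'))"
proof (rule ccontr)
  assume neg: "\<not> ?thesis"
  have MV: "M \<subseteq> V" using M by (rule elem_subset)
  \<comment> \<open>The new pair shows that the earlier \<open>m\<close> do not suffice. The new
    \<open>m\<close> separates this pair and all earlier ones in the way \<open>a\<close> does, so
    \<open>Q\<close> holds at every earlier \<open>y\<close> and fails at every earlier
    \<open>y'\<close>.\<close>
  define S where "S = (\<lambda>(z :: nat \<Rightarrow> ('c \<Rightarrow> 'a) \<times> ('c \<Rightarrow> 'a) \<times> ('b \<Rightarrow> 'a)) n (y, y', m).
    y ` J \<subseteq> M \<and> y' ` J \<subseteq> M \<and> m ` I \<subseteq> M \<and> Q (case_sum m y) \<and> \<not> Q (case_sum m y') \<and>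
    (\<forall>k<n. Q (case_sum (snd (snd (z k))) y) \<longrightarrow> Q (case_sum (snd (snd (z k))) y')) \<and>
    (\<forall>k<n. Q (case_sum m (fst (z k))) \<and> \<not> Q (case_sum m (fst (snd (z k))))) \<and>
    Q (case_sum a y) \<and> \<not> Q (case_sum a y'))"
  have "\<exists>z. \<forall>n. S z n (z n)"
  proof (rule dependent_wellorder_choice)
    fix r and f g :: "nat \<Rightarrow> ('c \<Rightarrow> 'a) \<times> ('c \<Rightarrow> 'a) \<times> ('b \<Rightarrow> 'a)" and n :: nat
    assume "\<And>k. k < n \<Longrightarrow> f k = g k"
    then show "S f n r = S g n r" by (cases r) (simp add: S_def)
  next
    fix n z assume z: "\<And>k. k < n \<Longrightarrow> S z k (z k)"
    have zk: "fst (z k) ` J \<subseteq> M" "fst (snd (z k)) ` J \<subseteq> M" "snd (snd (z k)) ` I \<subseteq> M"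
      "Q (case_sum a (fst (z k)))" "\<not> Q (case_sum a (fst (snd (z k))))" if "k < n" for k
      using z[OF that] by (auto simp: S_def split: prod.splits)
    have "\<not> (\<forall>y y'. y ` J \<subseteq> M \<longrightarrow> y' ` J \<subseteq> M \<longrightarrow> Q (case_sum a y) \<longrightarrow>
        (\<forall>k<n. Q (case_sum (snd (snd (z k))) y) \<longrightarrow> Q (case_sum (snd (snd (z k))) y')) \<longrightarrow>
        Q (case_sum a y'))"
      using neg zk(3)[unfolded image_subset_iff] by (auto dest!: spec[of _ n] spec[of _ "\<lambda>k. snd (snd (z k))"])
    then obtain y y' where y: "y ` J \<subseteq> M" "y' ` J \<subseteq> M" "Q (case_sum a y)" "\<not> Q (case_sum a y')"
      "\<forall>k<n. Q (case_sum (snd (snd (z k))) y) \<longrightarrow> Q (case_sum (snd (snd (z k))) y')" by blast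
    \<comment> \<open>All these conditions hold of \<open>a\<close> itself, so they have a solution
      in \<open>M\<close>.\<close>
    let ?R = "\<lambda>m. (Q (case_sum m y) \<and> \<not> Q (case_sum m y')) \<and>
      (\<forall>k\<in>{..<n}. Q (case_sum m (fst (z k))) \<and> \<not> Q (case_sum m (fst (snd (z k)))))"
    have par: "dfn M I (\<lambda>m. Q (case_sum m b))" if "b ` J \<subseteq> M" for b
      by (rule dfn_param[OF dfn_mono[OF Q] that MV]) auto
    have "dfn M I ?R"
      using y(1,2) zk(1,2) by (intro dfn_conj dfn_not dfn_ball par) auto
    moreover have "?R a" using y(3,4) zk(4,5) by auto
    ultimately obtain m where "m ` I \<subseteq> M" "?R m" using elem_witness[OF M _ a, of ?R] by blast
    then have "S z n (y, y', m)" using y by (simp add: S_def)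
    then show "\<exists>r. S z n r" by blast
  qed
  then obtain z where z: "\<And>n. S z n (z n)" by blast
  define y y' m where "y = (\<lambda>n. fst (z n))" and "y' = (\<lambda>n. fst (snd (z n)))"
    and "m = (\<lambda>n. snd (snd (z n)))"
  have zn: "y n ` J \<subseteq> M" "y' n ` J \<subseteq> M" "m n ` I \<subseteq> M"
    "Q (case_sum (m n) (y n))" "\<not> Q (case_sum (m n) (y' n))"
    "k < n \<Longrightarrow> Q (case_sum (m k) (y n)) \<Longrightarrow> Q (case_sum (m k) (y' n))"
    "k < n \<Longrightarrow> Q (case_sum (m n) (y k))" "k < n \<Longrightarrow> \<not> Q (case_sum (m n) (y' k))" for k n
    using z[of n] by (auto simp: S_def y_def y'_def m_def split: prod.splits)
  have V: "y n ` J \<subseteq> V" "y' n ` J \<subseteq> V" "m n ` I \<subseteq> V" for n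
    using zn(1-3)[of n] MV by blast+
  \<comment> \<open>For j \<le> i the truth values at \<open>(m\<^sub>i, y\<^sub>j)\<close> are
    fixed by the construction; the colouring makes those for i < j constant. If they are true, they
    pass from \<open>y\<close> to \<open>y'\<close>, and \<open>y'\<close> gives a ladder; if they
    are false, \<open>y\<close> gives one in the opposite direction.\<close>
  define c where "c = (\<lambda>X. if Q (case_sum (m (Min X)) (y (Max X))) then 1 else 0 :: nat)"
  have "\<exists>Y t. Y \<subseteq> (UNIV :: nat set) \<and> infinite Y \<and> t < 2 \<and>
      (\<forall>i\<in>Y. \<forall>j\<in>Y. i \<noteq> j \<longrightarrow> c {i, j} = t)"
    by (rule Ramsey2) (auto simp: c_def)
  then obtain Y t where Y: "infinite Y" "t < 2" "\<And>i j. i \<in> Y \<Longrightarrow> j \<in> Y \<Longrightarrow> i \<noteq> j \<Longrightarrow> c {i, j} = t"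
    by blast
  obtain e :: "nat \<Rightarrow> nat" where e: "strict_mono e" "\<And>n. e n \<in> Y"
    using infinite_enumerate[OF Y(1)] by blast
  have less: "e i < e j \<longleftrightarrow> i < j" for i j using e(1) by (simp add: strict_mono_less)
  have c: "Q (case_sum (m (e i)) (y (e j))) \<longleftrightarrow> t = 1" if "i < j" for i j
  proof -
    have l: "e i < e j" using that less by simp
    then have "c {e i, e j} = t" using Y(3) e(2) by simp
    moreover have "Min {e i, e j} = e i" "Max {e i, e j} = e j" using l by auto
    ultimately show ?thesis using Y(2) by (auto simp: c_def split: if_splits)
  qed
  show False
  proof (cases "t = 1")
    case True
    have "Q (case_sum (m (e i)) (y' (e j))) \<longleftrightarrow> i < j" for i j
      using c[of i j] True zn(5)[of "e i"] zn(6)[of "e i" "e j"] zn(8)[of "e j" "e i"] less[of i j]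
        less[of j i] by (cases i j rule: linorder_cases) auto
    then show False by (intro no_ladder_less[OF Q, of "\<lambda>i. m (e i)" "\<lambda>j. y' (e j)"] V)
  next
    case False
    have "Q (case_sum (m (e i)) (y (e j))) \<longleftrightarrow> j \<le> i" for i j
      using c[of i j] False zn(4)[of "e i"] zn(7)[of "e j" "e i"] less[of j i]
      by (cases i j rule: linorder_cases) auto
    then show False by (intro no_ladder_ge[OF Q, of "\<lambda>i. m (e i)" "\<lambda>j. y (e j)"] V)
  qed
qed

text \<open>For \<open>y\<close> in \<open>M\<close>, the truth of \<open>Q(a, y)\<close> is
  monotone in the set of those \<open>k\<close> for which \<open>Q(ms k, y)\<close> holds. So
  \<open>d\<close> is the disjunction, over the finitely many such sets that come from positive
  instances, of the corresponding conjunctions.\<close>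

lemma definable_type:
  assumes M: "elem_sub L U M" and a: "a ` I \<subseteq> V" and Q: "dfn {} (I <+> J) Q"
  obtains d where "dfn M J d" and "\<And>m. m ` J \<subseteq> M \<Longrightarrow> Q (case_sum a m) \<longleftrightarrow> d m"
proof -
  have MV: "M \<subseteq> V" using M by (rule elem_subset)
  from finite_positive_definition[OF assms] obtain n :: nat and ms where
    ms: "\<And>k. k < n \<Longrightarrow> ms k ` I \<subseteq> M" and
    pos: "\<And>y y'. y ` J \<subseteq> M \<Longrightarrow> y' ` J \<subseteq> M \<Longrightarrow> Q (case_sum a y) \<Longrightarrow>
      (\<forall>k<n. Q (case_sum (ms k) y) \<longrightarrow> Q (case_sum (ms k) y')) \<Longrightarrow> Q (case_sum a y')" by metis
  let ?T = "\<lambda>y. {k. k < n \<and> Q (case_sum (ms k) y)}"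
  let ?S = "?T ` {y. y ` J \<subseteq> M \<and> Q (case_sum a y)}"
  let ?d = "\<lambda>y. \<exists>X\<in>?S. \<forall>k\<in>X. Q (case_sum (ms k) y)"
  have "?S \<subseteq> Pow {..<n}" by auto
  then have fin: "finite ?S" by (rule finite_subset) simp
  show ?thesis
  proof (rule that[of ?d])
    have par: "dfn M J (\<lambda>y. Q (case_sum (ms k) y))" if "k < n" for k
      using dfn_param[OF dfn_mono[OF dfn_swap[OF Q] _ subset_refl, of M] ms[OF that] MV] by simp
    show "dfn M J ?d"
      by (intro dfn_bex[OF fin] dfn_ball) (auto intro: par)
    fix y assume y: "y ` J \<subseteq> M"
    show "Q (case_sum a y) \<longleftrightarrow> ?d y"
    proof
      assume "Q (case_sum a y)"
      then show "?d y" using y by (intro bexI[of _ "?T y"]) auto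
    next
      assume "?d y"
      then obtain y0 where "y0 ` J \<subseteq> M" "Q (case_sum a y0)" "\<forall>k\<in>?T y0. Q (case_sum (ms k) y)"
        by auto
      then show "Q (case_sum a y)" using pos[of y0 y] y by auto
    qed
  qed
qed

end

subsection \<open>Definable extensions\<close>

context first_order_structure
begin

text \<open>The type of \<open>A\<close> over \<open>D\<close> is the extension of the type of \<open>A\<close> over \<open>M\<close> given by its
  definition schema.\<close>

definition def_indep :: "'a set \<Rightarrow> 'a set \<Rightarrow> 'a set \<Rightarrow> bool" where
  "def_indep A M D \<longleftrightarrow> (\<forall>W d. dfn {} (A <+> D) W \<and> dfn M D d \<and>
     (\<forall>m. m ` D \<subseteq> M \<longrightarrow> (W (case_sum id m) \<longleftrightarrow> d m)) \<longrightarrow> (W (case_sum id id) \<longleftrightarrow> d id))"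

lemma dfn_reindex2:
  assumes "dfn {} (I <+> J) W" and "f ` I \<subseteq> I'" and "g ` J \<subseteq> J'"
  shows "dfn {} (I' <+> J') (\<lambda>e. W (case_sum (\<lambda>i. e (Inl (f i))) (\<lambda>j. e (Inr (g j)))))"
proof -
  let ?h = "case_sum (\<lambda>i. Inl (f i)) (\<lambda>j. Inr (g j))"
  have "(\<lambda>k. e (?h k)) = case_sum (\<lambda>i. e (Inl (f i))) (\<lambda>j. e (Inr (g j)))" for e :: "'d + 'e \<Rightarrow> 'a"
    by (auto split: sum.split)
  moreover have "?h ` (I <+> J) \<subseteq> I' <+> J'" using assms(2,3) by auto
  ultimately show ?thesis using dfn_reindex[OF assms(1), of ?h "I' <+> J'"] by simp
qed

text \<open>\<open>def_indep\<close> indexes variables by the elements themselves; this is its form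
  for tuples with other index sets, possibly with repetitions.\<close>

lemma def_indep_tuple:
  assumes DI: "def_indep A M D" and M: "M \<subseteq> V" and D: "D \<subseteq> V"
    and a: "a ` I \<subseteq> A" and u: "u ` J \<subseteq> D"
    and W: "dfn {} (I <+> J) W" and d: "dfn M J d"
    and eq: "\<And>m. m ` J \<subseteq> M \<Longrightarrow> W (case_sum a m) \<longleftrightarrow> d m"
  shows "W (case_sum a u) \<longleftrightarrow> d u"
proof -
  let ?W = "\<lambda>e. W (case_sum (\<lambda>i. e (Inl (a i))) (\<lambda>j. e (Inr (u j))))"
  let ?d = "\<lambda>e. d (\<lambda>j. e (u j))"
  have 1: "dfn {} (A <+> D) ?W" by (rule dfn_reindex2[OF W a u])
  have 2: "dfn M D ?d" by (rule dfn_reindex[OF d u M])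
  have 3: "?W (case_sum id m) \<longleftrightarrow> ?d m" if "m ` D \<subseteq> M" for m
  proof -
    have "(\<lambda>j. m (u j)) ` J \<subseteq> M" using that u by blast
    from eq[OF this] show ?thesis by simp
  qed
  from DI[unfolded def_indep_def, rule_format, of ?W ?d] 1 2 3
  have "?W (case_sum id id) \<longleftrightarrow> ?d id" by blast
  then show ?thesis by simp
qed

lemma def_indep_mono:
  assumes DI: "def_indep A M D" and "M \<subseteq> V" and "D \<subseteq> V" and "A' \<subseteq> A" and "D' \<subseteq> D"
  shows "def_indep A' M D'"
  unfolding def_indep_def
proof (intro allI impI, elim conjE)
  fix W d assume W: "dfn {} (A' <+> D') W" "dfn M D' d"
    "\<forall>m. m ` D' \<subseteq> M \<longrightarrow> (W (case_sum id m) \<longleftrightarrow> d m)"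
  show "W (case_sum id id) \<longleftrightarrow> d id"
    by (rule def_indep_tuple[OF DI assms(2,3) _ _ W(1,2)]) (use assms(4,5) W(3) in auto)
qed

text \<open>Formulas about the image are pulled back along the inverse of \<open>f\<close>. Since
  \<open>f\<close> fixes \<open>D\<close>, and with it \<open>M\<close>, neither the parameters in
  \<open>D\<close> nor the definitions change.\<close>

lemma def_indep_emap:
  assumes DI: "def_indep A M D" and f: "emap_over D A f" and MD: "M \<subseteq> D"
  shows "def_indep (f ` A) M D"
  unfolding def_indep_def
proof (intro allI impI, elim conjE)
  fix W d assume W: "dfn {} (f ` A <+> D) W" and d: "dfn M D d"
    and eq: "\<forall>m. m ` D \<subseteq> M \<longrightarrow> (W (case_sum id m) \<longleftrightarrow> d m)"
  have fV: "f ` A \<subseteq> V" "A \<subseteq> V" "D \<subseteq> V" using emap_overD[OF f] by auto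
  have inj: "inj_on f A" using emap_inj[OF emap_overD(1)[OF f]] inj_on_subset by blast
  let ?s = "\<lambda>b. inv_into A f b"
  have s: "?s b \<in> A" "f (?s b) = b" if "b \<in> f ` A" for b
    using that by (auto intro: inv_into_into f_inv_into_f)
  have sub: "?s ` f ` A \<subseteq> A" using s(1) by blast
  have *: "W (case_sum ?s m) \<longleftrightarrow> W (case_sum id m)" if m: "m ` D \<subseteq> D" for m
  proof -
    have P: "dfn D (f ` A) (\<lambda>x. W (case_sum x m))"
      by (rule dfn_param[OF dfn_mono[OF W] m fV(3)]) auto
    have "W (case_sum ?s m) \<longleftrightarrow> W (case_sum (\<lambda>b. f (?s b)) m)"
      by (rule emap_over_dfn[OF f P]) (use sub in blast)
    also have "\<dots> \<longleftrightarrow> W (case_sum id m)"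
      by (rule dfn_same[OF P]) (use s(2) fV(1) in auto)
    finally show ?thesis .
  qed
  have "W (case_sum ?s id) \<longleftrightarrow> d id"
    by (rule def_indep_tuple[OF DI _ fV(3) sub _ W d]) (use * eq MD fV(3) in auto)
  then show "W (case_sum id id) \<longleftrightarrow> d id" using *[of id] by simp
qed

end

context stable_monster
begin

text \<open>Take finitely many formulas with their definitions. That the definitions imply the
  existence of a common solution is definable over \<open>M\<close>; it is true throughout
  \<open>M\<close>, with \<open>A\<close> itself as solution, hence also at
  \<open>D\<close>.\<close>

lemma def_indep_extension:
  assumes M: "elem_sub L U M" and A: "small U \<kappa> A" and D: "small U \<kappa> D" and MD: "M \<subseteq> D"
  obtains g where "emap_over M A g" and "def_indep (g ` A) M D"
proof -
  have V: "A \<subseteq> V" "D \<subseteq> V" "M \<subseteq> V" using A D MD small_V by auto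
  let ?T = "{(W, d). dfn {} (A <+> D) W \<and> dfn M D d \<and>
    (\<forall>m. m ` D \<subseteq> M \<longrightarrow> (W (case_sum id m) \<longleftrightarrow> d m)) \<and> d id}"
  let ?\<Sigma> = "(\<lambda>(W, d) x. W (case_sum x id)) ` ?T"
  have "dfn D A P" if P: "P \<in> ?\<Sigma>" for P
  proof -
    obtain W d where W: "dfn {} (A <+> D) W" "P = (\<lambda>x. W (case_sum x id))" using P by auto
    show ?thesis unfolding W(2) by (rule dfn_param[OF dfn_mono[OF W(1)]]) (use V in auto)
  qed
  moreover have "\<exists>x. x ` A \<subseteq> V \<and> (\<forall>P\<in>\<Sigma>0. P x)" if \<Sigma>0: "finite \<Sigma>0" "\<Sigma>0 \<subseteq> ?\<Sigma>" for \<Sigma>0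
  proof -
    obtain S where S: "finite S" "S \<subseteq> ?T" "\<Sigma>0 = (\<lambda>(W, d) x. W (case_sum x id)) ` S"
      using finite_subset_image[OF \<Sigma>0] by blast
    have S': "dfn {} (A <+> D) (fst p)" "dfn M D (snd p)" "snd p id"
      "\<And>m. m ` D \<subseteq> M \<Longrightarrow> fst p (case_sum id m) \<longleftrightarrow> snd p m" if "p \<in> S" for p
      using S(2) that by auto
    let ?E = "\<lambda>y. \<exists>x. x ` A \<subseteq> V \<and> (\<forall>p\<in>S. fst p (case_sum x y))"
    have "dfn {} (A <+> D) (\<lambda>e. \<forall>p\<in>S. fst p e)" using S'(1) by (intro dfn_ball S(1))
    from dfn_ex_family[OF dfn_swap[OF this]] have "dfn {} D ?E" by simp
    then have "dfn M D ?E" by (rule dfn_mono) auto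
    then have H: "dfn M D (\<lambda>y. (\<forall>p\<in>S. snd p y) \<longrightarrow> ?E y)"
      using S'(2) by (intro dfn_imp dfn_ball S(1))
    have "(\<forall>p\<in>S. snd p m) \<longrightarrow> ?E m" if "m ` D \<subseteq> M" for m
      using S'(4)[OF _ that] V(1) by (intro impI exI[of _ id]) auto
    from elem_all[OF M H this, of id] V(2) S'(3) have "?E id" by auto
    then show ?thesis unfolding S(3) by (auto simp: case_prod_beta)
  qed
  ultimately have "\<exists>x. x ` A \<subseteq> V \<and> (\<forall>P\<in>?\<Sigma>. P x)"
    by (rule realize[OF D small_card[OF A]])
  then obtain g0 where g0V: "g0 ` A \<subseteq> V" and g0: "\<forall>P\<in>?\<Sigma>. P g0" by (elim exE conjE) (rule that)
  have imp: "W (case_sum g0 id)" if "dfn {} (A <+> D) W" "dfn M D d"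
    "\<And>m. m ` D \<subseteq> M \<Longrightarrow> W (case_sum id m) \<longleftrightarrow> d m" "d id" for W d
  proof -
    have "(W, d) \<in> ?T" using that by simp
    from g0[THEN bspec, OF imageI[OF this]] show ?thesis by simp
  qed
  \<comment> \<open>The negated formula has the negated definition, so the implication is an
    equivalence.\<close>
  have star: "W (case_sum g0 id) \<longleftrightarrow> d id" if "dfn {} (A <+> D) W" "dfn M D d"
    "\<And>m. m ` D \<subseteq> M \<Longrightarrow> W (case_sum id m) \<longleftrightarrow> d m" for W d
    using imp[OF that] imp[OF dfn_not[OF that(1)] dfn_not[OF that(2)]] that(3) by blast
  have "same_type L U M A id g0"
  proof (rule same_typeI)
    fix P :: "('a \<Rightarrow> 'a) \<Rightarrow> bool" assume P: "dfn M A P" "P id"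
    from P(1) have "dfn ({} \<union> M) A P" by simp
    then obtain Q where Q: "dfn {} (A <+> M) Q"
      "\<And>a. a ` A \<subseteq> V \<Longrightarrow> P a \<longleftrightarrow> Q (case_sum a id)" by (rule dfn_abstract) (rule that)
    have "id ` A \<subseteq> V" using V(1) by simp
    from definable_type[OF M this Q(1)] obtain d where d: "dfn M M d"
      "\<And>m. m ` M \<subseteq> M \<Longrightarrow> Q (case_sum id m) \<longleftrightarrow> d m" by blast
    have "Q (case_sum g0 id) \<longleftrightarrow> d id"
    proof (rule star)
      show "dfn {} (A <+> D) Q" by (rule dfn_mono[OF Q(1)]) (use MD in auto)
      show "dfn M D d" by (rule dfn_mono[OF d(1)]) (use MD in auto)
      show "Q (case_sum id m) \<longleftrightarrow> d m" if "m ` D \<subseteq> M" for m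
        using d(2)[of m] that MD by blast
    qed
    also have "d id \<longleftrightarrow> P id" using d(2)[of id] Q(2)[of id] V(1) by simp
    finally show "P g0" using P(2) Q(2)[OF g0V] by blast
  qed
  from same_type_emap_over[OF this V(1) g0V V(3)] obtain g where
    g: "emap_over M A g" "\<And>x. x \<in> A \<Longrightarrow> g x = g0 x" by blast
  have gA: "g ` A = g0 ` A" using g(2) by force
  have "def_indep (g ` A) M D"
    unfolding def_indep_def
  proof (intro allI impI, elim conjE)
    fix W d assume W: "dfn {} (g ` A <+> D) W" and d: "dfn M D d"
      and eq: "\<forall>m. m ` D \<subseteq> M \<longrightarrow> (W (case_sum id m) \<longleftrightarrow> d m)"
    let ?s = "inv_into A g"
    have s: "?s b \<in> A" "g (?s b) = b" if "b \<in> g ` A" for b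
      using that by (auto intro: inv_into_into f_inv_into_f)
    have sub: "?s ` g ` A \<subseteq> A" using s(1) by blast
    let ?W = "\<lambda>e. W (case_sum (\<lambda>b. e (Inl (?s b))) (\<lambda>u. e (Inr (id u))))"
    have W': "dfn {} (A <+> D) ?W" by (rule dfn_reindex2[OF W sub]) simp
    have gs: "W (case_sum (\<lambda>b. g (?s b)) m) \<longleftrightarrow> W (case_sum id m)" if "m ` D \<subseteq> V" for m
      by (rule dfn_same[OF W]) (use s(2) that g0V gA in \<open>auto split: sum.splits\<close>)
    have W'm: "?W (case_sum id m) \<longleftrightarrow> d m" if m: "m ` D \<subseteq> M" for m
    proof -
      have mV: "m ` D \<subseteq> V" using m V(3) by blast
      have P: "dfn M (g ` A) (\<lambda>x. W (case_sum x m))"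
        by (rule dfn_param[OF dfn_mono[OF W] m V(3)]) auto
      have "W (case_sum ?s m) \<longleftrightarrow> W (case_sum (\<lambda>b. g (?s b)) m)"
        by (rule emap_over_dfn[OF g(1) P]) (use sub in blast)
      then show ?thesis using gs[OF mV] eq m by simp
    qed
    have "?W (case_sum g0 id) \<longleftrightarrow> d id" by (rule star[OF W' d W'm])
    moreover have "?W (case_sum g0 id) \<longleftrightarrow> W (case_sum (\<lambda>b. g (?s b)) id)"
      using g(2) s(1) by (intro dfn_same[OF W]) (use g0V V(2) sub in \<open>auto split: sum.splits\<close>)
    ultimately show "W (case_sum id id) \<longleftrightarrow> d id" using gs[of id] V(2) by simp
  qed
  then show ?thesis using that g(1) by blast
qed

text \<open>A map that is elementary over \<open>M\<close> preserves definitions over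
  \<open>M\<close>, so one \<open>d\<close> serves \<open>A\<close> and its image; its truth value
  at \<open>D\<close> decides the formula for both.\<close>

lemma def_indep_unique:
  assumes M: "elem_sub L U M" and MD: "M \<subseteq> D" and D: "D \<subseteq> V" and g: "emap_over M A g"
    and DI: "def_indep A M D" "def_indep (g ` A) M D"
  obtains h where "emap_over D A h" and "\<And>x. x \<in> A \<Longrightarrow> h x = g x"
proof -
  have V: "A \<subseteq> V" "M \<subseteq> V" "g ` A \<subseteq> V" using emap_overD[OF g] by auto
  have "same_type L U D A id g"
  proof (rule same_typeI)
    fix P :: "('a \<Rightarrow> 'a) \<Rightarrow> bool" assume P: "dfn D A P" "P id"
    from P(1) have "dfn ({} \<union> D) A P" by simp
    then obtain Q where Q: "dfn {} (A <+> D) Q"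
      "\<And>a. a ` A \<subseteq> V \<Longrightarrow> P a \<longleftrightarrow> Q (case_sum a id)" by (rule dfn_abstract) (rule that)
    have "id ` A \<subseteq> V" using V(1) by simp
    from definable_type[OF M this Q(1)] obtain d where d: "dfn M D d"
      "\<And>m. m ` D \<subseteq> M \<Longrightarrow> Q (case_sum id m) \<longleftrightarrow> d m" by blast
    have eq: "Q (case_sum g m) \<longleftrightarrow> d m" if m: "m ` D \<subseteq> M" for m
    proof -
      have "dfn M A (\<lambda>x. Q (case_sum x m))"
        by (rule dfn_param[OF dfn_mono[OF Q(1)] m V(2)]) auto
      from emap_over_dfn[OF g this, of id] d(2)[OF m] show ?thesis by simp
    qed
    have "Q (case_sum g id) \<longleftrightarrow> d id"
      by (rule def_indep_tuple[OF DI(2) V(2) D _ _ Q(1) d(1) eq]) simp_all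
    moreover have "Q (case_sum id id) \<longleftrightarrow> d id"
      by (rule def_indep_tuple[OF DI(1) V(2) D _ _ Q(1) d(1) d(2)]) simp_all
    ultimately show "P g" using P(2) Q(2)[of id] Q(2)[OF V(3)] V(1) by simp
  qed
  from same_type_emap_over[OF this V(1,3) D] that show ?thesis by blast
qed

text \<open>Choose a copy of \<open>A\<close> independent from a set that contains \<open>D\<close>,
  the parameters of the covering formulas and their witnessing sequences. By uniqueness it has the
  type of \<open>A\<close> over \<open>D\<close>, so it satisfies some covering
  \<open>\<delta>\<close>; the definition of \<open>\<delta>\<close> over \<open>M\<close> is then
  true along the whole witnessing sequence, contradicting its inconsistency.\<close>

lemma def_indep_nf_indep:
  assumes M: "elem_sub L U M" and A: "small U \<kappa> A" and D: "small U \<kappa> D" and MD: "M \<subseteq> D"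
    and DI: "def_indep A M D"
  shows "nf_indep L U A M D"
  unfolding nf_indep_def
proof (intro ballI conjI)
  fix a assume "a \<in> lists A"
  then have a: "set a \<subseteq> A" by (auto simp: in_lists_conv_set)
  have V: "A \<subseteq> V" "D \<subseteq> V" "M \<subseteq> V" using A D MD small_V by auto
  show "tp L U M a \<subseteq> tp L U D a"
    using MD by (auto simp: tp_def fms_over_def in_lists_conv_set)
  fix \<theta> assume \<theta>: "\<theta> \<in> tp L U D a"
  let ?n = "length a"
  show "\<not> forks L U M ?n \<theta>"
  proof
    assume "forks L U M ?n \<theta>"
    then obtain \<Delta> where \<Delta>: "finite \<Delta>" "\<Delta> \<subseteq> fms_over L V ?n" "\<And>\<delta>. \<delta> \<in> \<Delta> \<Longrightarrow> divides L U M ?n \<delta>"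
      "\<And>x. x \<in> tuples V ?n \<Longrightarrow> holds_at U x \<theta> \<Longrightarrow> \<exists>\<delta>\<in>\<Delta>. holds_at U x \<delta>"
      unfolding forks_def by blast
    have "\<forall>\<delta>\<in>\<Delta>. \<exists>k bs. (\<forall>i::nat. bs i \<in> tuples V (length (snd \<delta>)) \<and>
        same_type L U M {..<length (snd \<delta>)} ((!) (snd \<delta>)) ((!) (bs i))) \<and>
      (\<forall>S. finite S \<and> card S = k \<longrightarrow>
        \<not> (\<exists>x\<in>tuples V ?n. \<forall>i\<in>S. holds_at U x (fst \<delta>, bs i)))"
      using \<Delta>(3) unfolding divides_def case_prod_beta by blast
    then obtain k bs where bs: "\<And>\<delta> i::nat. \<delta> \<in> \<Delta> \<Longrightarrow> bs \<delta> i \<in> tuples V (length (snd \<delta>))"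
      "\<And>\<delta> i. \<delta> \<in> \<Delta> \<Longrightarrow> same_type L U M {..<length (snd \<delta>)} ((!) (snd \<delta>)) ((!) (bs \<delta> i))"
      "\<And>\<delta> S. \<delta> \<in> \<Delta> \<Longrightarrow> finite S \<Longrightarrow> card S = k \<delta> \<Longrightarrow>
        \<not> (\<exists>x\<in>tuples V ?n. \<forall>i\<in>S. holds_at U x (fst \<delta>, bs \<delta> i))" by metis
    have \<delta>V: "set (snd \<delta>) \<subseteq> V" "\<And>i. set (bs \<delta> i) \<subseteq> V" "\<And>i. length (bs \<delta> i) = length (snd \<delta>)"
      if "\<delta> \<in> \<Delta>" for \<delta>
      using \<Delta>(2) bs(1) that by (force simp: fms_over_def tuples_def in_lists_conv_set)+
    let ?D = "D \<union> (\<Union>\<delta>\<in>\<Delta>. \<Union>i. set (snd \<delta>) \<union> set (bs \<delta> i))"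
    have D': "small U \<kappa> ?D"
      using \<delta>V by (intro small_Un D small_UN_finite \<Delta>(1) small_UN_nat) auto
    have D'V: "?D \<subseteq> V" using D' by (rule small_V)
    obtain g where g: "emap_over M A g" "def_indep (g ` A) M ?D"
      by (rule def_indep_extension[OF M A D']) (use MD in auto)
    have "def_indep (g ` A) M D" by (rule def_indep_mono[OF g(2) V(3) D'V]) auto
    from def_indep_unique[OF M MD V(2) g(1) DI this] obtain h where
      h: "emap_over D A h" "\<And>x. x \<in> A \<Longrightarrow> h x = g x" by blast
    let ?a = "map g a"
    have ga: "map h a = ?a" using h(2) a by auto
    obtain \<phi> b where \<theta>': "\<theta> = (\<phi>, b)" by force
    have b: "set b \<subseteq> D" "(\<phi>, b) \<in> fms_over L (D \<union> A) ?n" "holds_at U a (\<phi>, b)"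
      using \<theta> unfolding \<theta>' by (auto simp: tp_def fms_over_def in_lists_conv_set)
    have "map h b = b" using b(1) emap_overD(2)[OF h(1)] by (simp add: map_idI subset_iff)
    then have "holds_at U ?a \<theta>"
      using emap_holds_at[OF emap_overD(1)[OF h(1)] _ b(2)] a b(3) ga \<theta>' by auto
    moreover have gV: "?a \<in> tuples V ?n"
      using a emap_overD(5)[OF g(1)] by (auto simp: tuples_def in_lists_conv_set)
    ultimately obtain \<delta> where \<delta>: "\<delta> \<in> \<Delta>" "holds_at U ?a \<delta>" using \<Delta>(4) by blast
    let ?l = "length (snd \<delta>)"
    have \<phi>: "wf_fm L (fst \<delta>)" "fv (fst \<delta>) \<subseteq> {..<?n + ?l}"
      using subsetD[OF \<Delta>(2) \<delta>(1)] by (auto simp: fms_over_def)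
    let ?W = "\<lambda>e. sat U ((!) (map (\<lambda>i. e (Inl i)) [0..<?n] @ map (\<lambda>j. e (Inr j)) [0..<?l])) (fst \<delta>)"
    have W: "dfn {} ({..<?n} <+> {..<?l}) ?W" by (rule dfn_sat_lists[OF \<phi>])
    have WH: "?W (case_sum ((!) ?a) ((!) c)) \<longleftrightarrow> holds_at U ?a (fst \<delta>, c)" if "length c = ?l" for c
    proof -
      have "map ((!) ?a) [0..<?n] = ?a" using map_nth[of ?a] by simp
      moreover have "map ((!) c) [0..<?l] = c" using map_nth[of c] that by simp
      ultimately show ?thesis unfolding holds_at_def sum.case fst_conv snd_conv by (simp only:)
    qed
    have aA: "(!) ?a ` {..<?n} \<subseteq> g ` A" using a nth_mem[of _ a] by (force simp: subset_iff)
    then have aV: "(!) ?a ` {..<?n} \<subseteq> V" using emap_overD(5)[OF g(1)] by blast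
    from definable_type[OF M aV W] obtain d where d: "dfn M {..<?l} d"
      "\<And>m. m ` {..<?l} \<subseteq> M \<Longrightarrow> ?W (case_sum ((!) ?a) m) \<longleftrightarrow> d m" by blast
    have Wd: "?W (case_sum ((!) ?a) u) \<longleftrightarrow> d u" if "u ` {..<?l} \<subseteq> ?D" for u
      by (rule def_indep_tuple[OF g(2) V(3) D'V aA that W d])
    have c: "(!) (snd \<delta>) ` {..<?l} \<subseteq> ?D" using \<delta>(1) by auto
    have ci: "(!) (bs \<delta> i) ` {..<?l} \<subseteq> ?D" for i
    proof -
      have "bs \<delta> i ! j \<in> set (bs \<delta> i)" if "j < ?l" for j using \<delta>V(3)[OF \<delta>(1), of i] that by simp
      then show ?thesis using \<delta>(1) by blast
    qed
    have "d ((!) (snd \<delta>))" using Wd[OF c] WH[of "snd \<delta>"] \<delta>(2) by simp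
    then have "d ((!) (bs \<delta> i))" for i
      using same_type_dfn[OF bs(2)[OF \<delta>(1)] d(1)] c ci D'V by (meson order_trans)
    then have "holds_at U ?a (fst \<delta>, bs \<delta> i)" for i
      using Wd[OF ci] WH[OF \<delta>V(3)[OF \<delta>(1)]] by blast
    then show False using bs(3)[OF \<delta>(1), of "{..<k \<delta>}"] gV by auto
  qed
qed

end

subsection \<open>Algebraic closure, dividing, and independence over models\<close>

context first_order_structure
begin

section \<open>Algebraic closure\<close>

lemma acl_iff:
  assumes C: "C \<subseteq> V"
  shows "a \<in> acl L U C \<longleftrightarrow> a \<in> V \<and>
    (\<exists>P. dfn C (UNIV :: unit set) (\<lambda>e. P (e ())) \<and> P a \<and> finite {x \<in> V. P x})"
proof
  assume "a \<in> acl L U C"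
  then obtain \<phi> b where a: "a \<in> V" and \<theta>: "(\<phi>, b) \<in> fms_over L C 1" "holds_at U [a] (\<phi>, b)"
    "finite {x \<in> V. holds_at U [x] (\<phi>, b)}" unfolding acl_def by auto
  have "dfn C (UNIV :: unit set) (\<lambda>e. holds_at U (map (\<lambda>i. e ()) [0..<1]) (\<phi>, b))"
    using dfn_reindex[OF dfn_holds_at[OF \<theta>(1) C], of "\<lambda>_. ()" UNIV] C by simp
  then show "a \<in> V \<and> (\<exists>P. dfn C (UNIV :: unit set) (\<lambda>e. P (e ())) \<and> P a \<and> finite {x \<in> V. P x})"
    using a \<theta>(2,3) by (intro conjI exI[of _ "\<lambda>x. holds_at U [x] (\<phi>, b)"]) simp_all
next
  assume "a \<in> V \<and> (\<exists>P. dfn C (UNIV :: unit set) (\<lambda>e. P (e ())) \<and> P a \<and> finite {x \<in> V. P x})"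
  then obtain P where a: "a \<in> V" and P: "dfn C (UNIV :: unit set) (\<lambda>e. P (e ()))" "P a"
    "finite {x \<in> V. P x}" by (elim conjE exE) (rule that)
  obtain \<theta> where \<theta>: "\<theta> \<in> fms_over L C 1" "\<And>x. x \<in> V \<Longrightarrow> P x \<longleftrightarrow> holds_at U [x] \<theta>"
    by (rule dfn_unit_holds_at[OF P(1) C]) (rule that)
  have "{x \<in> V. holds_at U [x] \<theta>} = {x \<in> V. P x}" using \<theta>(2) by auto
  then show "a \<in> acl L U C" unfolding acl_def using a P(2,3) \<theta> by auto
qed

lemma acl_subset_V: "acl L U C \<subseteq> V"
  by (auto simp: acl_def)

lemma subset_acl:
  assumes C: "C \<subseteq> V" shows "C \<subseteq> acl L U C"
proof
  fix c assume c: "c \<in> C"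
  have "dfn C (UNIV :: unit set) (\<lambda>e. e () = c)" by (rule dfn_eq_param[OF _ c]) simp
  then show "c \<in> acl L U C" unfolding acl_iff[OF C] using c C
    by (intro conjI exI[of _ "\<lambda>x. x = c"]) (auto intro: finite_subset[of _ "{c}"])
qed

text \<open>Boundedness by \<open>k\<close> is the absence of \<open>k + 1\<close> distinct
  solutions, which a formula can express with \<open>y\<close> as variables. \<open>acl_idem\<close>
  needs such a bound for varying parameters.\<close>

lemma dfn_at_most:
  assumes Q: "dfn {} ((UNIV :: unit set) <+> F) Q"
  obtains Z where "dfn {} F Z" and
    "\<And>y. y ` F \<subseteq> V \<Longrightarrow> Z y \<longleftrightarrow> finite {x \<in> V. Q (case_sum (\<lambda>_. x) y)} \<and> card {x \<in> V. Q (case_sum (\<lambda>_. x) y)} \<le> k"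
proof -
  let ?X = "\<lambda>y. {x \<in> V. Q (case_sum (\<lambda>_. x) y)}"
  let ?K = "{..<Suc k}"
  let ?R = "\<lambda>e. (\<forall>i\<in>?K. \<forall>j\<in>?K. i \<noteq> j \<longrightarrow> e (Inr i) \<noteq> e (Inr j)) \<and>
    (\<forall>i\<in>?K. Q (case_sum (\<lambda>_. e (Inr i)) (\<lambda>c. e (Inl c))))"
  have "dfn {} (F <+> ?K) (\<lambda>e. Q (case_sum (\<lambda>_. e (Inr i)) (\<lambda>c. e (Inl c))))" if "i \<in> ?K" for i
  proof -
    have eq: "(\<lambda>k. e (case_sum (\<lambda>_. Inr i) Inl k)) = case_sum (\<lambda>_. e (Inr i)) (\<lambda>c. e (Inl c))"
      for e :: "'b + nat \<Rightarrow> 'a" by (auto split: sum.split)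
    have "case_sum (\<lambda>_. Inr i) Inl ` ((UNIV :: unit set) <+> F) \<subseteq> F <+> ?K" using that by auto
    from dfn_reindex[OF Q this] show ?thesis unfolding eq by simp
  qed
  moreover have "dfn {} (F <+> ?K) (\<lambda>e. i \<noteq> j \<longrightarrow> e (Inr i) \<noteq> e (Inr j))" if "i \<in> ?K" "j \<in> ?K" for i j
    using that by (intro dfn_imp dfn_const dfn_not dfn_eq) auto
  ultimately have "dfn {} (F <+> ?K) ?R" by (intro dfn_conj dfn_ball) auto
  have inj: "(\<forall>i\<in>?K. \<forall>j\<in>?K. i \<noteq> j \<longrightarrow> z i \<noteq> z j) \<longleftrightarrow> inj_on z ?K" for z :: "nat \<Rightarrow> 'a"
    by (auto simp: inj_on_def)
  from dfn_not[OF dfn_ex_family[OF \<open>dfn {} (F <+> ?K) ?R\<close> empty_subsetI]]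
  have Z: "dfn {} F (\<lambda>y. \<not> (\<exists>z. z ` ?K \<subseteq> V \<and> inj_on z ?K \<and> (\<forall>i\<in>?K. Q (case_sum (\<lambda>_. z i) y))))"
    by (simp only: sum.case inj)
  show ?thesis
  proof (rule that[OF Z])
    fix y assume "y ` F \<subseteq> V"
    have "(\<exists>z. z ` ?K \<subseteq> V \<and> inj_on z ?K \<and> (\<forall>i\<in>?K. Q (case_sum (\<lambda>_. z i) y))) \<longleftrightarrow>
        (\<exists>z. inj_on z ?K \<and> z ` ?K \<subseteq> ?X y)" by blast
    also have "\<dots> \<longleftrightarrow> \<not> (finite (?X y) \<and> card (?X y) \<le> k)"
    proof
      assume "\<exists>z. inj_on z ?K \<and> z ` ?K \<subseteq> ?X y"
      then obtain z where z: "inj_on z ?K" "z ` ?K \<subseteq> ?X y" by blast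
      then show "\<not> (finite (?X y) \<and> card (?X y) \<le> k)"
        using card_inj_on_le[OF z] by auto
    next
      assume *: "\<not> (finite (?X y) \<and> card (?X y) \<le> k)"
      obtain Y where Y: "Y \<subseteq> ?X y" "finite Y" "card Y = Suc k"
      proof (cases "finite (?X y)")
        case True
        then have "Suc k \<le> card (?X y)" using * by simp
        from obtain_subset_with_card_n[OF this] True that finite_subset show ?thesis by metis
      next
        case False
        from infinite_arbitrarily_large[OF this, of "Suc k"] that show ?thesis by blast
      qed
      then obtain z where "bij_betw z {0..<Suc k} Y" using ex_bij_betw_nat_finite by metis
      then show "\<exists>z. inj_on z ?K \<and> z ` ?K \<subseteq> ?X y"
        using Y(1) by (intro exI[of _ z]) (auto simp: bij_betw_def atLeast0LessThan)
    qed
    finally show "\<not> (\<exists>z. z ` ?K \<subseteq> V \<and> inj_on z ?K \<and> (\<forall>i\<in>?K. Q (case_sum (\<lambda>_. z i) y))) \<longleftrightarrow>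
        finite (?X y) \<and> card (?X y) \<le> k" by blast
  qed
qed

text \<open>The parameters from the algebraic closure are replaced by a tuple \<open>y\<close> of
  solutions of their algebraic formulas over \<open>C\<close>. Only finitely many \<open>y\<close>
  qualify, and the conjunct \<open>Z\<close> keeps the set of solutions finite for each of
  them.\<close>

lemma acl_idem:
  assumes C: "C \<subseteq> V" shows "acl L U (acl L U C) = acl L U C"
proof
  show "acl L U C \<subseteq> acl L U (acl L U C)" by (rule subset_acl[OF acl_subset_V])
  show "acl L U (acl L U C) \<subseteq> acl L U C"
  proof
    fix a assume "a \<in> acl L U (acl L U C)"
    then obtain P where a: "a \<in> V" and P: "dfn (acl L U C) (UNIV :: unit set) (\<lambda>e. P (e ()))" "P a"
      "finite {x \<in> V. P x}" unfolding acl_iff[OF acl_subset_V] by (elim conjE exE) (rule that)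
    have aV: "acl L U C \<subseteq> V" by (rule acl_subset_V)
    from P(1) have "dfn ({} \<union> acl L U C) (UNIV :: unit set) (\<lambda>e. P (e ()))" by simp
    then obtain Q0 where Q0: "dfn {} ((UNIV :: unit set) <+> acl L U C) Q0"
      "\<And>e. e ` (UNIV :: unit set) \<subseteq> V \<Longrightarrow> P (e ()) \<longleftrightarrow> Q0 (case_sum e id)"
      by (rule dfn_abstract) (rule that)
    from Q0(1) obtain F0 Q where F0: "finite F0" "F0 \<subseteq> (UNIV :: unit set) <+> acl L U C" "dfn {} F0 Q"
      "\<And>e. e ` ((UNIV :: unit set) <+> acl L U C) \<subseteq> V \<Longrightarrow> Q0 e \<longleftrightarrow> Q e" by (rule dfn_support) (rule that)
    define F where "F = Inr -` F0"
    have F: "finite F" "F \<subseteq> acl L U C" using F0(1,2) by (auto simp: F_def intro: finite_vimageI)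
    have FV: "F \<subseteq> V" using F(2) aV by blast
    have "F0 \<subseteq> (UNIV :: unit set) <+> F"
    proof
      fix i assume i: "i \<in> F0"
      then show "i \<in> (UNIV :: unit set) <+> F" by (cases i) (auto simp: F_def)
    qed
    from dfn_mono[OF F0(3) subset_refl this] have Q: "dfn {} ((UNIV :: unit set) <+> F) Q" .
    have PQ: "P x \<longleftrightarrow> Q (case_sum (\<lambda>_. x) id)" if "x \<in> V" for x
      using Q0(2)[of "\<lambda>_. x"] F0(4)[of "case_sum (\<lambda>_. x) id"] that aV by auto
    have "\<forall>c\<in>F. \<exists>R. dfn C (UNIV :: unit set) (\<lambda>e. R (e ())) \<and> R c \<and> finite {x \<in> V. R x}"
      using F(2) unfolding acl_iff[OF C] subset_iff by blast
    from bchoice[OF this] obtain R where R: "\<And>c. c \<in> F \<Longrightarrow> dfn C (UNIV :: unit set) (\<lambda>e. R c (e ()))"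
      "\<And>c. c \<in> F \<Longrightarrow> R c c" "\<And>c. c \<in> F \<Longrightarrow> finite {x \<in> V. R c x}" by blast
    let ?X = "\<lambda>y. {x \<in> V. Q (case_sum (\<lambda>_. x) y)}"
    let ?k = "card (?X id)"
    from dfn_at_most[OF Q, of ?k] obtain Z where Z: "dfn {} F Z"
      "\<And>y. y ` F \<subseteq> V \<Longrightarrow> Z y \<longleftrightarrow> finite (?X y) \<and> card (?X y) \<le> ?k" by blast
    have Xid: "finite (?X id)" using P(3) PQ by (simp cong: conj_cong)
    let ?S = "\<lambda>e. (\<forall>c\<in>F. R c (e (Inr c))) \<and> Z (\<lambda>c. e (Inr c)) \<and> Q e"
    have "dfn C ((UNIV :: unit set) <+> F) ?S"
    proof (intro dfn_conj dfn_ball F(1))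
      show "dfn C ((UNIV :: unit set) <+> F) Q" by (rule dfn_mono[OF Q]) auto
      show "dfn C ((UNIV :: unit set) <+> F) (\<lambda>e. Z (\<lambda>c. e (Inr c)))"
        by (rule dfn_mono[OF dfn_reindex[OF Z(1), of Inr "(UNIV :: unit set) <+> F"]]) auto
      show "dfn C ((UNIV :: unit set) <+> F) (\<lambda>e. R c (e (Inr c)))" if "c \<in> F" for c
        using dfn_reindex[OF R(1)[OF that], of "\<lambda>_. Inr c" "(UNIV :: unit set) <+> F"] that C by auto
    qed
    from dfn_ex_family[OF this C]
    have T: "dfn C (UNIV :: unit set) (\<lambda>e. \<exists>y. y ` F \<subseteq> V \<and> ?S (case_sum e y))" .
    let ?P = "\<lambda>x. \<exists>y. y ` F \<subseteq> V \<and> ?S (case_sum (\<lambda>_. x) y)"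
    have unit: "(\<lambda>_. e ()) = e" for e :: "unit \<Rightarrow> 'a" by auto
    have "dfn C (UNIV :: unit set) (\<lambda>e. ?P (e ()))" using T unfolding unit .
    moreover have "?P a"
      using R(2) Z(2)[of id] Xid FV PQ[OF a] P(2) by (intro exI[of _ id]) (auto simp: id_def)
    moreover have "finite {x \<in> V. ?P x}"
    proof -
      \<comment> \<open>Families are cut down to \<open>F\<close>, since their arbitrary values off
        \<open>F\<close> could make them infinitely many.\<close>
      let ?Y = "{y \<in> Pi\<^sub>E F (\<lambda>c. {x \<in> V. R c x}). Z y}"
      have "finite (Pi\<^sub>E F (\<lambda>c. {x \<in> V. R c x}))" by (rule finite_PiE[OF F(1) R(3)])
      then have fin: "finite ?Y" by simp
      have YV: "y ` F \<subseteq> V" if "y \<in> ?Y" for y using that by (auto simp: PiE_iff)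
      have "finite (\<Union>y\<in>?Y. ?X y)"
        using Z(2) YV by (intro finite_UN_I[OF fin]) blast
      moreover have "{x \<in> V. ?P x} \<subseteq> (\<Union>y\<in>?Y. ?X y)"
      proof
        fix x assume "x \<in> {x \<in> V. ?P x}"
        then obtain y where x: "x \<in> V" and y: "y ` F \<subseteq> V" "\<forall>c\<in>F. R c (y c)" "Z y"
          "Q (case_sum (\<lambda>_. x) y)" by auto
        let ?y = "restrict y F"
        have "Z y \<longleftrightarrow> Z ?y" by (rule dfn_same[OF Z(1) _ y(1)]) simp
        moreover have "Q (case_sum (\<lambda>_. x) y) \<longleftrightarrow> Q (case_sum (\<lambda>_. x) ?y)"
          by (rule dfn_same[OF Q]) (use x y(1) in \<open>auto split: sum.splits\<close>)
        ultimately have "?y \<in> ?Y" "x \<in> ?X ?y" using x y by (auto simp: PiE_iff)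
        then show "x \<in> (\<Union>y\<in>?Y. ?X y)" by blast
      qed
      ultimately show ?thesis by (rule finite_subset[rotated])
    qed
    ultimately show "a \<in> acl L U C"
      unfolding acl_iff[OF C] using a by (intro conjI exI[of _ ?P])
  qed
qed

section \<open>Types of sets and dividing in terms of elementary maps\<close>

lemma equiv_over_iff:
  assumes "A \<subseteq> V" and "A' \<subseteq> V" and "C \<subseteq> V"
  shows "equiv_over L U C A A' \<longleftrightarrow> (\<exists>f. emap_over C A f \<and> f ` A = A')"
proof
  assume "equiv_over L U C A A'"
  then obtain I :: "'a set" and a a' where a: "a ` I = A" "a' ` I = A'" "same_type L U C I a a'"
    unfolding equiv_over_def by blast
  have "a ` I \<subseteq> V" "a' ` I \<subseteq> V" using a assms by auto
  from same_type_emap[OF a(3) this assms(3)] obtain f where f: "emap (C \<union> a ` I) f"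
    "\<And>c. c \<in> C \<Longrightarrow> f c = c" "\<And>i. i \<in> I \<Longrightarrow> f (a i) = a' i" by blast
  have "emap_over C A f" using f(1,2) a(1) by (simp add: emap_over_def)
  moreover have "f ` A = A'" using f(3) unfolding a(1,2)[symmetric] by force
  ultimately show "\<exists>f. emap_over C A f \<and> f ` A = A'" by blast
next
  assume "\<exists>f. emap_over C A f \<and> f ` A = A'"
  then obtain f where f: "emap_over C A f" "f ` A = A'" by blast
  have "same_type L U C A id (\<lambda>x. f (id x))"
    by (rule emap_same_type[OF emap_overD(1,2)[OF f(1)]]) auto
  then show "equiv_over L U C A A'"
    unfolding equiv_over_def using f(2) by (intro exI[of _ A] exI[of _ id] exI[of _ f]) auto
qed

lemma emap_equiv3:
  assumes f: "emap X f" and "A \<union> B \<union> C \<subseteq> X"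
  shows "equiv3 L U A B C (f ` A) (f ` B) (f ` C)"
proof -
  let ?i = "case_sum id (case_sum id id) :: 'a + 'a + 'a \<Rightarrow> 'a"
  have eq: "(\<lambda>i. f (?i i)) = case_sum f (case_sum f f)" by (auto split: sum.split)
  have "same_type L U {} (A <+> B <+> C) ?i (\<lambda>i. f (?i i))"
    by (rule emap_same_type[OF f]) (use assms(2) in auto)
  then show ?thesis unfolding equiv3_def eq
    by (intro exI[of _ A] exI[of _ B] exI[of _ C] exI[of _ id] exI[of _ f]) simp
qed

text \<open>A formula that divides also forks, being covered by itself. So for each \<open>k\<close>
  there are \<open>k\<close> of the copies \<open>h n\<close> at which the instances have a common
  solution; which ones is not under control.\<close>

lemma nf_indep_nondividing:
  assumes nf: "nf_indep L U A C B" and CB: "C \<subseteq> B" and V: "A \<subseteq> V" "B \<subseteq> V"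
    and W: "dfn {} (A <+> B) W" "W (case_sum id id)" and h: "\<And>n::nat. emap_over C B (h n)"
  shows "\<exists>S. finite S \<and> card S = k \<and> (\<exists>x. x ` A \<subseteq> V \<and> (\<forall>n\<in>S. W (case_sum x (h n))))"
proof -
  from W(1) obtain ms js \<phi> where \<phi>: "set ms \<subseteq> A" "set js \<subseteq> B" "distinct ms" "wf_fm L \<phi>"
    "fv \<phi> \<subseteq> {..<length ms + length js}"
    "\<And>a b. a ` A \<subseteq> V \<Longrightarrow> b ` B \<subseteq> V \<Longrightarrow>
      W (case_sum a b) \<longleftrightarrow> sat U ((!) (map a ms @ map b js)) \<phi>" by (rule dfn_lists) (rule that)
  have "holds_at U ms (\<phi>, js)" using \<phi>(6)[of id id] W(2) V by (simp add: holds_at_def)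
  then have "(\<phi>, js) \<in> tp L U B ms" using \<phi> by (auto simp: tp_def fms_over_def)
  moreover have "ms \<in> lists A" using \<phi>(1) by auto
  ultimately have "\<not> forks L U C (length ms) (\<phi>, js)" using nf unfolding nf_indep_def by blast
  moreover have "(\<phi>, js) \<in> fms_over L V (length ms)" using \<phi> V(2) by (auto simp: fms_over_def)
  ultimately have nd: "\<not> divides L U C (length ms) (\<phi>, js)"
    unfolding forks_def by (auto dest!: spec[of _ "{(\<phi>, js)}"])
  let ?bs = "\<lambda>n. map (h n) js"
  have hV: "h n ` B \<subseteq> V" for n using emap_overD(5)[OF h] .
  have "?bs n \<in> tuples V (length js)" for n
    using \<phi>(2) hV[of n] by (auto simp: tuples_def in_lists_conv_set)
  moreover have st: "same_type L U C {..<length js} ((!) js) ((!) (?bs n))" for n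
  proof (rule same_typeI)
    fix P assume P: "dfn C {..<length js} P" "P ((!) js)"
    have js: "js ! i \<in> B" if "i < length js" for i using \<phi>(2) nth_mem[OF that] by blast
    have "(!) js ` {..<length js} \<subseteq> C \<union> B" using js by blast
    from emap_over_dfn[OF h P(1) this] have "P (\<lambda>i. h n (js ! i))" using P(2) by simp
    moreover have "P (\<lambda>i. h n (js ! i)) \<longleftrightarrow> P ((!) (?bs n))"
      by (rule dfn_same[OF P(1)]) (use js hV[of n] in auto)
    ultimately show "P ((!) (?bs n))" by simp
  qed
  ultimately have bs: "\<forall>n. ?bs n \<in> tuples V (length js) \<and>
      same_type L U C {..<length js} ((!) js) ((!) (?bs n))" by blast
  have "\<not> (\<forall>S. finite S \<and> card S = k \<longrightarrow>
      \<not> (\<exists>x\<in>tuples V (length ms). \<forall>i\<in>S. holds_at U x (\<phi>, ?bs i)))"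
  proof
    assume "\<forall>S. finite S \<and> card S = k \<longrightarrow>
      \<not> (\<exists>x\<in>tuples V (length ms). \<forall>i\<in>S. holds_at U x (\<phi>, ?bs i))"
    with bs have "divides L U C (length ms) (\<phi>, js)"
      unfolding divides_def prod.case by (intro exI[of _ k] exI[of _ ?bs] conjI)
    with nd show False by blast
  qed
  then obtain S x where S: "finite S" "card S = k" and x: "x \<in> tuples V (length ms)"
    "\<And>n. n \<in> S \<Longrightarrow> holds_at U x (\<phi>, ?bs n)" by blast
  obtain z where z: "z \<in> V" using univ_nonempty by auto
  \<comment> \<open>Reads the tuple \<open>x\<close> as a family on \<open>A\<close>, with the
    default \<open>z\<close> off the finitely many indices in \<open>ms\<close>.\<close>
  define y where "y = (\<lambda>m. if m \<in> set ms then x ! (THE i. i < length ms \<and> ms ! i = m) else z)"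
  have len: "length x = length ms" using x(1) by (simp add: tuples_def)
  have y: "y (ms ! i) = x ! i" if "i < length ms" for i
  proof -
    have "(THE j. j < length ms \<and> ms ! j = ms ! i) = i"
      using that \<phi>(3) by (intro the_equality) (auto simp: nth_eq_iff_index_eq)
    then show ?thesis using that by (simp add: y_def)
  qed
  have map: "map y ms = x" using y len by (intro nth_equalityI) auto
  have "y ` set ms = set x" using map by (metis set_map)
  moreover have "set x \<subseteq> V" using x(1) by (auto simp: tuples_def in_lists_conv_set)
  ultimately have "y m \<in> V" for m using z by (cases "m \<in> set ms") (auto simp: y_def)
  then have yV: "y ` A \<subseteq> V" by blast
  have "W (case_sum y (h n))" if "n \<in> S" for n
    using \<phi>(6)[OF yV hV] x(2)[OF that] map by (simp add: holds_at_def)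
  then show ?thesis using S yV by blast
qed

end

context monster
begin

lemma small_acl:
  assumes "small U \<kappa> C" shows "small U \<kappa> (acl L U C)"
proof -
  let ?r = "|C <+> {\<phi>. wf_fm L \<phi>}|"
  have "infinite (C <+> {\<phi>. wf_fm L \<phi>})" using infinite_wf_fms[of L] by (simp add: finite_Plus_iff)
  then have r: "Cinfinite ?r" by (simp add: cinfinite_def Field_card_of card_of_card_order_on)
  have "|lists C| \<le>o ?r" by (rule card_lists_bound[OF r card_of_Plus1])
  then have "|{\<phi>. wf_fm L \<phi>} \<times> lists C| \<le>o ?r"
    using r card_of_Plus2 card_of_Times_ordLeq_infinite_Field unfolding cinfinite_def by blast
  moreover have "fms_over L C 1 \<subseteq> {\<phi>. wf_fm L \<phi>} \<times> lists C" by (auto simp: fms_over_def)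
  ultimately have "|fms_over L C 1| \<le>o ?r" using card_of_mono1 ordLeq_transitive by blast
  moreover let ?X = "\<lambda>\<theta>. if finite {x \<in> V. holds_at U [x] \<theta>} then {x \<in> V. holds_at U [x] \<theta>} else {}"
  have "|?X \<theta>| \<le>o ?r" for \<theta> by (rule ordLess_imp_ordLeq[OF finite_bound[OF r]]) simp
  ultimately have "|\<Union>\<theta>\<in>fms_over L C 1. ?X \<theta>| \<le>o ?r" by (intro UNION_Cinfinite_bound r) auto
  moreover have "acl L U C \<subseteq> (\<Union>\<theta>\<in>fms_over L C 1. ?X \<theta>)" unfolding acl_def by fastforce
  ultimately have "|acl L U C| \<le>o ?r" using card_of_mono1 ordLeq_transitive by blast
  moreover have "?r <o \<kappa>" using card_less_Plus[OF small_card[OF assms] card_fms] .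
  ultimately show ?thesis using ordLeq_ordLess_trans acl_subset_V unfolding small_def by blast
qed

end

locale weak_independence = stable_monster L U \<kappa>
  for L :: "('f, 'r) lang" and U :: "('f, 'r, 'a) struct" and \<kappa> :: "'k rel" +
  fixes ind :: "'a set \<Rightarrow> 'a set \<Rightarrow> 'a set \<Rightarrow> bool"
  assumes weak_notion: "weak_notion_of_independence L U \<kappa> ind"
    and stationarity: "stationarity_over_models L U \<kappa> ind"
begin

lemma nf_indep_imp_ind:
  assumes "small U \<kappa> A" "small U \<kappa> B" "elem_sub L U M" "M \<subseteq> B" "nf_indep L U A M B"
  shows "ind (M \<union> A) M B"
  using weak_notion assms unfolding weak_notion_of_independence_def by blast

lemma ind_emap:
  assumes f: "emap X f" "A \<union> B \<subseteq> X" and C: "C \<subseteq> A" "C \<subseteq> B"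
    and s: "small U \<kappa> A" "small U \<kappa> B" and i: "ind A C B"
  shows "ind (f ` A) (f ` C) (f ` B)"
proof -
  have sC: "small U \<kappa> C" using small_subset[OF s(1) C(1)] .
  have fV: "f ` X \<subseteq> V" using emapD(2)[OF f(1)] .
  have "small U \<kappa> (f ` Y)" if "small U \<kappa> Y" "Y \<subseteq> X" for Y
    using small_image[OF small_card[OF that(1)]] that(2) fV by blast
  then have "small U \<kappa> (f ` A)" "small U \<kappa> (f ` B)" "small U \<kappa> (f ` C)"
    using s sC f(2) C by blast+
  moreover have "equiv3 L U A B C (f ` A) (f ` B) (f ` C)"
    using emap_equiv3[OF f(1)] f(2) C by blast
  moreover have "invariance L U \<kappa> ind" using weak_notion by (simp add: weak_notion_of_independence_def)
  ultimately show ?thesis using s sC C i unfolding invariance_def by blast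
qed

lemma ind_def_indep:
  assumes M: "elem_sub L U M" and A: "small U \<kappa> A" and D: "small U \<kappa> D" and MD: "M \<subseteq> D"
    and i: "ind (M \<union> A) M D"
  shows "def_indep A M D"
proof -
  have V: "A \<subseteq> V" "D \<subseteq> V" "M \<subseteq> V" using A D MD small_V by auto
  obtain g where g: "emap_over M A g" "def_indep (g ` A) M D"
    by (rule def_indep_extension[OF M A D MD]) (rule that)
  have gV: "g ` A \<subseteq> V" using emap_overD(5)[OF g(1)] .
  have gA: "small U \<kappa> (g ` A)" using small_image[OF small_card[OF A] gV] .
  have "ind (M \<union> g ` A) M D"
    using nf_indep_imp_ind[OF gA D M MD def_indep_nf_indep[OF M gA D MD g(2)]] .
  moreover have "equiv_over L U M A (g ` A)" using equiv_over_iff[OF V(1) gV V(3)] g(1) by blast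
  ultimately have "equiv_over L U D A (g ` A)"
    using stationarity A gA D M MD i unfolding stationarity_over_models_def by blast
  \<comment> \<open>Types of sets are compared in some enumeration, so \<open>f\<close> need not
    agree with \<open>g\<close>. Only the image matters, since \<open>def_indep\<close> speaks of
    sets.\<close>
  then obtain f where f: "emap_over D A f" "f ` A = g ` A"
    using equiv_over_iff[OF V(1) gV V(2)] by blast
  obtain k where k: "emap_over D (f ` A) k" "\<And>x. x \<in> A \<Longrightarrow> k (f x) = x"
    by (rule emap_over_inv[OF f(1)]) (rule that)
  have "k ` g ` A = A" unfolding f(2)[symmetric] using k(2) by force
  then show ?thesis using def_indep_emap[OF g(2), of k] k(1) f(2) MD by simp
qed

lemma nf_indep_iff_ind_over_models:
  assumes "small U \<kappa> A" "small U \<kappa> B" "elem_sub L U M" "M \<subseteq> B"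
  shows "nf_indep L U A M B \<longleftrightarrow> ind (M \<union> A) M B"
  using nf_indep_imp_ind def_indep_nf_indep ind_def_indep assms by blast

end

subsection \<open>Dividing over models and symmetry\<close>

context first_order_structure
begin

lemma same_type_image:
  assumes g: "emap X g" and N: "N \<subseteq> X" and a: "a ` I \<subseteq> X" "a' ` I \<subseteq> X"
    and st: "same_type L U N I a a'"
  shows "same_type L U (g ` N) I (\<lambda>i. g (a i)) (\<lambda>i. g (a' i))"
  unfolding same_type_def
proof (intro allI impI)
  fix \<phi> s assume \<phi>: "wf_fm L \<phi> \<and> s ` fv \<phi> \<subseteq> I <+> g ` N"
  let ?s = "\<lambda>v. case s v of Inl i \<Rightarrow> Inl i | Inr c \<Rightarrow> Inr (inv_into N g c)"
  have inv: "inv_into N g c \<in> N" "g (inv_into N g c) = c" if "c \<in> g ` N" for c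
    using that by (auto intro: inv_into_into f_inv_into_f)
  have s: "?s ` fv \<phi> \<subseteq> I <+> N"
    using \<phi> inv(1) by (auto simp: sum_image_subset_Plus split: sum.splits)
  have *: "sat U (\<lambda>v. case_sum b id (?s v)) \<phi> \<longleftrightarrow> sat U (\<lambda>v. case_sum (\<lambda>i. g (b i)) id (s v)) \<phi>"
    if b: "b ` I \<subseteq> X" for b
  proof -
    have "(\<lambda>v. case_sum b id (?s v)) ` fv \<phi> \<subseteq> X" using case_sum_in[OF _ b N] s by blast
    from emapD(3)[OF g _ this] \<phi>
    have "sat U (\<lambda>v. case_sum b id (?s v)) \<phi> \<longleftrightarrow> sat U (\<lambda>v. g (case_sum b id (?s v))) \<phi>" by blast
    also have "\<dots> \<longleftrightarrow> sat U (\<lambda>v. case_sum (\<lambda>i. g (b i)) id (s v)) \<phi>"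
      using \<phi> inv(2) by (intro sat_cong) (auto simp: sum_image_subset_Plus split: sum.split)
    finally show ?thesis .
  qed
  show "sat U (\<lambda>v. case_sum (\<lambda>i. g (a i)) id (s v)) \<phi> \<longleftrightarrow>
      sat U (\<lambda>v. case_sum (\<lambda>i. g (a' i)) id (s v)) \<phi>"
    using st \<phi> s unfolding *[OF a(1), symmetric] *[OF a(2), symmetric] same_type_def by blast
qed

end

context monster
begin

text \<open>A witnessing sequence can be chosen with all its members of the same type over some model
  containing \<open>C\<close>: this is compactness and the pigeonhole principle, applied to the sequence over an
  arbitrary model, which is then moved by an elementary map.\<close>

lemma divides_over_model:
  assumes C: "small U \<kappa> C" and div: "divides L U C n (\<phi>, c)" and \<theta>: "(\<phi>, c) \<in> fms_over L V n"
  obtains N where "elem_sub L U N" and "C \<subseteq> N" and "small U \<kappa> N" and "divides L U N n (\<phi>, c)"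
proof -
  let ?l = "length c" and ?I = "(UNIV :: nat set) \<times> {..<length c}"
  have \<phi>: "wf_fm L \<phi>" "fv \<phi> \<subseteq> {..<n + ?l}" "set c \<subseteq> V" using \<theta> by (auto simp: fms_over_def)
  from div obtain k and bs :: "nat \<Rightarrow> 'a list" where
    bs0: "\<forall>i. bs i \<in> tuples V ?l \<and> same_type L U C {..<?l} ((!) c) ((!) (bs i))"
    and k: "\<forall>S. finite S \<and> card S = k \<longrightarrow> \<not> (\<exists>x\<in>tuples V n. \<forall>i\<in>S. holds_at U x (\<phi>, bs i))"
    unfolding divides_def prod.case by (elim exE conjE) (rule that)
  have bs: "length (bs i) = ?l" "set (bs i) \<subseteq> V" "same_type L U C {..<?l} ((!) c) ((!) (bs i))" for i
    using bs0 by (auto simp: tuples_def in_lists_conv_set)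
  have bsV: "(!) (bs i) ` {..<?l} \<subseteq> V" for i
    using bs(2)[of i] nth_mem[of _ "bs i"] bs(1)[of i] by auto
  have cV: "(!) c ` {..<?l} \<subseteq> V" using \<phi>(3) nth_mem[of _ c] by auto
  obtain N0 where N0: "elem_sub L U N0" "C \<subseteq> N0" "small U \<kappa> N0" by (rule small_model[OF C]) (rule that)
  have N0V: "N0 \<subseteq> V" using N0(3) by (rule small_V)
  let ?W = "\<lambda>e. sat U ((!) (map (\<lambda>i. e (Inl i)) [0..<n] @ map (\<lambda>j. e (Inr j)) [0..<?l])) \<phi>"
  have W: "dfn {} ({..<n} <+> {..<?l}) ?W" by (rule dfn_sat_lists[OF \<phi>(1,2)])
  \<comment> \<open>\<open>K S\<close> says that the instances at the rows of \<open>y\<close> with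
    index in \<open>S\<close> have a common solution. Its negations express
    \<open>k\<close>-inconsistency by formulas without parameters.\<close>
  define K where "K = (\<lambda>S (y :: nat \<times> nat \<Rightarrow> 'a). \<exists>x. x ` {..<n} \<subseteq> V \<and>
    (\<forall>j\<in>S. ?W (case_sum x (\<lambda>i. y (j, i)))))"
  have K: "dfn {} ?I (K S)" if S: "finite S" for S
  proof -
    have "dfn {} (?I <+> {..<n}) (\<lambda>e. \<forall>j\<in>S. ?W (case_sum (\<lambda>i. e (Inr i)) (\<lambda>i. e (Inl (j, i)))))"
    proof (intro dfn_ball S)
      fix j
      have eq: "(\<lambda>k. e (case_sum Inr (\<lambda>i. Inl (j, i)) k)) = case_sum (\<lambda>i. e (Inr i)) (\<lambda>i. e (Inl (j, i)))"
        for e :: "(nat \<times> nat) + nat \<Rightarrow> 'a" by (auto split: sum.split)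
      have "case_sum Inr (\<lambda>i. Inl (j, i)) ` ({..<n} <+> {..<?l}) \<subseteq> ?I <+> {..<n}" by auto
      from dfn_reindex[OF W this] show "dfn {} (?I <+> {..<n})
          (\<lambda>e. ?W (case_sum (\<lambda>i. e (Inr i)) (\<lambda>i. e (Inl (j, i)))))"
        unfolding eq by simp
    qed
    from dfn_ex_family[OF this empty_subsetI] show ?thesis unfolding K_def by (simp only: sum.case)
  qed
  have WH: "?W (case_sum x u) \<longleftrightarrow> holds_at U (map x [0..<n]) (\<phi>, map u [0..<?l])" for x u
    by (simp add: holds_at_def)
  have row: "dfn D ?I (\<lambda>y. P (\<lambda>i. y (j, i)))" if "dfn D {..<?l} P" "D \<subseteq> V" for D P j
    by (rule dfn_reindex[OF that(1) _ that(2)]) auto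
  \<comment> \<open>A sequence of rows is sought that have the type of \<open>c\<close> over
    \<open>C\<close> (\<open>\<Sigma>1\<close>), are \<open>k\<close>-inconsistent
    (\<open>\<Sigma>2\<close>) and share one type over \<open>N0\<close>
    (\<open>\<Sigma>3\<close>).\<close>
  define \<Sigma>1 where "\<Sigma>1 = (\<lambda>(j, P) (y :: nat \<times> nat \<Rightarrow> 'a). P (\<lambda>i. y (j, i))) `
    {(j, P). dfn C {..<?l} P \<and> P ((!) c)}"
  define \<Sigma>2 where "\<Sigma>2 = (\<lambda>S y. \<not> K S y) ` {S. finite S \<and> card S = k}"
  define \<Sigma>3 where "\<Sigma>3 = (\<lambda>(j, j', P) (y :: nat \<times> nat \<Rightarrow> 'a). P (\<lambda>i. y (j, i)) \<longleftrightarrow> P (\<lambda>i. y (j', i))) `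
    {(j, j', P). dfn N0 {..<?l} P}"
  have D: "dfn N0 ?I P" if P: "P \<in> \<Sigma>1 \<union> \<Sigma>2 \<union> \<Sigma>3" for P
    using P
  proof (elim UnE)
    assume "P \<in> \<Sigma>1"
    then obtain j R where R: "dfn C {..<?l} R" "P = (\<lambda>y. R (\<lambda>i. y (j, i)))" by (auto simp: \<Sigma>1_def)
    show ?thesis unfolding R(2) by (rule row[OF dfn_mono[OF R(1) N0(2) subset_refl] N0V])
  next
    assume "P \<in> \<Sigma>2"
    then obtain S where S: "finite S" "P = (\<lambda>y. \<not> K S y)" by (auto simp: \<Sigma>2_def)
    show ?thesis unfolding S(2) by (rule dfn_not[OF dfn_mono[OF K[OF S(1)]]]) auto
  next
    assume "P \<in> \<Sigma>3"
    then obtain j j' R where R: "dfn N0 {..<?l} R"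
      "P = (\<lambda>y. R (\<lambda>i. y (j, i)) \<longleftrightarrow> R (\<lambda>i. y (j', i)))" by (auto simp: \<Sigma>3_def)
    show ?thesis unfolding R(2) by (intro dfn_iff row[OF R(1) N0V])
  qed
  have fin: "\<exists>y. y ` ?I \<subseteq> V \<and> (\<forall>P\<in>\<Sigma>0. P y)" if \<Sigma>0: "finite \<Sigma>0" "\<Sigma>0 \<subseteq> \<Sigma>1 \<union> \<Sigma>2 \<union> \<Sigma>3" for \<Sigma>0
  proof -
    have "finite (\<Sigma>0 \<inter> \<Sigma>3)" "\<Sigma>0 \<inter> \<Sigma>3 \<subseteq> \<Sigma>3" using \<Sigma>0(1) by auto
    from finite_subset_image[OF this[unfolded \<Sigma>3_def]] obtain T where
      T: "T \<subseteq> {(j, j', P). dfn N0 {..<?l} P}" "finite T"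
      "\<Sigma>0 \<inter> \<Sigma>3 = (\<lambda>(j, j', P) (y :: nat \<times> nat \<Rightarrow> 'a). P (\<lambda>i. y (j, i)) \<longleftrightarrow> P (\<lambda>i. y (j', i))) ` T"
      unfolding \<Sigma>3_def by blast
    \<comment> \<open>Only finitely many formulas over \<open>N0\<close> occur here. Infinitely many
      members of \<open>bs\<close> agree on all of them, and a subsequence is still
      \<open>k\<close>-inconsistent.\<close>
    let ?\<Pi> = "(\<lambda>(j, j', P). P) ` T"
    let ?c = "\<lambda>j. {P \<in> ?\<Pi>. P ((!) (bs j))}"
    have "finite (Pow ?\<Pi>)" using T(2) by simp
    then have "finite (range ?c)" by (rule finite_subset[rotated]) auto
    from pigeonhole_infinite[OF infinite_UNIV_nat this] obtain j0 where
      j0: "infinite {j. ?c j = ?c j0}" by auto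
    from infinite_enumerate[OF j0] obtain e :: "nat \<Rightarrow> nat" where
      e0: "strict_mono e" "\<forall>j. e j \<in> {j. ?c j = ?c j0}" by (elim exE conjE) (rule that)
    have e: "strict_mono e" "?c (e j) = ?c j0" for j
      using e0(1) e0(2)[THEN spec, of j] by (simp_all only: mem_Collect_eq)
    let ?y = "\<lambda>(j, i). bs (e j) ! i"
    have yV: "?y ` ?I \<subseteq> V" using bsV by auto
    have y: "(\<lambda>i. ?y (j, i)) = (!) (bs (e j))" for j by auto
    have "P ?y" if P: "P \<in> \<Sigma>0" for P
    proof -
      have "P \<in> \<Sigma>1 \<or> P \<in> \<Sigma>2 \<or> P \<in> \<Sigma>0 \<inter> \<Sigma>3" using P \<Sigma>0(2) by blast
      then show ?thesis
      proof (elim disjE)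
        assume "P \<in> \<Sigma>1"
        then obtain j R where R: "dfn C {..<?l} R" "R ((!) c)" "P = (\<lambda>y. R (\<lambda>i. y (j, i)))"
          by (auto simp: \<Sigma>1_def)
        have "R ((!) (bs (e j)))" using same_type_dfn[OF bs(3) R(1) cV bsV] R(2) by blast
        then show ?thesis unfolding R(3) y .
      next
        assume "P \<in> \<Sigma>2"
        then obtain S where S: "finite S" "card S = k" "P = (\<lambda>y. \<not> K S y)" by (auto simp: \<Sigma>2_def)
        have "inj_on e S" using e(1) strict_mono_imp_inj_on inj_on_subset by blast
        then have "card (e ` S) = k" "finite (e ` S)" using S card_image by auto
        then have no: "\<not> (\<exists>x\<in>tuples V n. \<forall>i\<in>e ` S. holds_at U x (\<phi>, bs i))" using k by blast
        have "\<not> K S ?y"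
        proof
          assume "K S ?y"
          then obtain x where x: "x ` {..<n} \<subseteq> V" "\<forall>j\<in>S. ?W (case_sum x (\<lambda>i. ?y (j, i)))"
            unfolding K_def by (elim exE conjE) (rule that)
          have m: "map ((!) (bs j)) [0..<?l] = bs j" for j using map_nth[of "bs j"] bs(1)[of j] by simp
          have "\<forall>j\<in>S. holds_at U (map x [0..<n]) (\<phi>, bs (e j))" using x(2) unfolding y WH m .
          moreover have "map x [0..<n] \<in> tuples V n"
            using x(1) by (auto simp: tuples_def in_lists_conv_set)
          ultimately show False using no by blast
        qed
        then show ?thesis unfolding S(3) .
      next
        assume "P \<in> \<Sigma>0 \<inter> \<Sigma>3"
        then have "P \<in> (\<lambda>(j, j', P) (y :: nat \<times> nat \<Rightarrow> 'a). P (\<lambda>i. y (j, i)) \<longleftrightarrow> P (\<lambda>i. y (j', i))) ` T"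
          unfolding T(3) .
        then obtain t where t: "t \<in> T"
          "P = (\<lambda>(j, j', P) (y :: nat \<times> nat \<Rightarrow> 'a). P (\<lambda>i. y (j, i)) \<longleftrightarrow> P (\<lambda>i. y (j', i))) t" by blast
        obtain j j' R where tR: "t = (j, j', R)" by (cases t)
        have "R \<in> ?\<Pi>" using t(1) tR by force
        moreover have "R \<in> ?c (e j) \<longleftrightarrow> R \<in> ?c (e j')" unfolding e(2) ..
        ultimately have "R ((!) (bs (e j))) \<longleftrightarrow> R ((!) (bs (e j')))"
          unfolding mem_Collect_eq by blast
        then show ?thesis unfolding t(2) tR prod.case y .
      qed
    qed
    then show ?thesis using yV by blast
  qed
  have "infinite (UNIV :: nat set)" by simp
  from card_of_Times_same_infinite[OF this]
  have "|(UNIV :: nat set) \<times> (UNIV :: nat set)| <o \<kappa>" using card_nat ordIso_ordLess_trans by blast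
  then have I: "|?I| <o \<kappa>" by (rule card_less_subset) auto
  have "\<exists>y. y ` ?I \<subseteq> V \<and> (\<forall>P\<in>\<Sigma>1 \<union> \<Sigma>2 \<union> \<Sigma>3. P y)" by (rule realize[OF N0(3) I D fin])
  then obtain y where yV: "y ` ?I \<subseteq> V" and y: "\<forall>P\<in>\<Sigma>1 \<union> \<Sigma>2 \<union> \<Sigma>3. P y"
    by (elim exE conjE) (rule that)
  let ?u = "\<lambda>j i. y (j, i)"
  have uV: "?u j ` {..<?l} \<subseteq> V" for j using yV by auto
  have st0: "same_type L U C {..<?l} (?u 0) ((!) c)"
  proof (rule same_typeI, rule ccontr)
    fix P assume P: "dfn C {..<?l} P" "P (?u 0)" "\<not> P ((!) c)"
    then have "(\<lambda>y. \<not> P (\<lambda>i. y (0, i))) \<in> \<Sigma>1"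
      unfolding \<Sigma>1_def using dfn_not[OF P(1)] by (intro image_eqI[of _ _ "(0, \<lambda>u. \<not> P u)"]) auto
    from bspec[OF y UnI1[OF UnI1[OF this]]] have "\<not> P (?u 0)" .
    then show False using P(2) by blast
  qed
  have st: "same_type L U N0 {..<?l} (?u 0) (?u j)" for j
  proof (rule same_typeI)
    fix P assume P: "dfn N0 {..<?l} P" "P (?u 0)"
    then have "(\<lambda>y. P (\<lambda>i. y (0, i)) \<longleftrightarrow> P (\<lambda>i. y (j, i))) \<in> \<Sigma>3"
      unfolding \<Sigma>3_def by (intro image_eqI[of _ _ "(0, j, P)"]) auto
    from bspec[OF y UnI2[OF this]] have "P (?u 0) \<longleftrightarrow> P (?u j)" .
    then show "P (?u j)" using P(2) by blast
  qed
  have noK: "\<not> K S y" if "finite S" "card S = k" for S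
  proof -
    have "(\<lambda>y. \<not> K S y) \<in> \<Sigma>2" unfolding \<Sigma>2_def using that by blast
    from bspec[OF y UnI1[OF UnI2[OF this]]] show ?thesis .
  qed
  \<comment> \<open>Row 0 has the type of \<open>c\<close> over \<open>C\<close>. The map that takes
    it to \<open>c\<close> is extended to \<open>N0\<close> and all rows, and carries
    \<open>N0\<close> to the required model.\<close>
  obtain f where f: "emap (C \<union> ?u 0 ` {..<?l}) f" "\<And>x. x \<in> C \<Longrightarrow> f x = x"
    "\<And>i. i \<in> {..<?l} \<Longrightarrow> f (?u 0 i) = c ! i"
    by (rule same_type_emap[OF st0 uV cV small_V[OF C]]) (rule that)
  have s1: "small U \<kappa> (C \<union> ?u 0 ` {..<?l})" using uV[of 0] by (intro small_Un[OF C small_finite]) auto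
  have s2: "small U \<kappa> (N0 \<union> y ` ?I)" using N0(3) small_image[OF I yV] by (rule small_Un)
  obtain g where g: "emap ((C \<union> ?u 0 ` {..<?l}) \<union> (N0 \<union> y ` ?I)) g"
    "\<And>x. x \<in> C \<union> ?u 0 ` {..<?l} \<Longrightarrow> g x = f x"
    by (rule emap_extend[OF f(1) s1 s2]) (rule that)
  let ?X = "(C \<union> ?u 0 ` {..<?l}) \<union> (N0 \<union> y ` ?I)"
  have gC: "g x = x" if "x \<in> C" for x using g(2)[of x] f(2)[OF that] that by simp
  have gc: "g (?u 0 i) = c ! i" if "i < ?l" for i using g(2)[of "?u 0 i"] f(3)[of i] that by simp
  have gV: "g ` ?X \<subseteq> V" by (rule emapD(2)[OF g(1)])
  let ?N = "g ` N0"
  have N: "elem_sub L U ?N" by (rule emap_elem_sub[OF g(1) N0(1)]) auto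
  have CN: "C \<subseteq> ?N" using gC N0(2) by force
  have sN: "small U \<kappa> ?N" using gV by (intro small_image small_card[OF N0(3)]) auto
  let ?bs = "\<lambda>j. map (\<lambda>i. g (?u j i)) [0..<?l]"
  have uX: "?u j ` {..<?l} \<subseteq> ?X" for j by auto
  have "divides L U ?N n (\<phi>, c)"
    unfolding divides_def prod.case
  proof (intro exI[of _ k] exI[of _ ?bs] conjI allI impI)
    fix j
    show "?bs j \<in> tuples V ?l" using gV uX[of j] by (auto simp: tuples_def in_lists_conv_set)
    have st': "same_type L U ?N {..<?l} (\<lambda>i. g (?u 0 i)) (\<lambda>i. g (?u j i))"
      by (rule same_type_image[OF g(1) _ uX uX st]) auto
    have gu: "(\<lambda>i. g (?u j i)) ` {..<?l} \<subseteq> V" for j using uX[of j] gV by blast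
    show "same_type L U ?N {..<?l} ((!) c) ((!) (?bs j))"
    proof (rule same_typeI)
      fix P assume P: "dfn ?N {..<?l} P" "P ((!) c)"
      have "P ((!) c) \<longleftrightarrow> P (\<lambda>i. g (?u 0 i))" by (rule dfn_same[OF P(1) _ cV]) (use gc in simp)
      also have "\<dots> \<longleftrightarrow> P (\<lambda>i. g (?u j i))" by (rule same_type_dfn[OF st' P(1) gu gu])
      also have "\<dots> \<longleftrightarrow> P ((!) (?bs j))" by (rule dfn_same[OF P(1) _ gu]) simp
      finally show "P ((!) (?bs j))" using P(2) by blast
    qed
  next
    fix S :: "nat set" assume S: "finite S \<and> card S = k"
    have "K S y \<longleftrightarrow> K S (\<lambda>p. g (y p))"
      by (rule emap_dfn[OF g(1) _ _ K]) (use S in auto)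
    then have nK: "\<not> K S (\<lambda>p. g (y p))" using noK S by blast
    show "\<not> (\<exists>x\<in>tuples V n. \<forall>j\<in>S. holds_at U x (\<phi>, ?bs j))"
    proof
      assume "\<exists>x\<in>tuples V n. \<forall>j\<in>S. holds_at U x (\<phi>, ?bs j)"
      then obtain x where x: "x \<in> tuples V n" "\<forall>j\<in>S. holds_at U x (\<phi>, ?bs j)" by blast
      have m: "map ((!) x) [0..<n] = x" using map_nth[of x] x(1) by (simp add: tuples_def)
      have "(!) x ` {..<n} \<subseteq> V"
        using x(1) nth_mem[of _ x] by (auto simp: tuples_def in_lists_conv_set)
      then have "K S (\<lambda>p. g (y p))" unfolding K_def WH using x(2) m
        by (intro exI[of _ "(!) x"]) (simp only:)
      then show False using nK by blast
    qed
  qed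
  then show ?thesis using that N CN sN by blast
qed

end

context stable_monster
begin

section \<open>Symmetry over models\<close>

lemma def_indep_eval:
  assumes DI: "def_indep (b ` B) M D" and M: "M \<subseteq> V" and D: "D \<subseteq> V"
    and Q: "dfn {} (A <+> B) Q" and d: "dfn M A d" and x: "x ` A \<subseteq> D"
    and eq: "\<And>m. m ` A \<subseteq> M \<Longrightarrow> Q (case_sum m b) \<longleftrightarrow> d m"
  shows "Q (case_sum x b) \<longleftrightarrow> d x"
proof -
  have W: "dfn {} (B <+> A) (\<lambda>e. Q (case_sum (\<lambda>i. e (Inr i)) (\<lambda>j. e (Inl j))))"
    by (rule dfn_swap[OF Q]) simp
  have "Q (case_sum (\<lambda>i. case_sum b x (Inr i)) (\<lambda>j. case_sum b x (Inl j))) \<longleftrightarrow> d x"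
    by (rule def_indep_tuple[OF DI M D subset_refl x W d]) (simp add: eq)
  then show ?thesis by simp
qed

lemma definable_type_swap:
  assumes M: "elem_sub L U M" and b: "b ` B \<subseteq> V" and Q: "dfn {} (A <+> B) Q"
  obtains d where "dfn M A d" and "\<And>m. m ` A \<subseteq> M \<Longrightarrow> Q (case_sum m b) \<longleftrightarrow> d m"
proof -
  have W: "dfn {} (B <+> A) (\<lambda>e. Q (case_sum (\<lambda>i. e (Inr i)) (\<lambda>j. e (Inl j))))"
    by (rule dfn_swap[OF Q]) simp
  from definable_type[OF M b W] obtain d where "dfn M A d"
    "\<And>m. m ` A \<subseteq> M \<Longrightarrow> Q (case_sum (\<lambda>i. case_sum b m (Inr i)) (\<lambda>j. case_sum b m (Inl j))) \<longleftrightarrow> d m"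
    by blast
  then show ?thesis using that by simp
qed

text \<open>This is the symmetry of independence over models: heirs are coheirs.\<close>

lemma def_indep_witness:
  assumes M: "elem_sub L U M" and DI: "def_indep (b ` B) M D" and D: "D \<subseteq> V" and f: "f ` A \<subseteq> D"
    and Q: "dfn {} (A <+> B) Q" "Q (case_sum f b)" and C: "C \<subseteq> M" and b: "b ` B \<subseteq> V" "\<And>c. c \<in> C \<Longrightarrow> b c = c"
  shows "\<exists>y. y ` B \<subseteq> M \<and> (\<forall>c\<in>C. y c = c) \<and> Q (case_sum f y)"
proof (rule ccontr)
  assume neg: "\<not> ?thesis"
  have MV: "M \<subseteq> V" using M by (rule elem_subset)
  have fV: "f ` A \<subseteq> V" using f D by blast
  obtain d where d: "dfn M A d" "\<And>m. m ` A \<subseteq> M \<Longrightarrow> Q (case_sum m b) \<longleftrightarrow> d m"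
    by (rule definable_type_swap[OF M b(1) Q(1)]) (rule that)
  have df: "d f" using def_indep_eval[OF DI MV D Q(1) d(1) f d(2)] Q(2) by blast
  \<comment> \<open>The new \<open>\<alpha>\<close> imitates \<open>f\<close>: it satisfies
    \<open>d\<close> but fails \<open>Q\<close> with all earlier \<open>\<beta>\<close>. The new
    \<open>\<beta>\<close> imitates \<open>b\<close>: it satisfies \<open>Q\<close> with every
    \<open>\<alpha>\<close> so far, the new one included. This is a ladder inside
    \<open>M\<close>.\<close>
  define S where "S = (\<lambda>(z :: nat \<Rightarrow> ('b \<Rightarrow> 'a) \<times> ('a \<Rightarrow> 'a)) n (\<alpha>, \<beta>).
    \<alpha> ` A \<subseteq> M \<and> d \<alpha> \<and> (\<forall>j<n. \<not> Q (case_sum \<alpha> (snd (z j)))) \<and> \<beta> ` B \<subseteq> M \<and> (\<forall>c\<in>C. \<beta> c = c) \<and>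
    Q (case_sum \<alpha> \<beta>) \<and> (\<forall>i<n. Q (case_sum (fst (z i)) \<beta>)))"
  have "\<exists>z. \<forall>n. S z n (z n)"
  proof (rule dependent_wellorder_choice)
    fix r and f g :: "nat \<Rightarrow> ('b \<Rightarrow> 'a) \<times> ('a \<Rightarrow> 'a)" and n :: nat
    assume "\<And>k. k < n \<Longrightarrow> f k = g k"
    then show "S f n r = S g n r" by (cases r) (simp add: S_def)
  next
    fix n z assume z: "\<And>k. k < n \<Longrightarrow> S z k (z k)"
    have zk: "fst (z k) ` A \<subseteq> M" "d (fst (z k))" "snd (z k) ` B \<subseteq> M" "\<forall>c\<in>C. snd (z k) c = c"
      if "k < n" for k
      using z[OF that] by (auto simp: S_def split: prod.splits)
    let ?R = "\<lambda>x. d x \<and> (\<forall>j\<in>{..<n}. \<not> Q (case_sum x (snd (z j))))"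
    have par: "dfn M A (\<lambda>x. Q (case_sum x y))" if "y ` B \<subseteq> M" for y
      by (rule dfn_param[OF dfn_mono[OF Q(1)] that MV]) auto
    have "dfn M A ?R"
      using zk(3) by (intro dfn_conj d(1) dfn_ball dfn_not par) auto
    \<comment> \<open>By \<open>neg\<close>, \<open>Q(f, y)\<close> fails for every \<open>y\<close>
      in \<open>M\<close> that fixes \<open>C\<close>, in particular for the earlier
      \<open>\<beta>\<close>.\<close>
    moreover have "?R f" using df neg zk(3,4) by blast
    ultimately obtain \<alpha> where \<alpha>: "\<alpha> ` A \<subseteq> M" "?R \<alpha>" by (rule elem_witness[OF M _ fV]) (rule that)
    \<comment> \<open>That \<open>\<beta>\<close> fixes \<open>C\<close> may amount to infinitely
      many equations, which no single formula can contain; so the elements of \<open>C\<close> are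
      substituted as parameters instead.\<close>
    let ?fix = "\<lambda>y c. if c \<in> C then c else y c"
    let ?s = "\<lambda>c. if c \<in> C then Inr c else Inl c"
    have s: "(\<lambda>c. case_sum y id (?s c)) = ?fix y" for y :: "'a \<Rightarrow> 'a" by auto
    have par2: "dfn M B (\<lambda>y. Q (case_sum x (?fix y)))" if x: "x ` A \<subseteq> M" for x
    proof -
      have "dfn M B (\<lambda>y. Q (case_sum x y))"
        using dfn_param[OF dfn_mono[OF dfn_swap[OF Q(1)] _ subset_refl, of M] x MV] by simp
      from dfn_subst[OF this subset_refl _ MV, of ?s B] C show ?thesis unfolding s by auto
    qed
    let ?T = "\<lambda>y. Q (case_sum \<alpha> (?fix y)) \<and> (\<forall>i\<in>{..<n}. Q (case_sum (fst (z i)) (?fix y)))"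
    have "dfn M B ?T" using \<alpha>(1) zk(1) by (intro dfn_conj dfn_ball par2) auto
    moreover have "?T b"
    proof -
      have "?fix b = b" using b(2) by auto
      then show ?thesis using d(2)[OF \<alpha>(1)] d(2)[OF zk(1)] zk(2) \<alpha>(2) by simp
    qed
    ultimately obtain \<beta> where \<beta>: "\<beta> ` B \<subseteq> M" "?T \<beta>" by (rule elem_witness[OF M _ b(1)]) (rule that)
    have "?fix \<beta> ` B \<subseteq> M" using \<beta>(1) C by auto
    then have "S z n (\<alpha>, ?fix \<beta>)" using \<alpha> \<beta>(2) by (simp add: S_def)
    then show "\<exists>r. S z n r" by blast
  qed
  then obtain z where z: "\<And>n. S z n (z n)" by blast
  have zn: "fst (z n) ` A \<subseteq> M" "snd (z n) ` B \<subseteq> M" "Q (case_sum (fst (z n)) (snd (z n)))"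
    "j < n \<Longrightarrow> \<not> Q (case_sum (fst (z n)) (snd (z j)))" "j < n \<Longrightarrow> Q (case_sum (fst (z j)) (snd (z n)))"
    for j n using z[of n] by (auto simp: S_def split: prod.splits)
  show False
  proof (rule no_ladder_le[OF Q(1)])
    show "fst (z n) ` A \<subseteq> V" "snd (z n) ` B \<subseteq> V" for n using zn(1,2)[of n] MV by blast+
    show "Q (case_sum (fst (z i)) (snd (z j))) \<longleftrightarrow> i \<le> j" for i j
      using zn(3)[of i] zn(4)[of j i] zn(5)[of i j] by (cases i j rule: linorder_cases) auto
  qed
qed

end

subsection \<open>Morley sequences\<close>

context stable_monster
begin

text \<open>Says that \<open>h\<close> and \<open>b\<close>, as tuples indexed by \<open>B\<close>,
  have the same type over \<open>M\<close>; \<open>h\<close> is arbitrary off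
  \<open>B\<close>.\<close>

definition copy_over :: "'a set \<Rightarrow> 'a set \<Rightarrow> ('a \<Rightarrow> 'a) \<Rightarrow> ('a \<Rightarrow> 'a) \<Rightarrow> bool" where
  "copy_over M B b h \<longleftrightarrow> (\<exists>g. emap_over M (b ` B) g \<and> (\<forall>x\<in>B. h x = g (b x)))"

text \<open>An initial segment of length \<open>n\<close> of a Morley sequence in the definable
  extensions of the type of \<open>b\<close> over \<open>M\<close>; an infinite sequence is one that
  satisfies this for all \<open>n\<close>.\<close>

definition morley :: "'a set \<Rightarrow> 'a set \<Rightarrow> ('a \<Rightarrow> 'a) \<Rightarrow> nat \<Rightarrow> (nat \<Rightarrow> 'a \<Rightarrow> 'a) \<Rightarrow> bool" where
  "morley M B b n h \<longleftrightarrow> (\<forall>i<n. copy_over M B b (h i) \<and>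
     def_indep (h i ` B) M (M \<union> (\<Union>j<i. h j ` B)))"

lemma copy_over_V:
  assumes "copy_over M B b h" shows "h ` B \<subseteq> V"
proof -
  obtain g where g: "emap_over M (b ` B) g" "\<forall>x\<in>B. h x = g (b x)"
    using assms unfolding copy_over_def by blast
  then show ?thesis using emap_overD(5)[OF g(1)] by auto
qed

lemma morleyD:
  assumes "morley M B b n h" and "i < n"
  shows "copy_over M B b (h i)" and "def_indep (h i ` B) M (M \<union> (\<Union>j<i. h j ` B))"
    and "h i ` B \<subseteq> V"
proof -
  show "copy_over M B b (h i)" "def_indep (h i ` B) M (M \<union> (\<Union>j<i. h j ` B))"
    using assms by (simp_all add: morley_def)
  then show "h i ` B \<subseteq> V" by (intro copy_over_V)
qed

lemma copy_over_eval:
  assumes h: "copy_over M B b h" and b: "b ` B \<subseteq> V" and Q: "dfn {} (I <+> B) Q"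
    and m: "m ` I \<subseteq> M" and M: "M \<subseteq> V"
  shows "Q (case_sum m h) \<longleftrightarrow> Q (case_sum m b)"
proof -
  obtain g where g: "emap_over M (b ` B) g" "\<forall>x\<in>B. h x = g (b x)"
    using h unfolding copy_over_def by blast
  have P: "dfn M B (\<lambda>y. Q (case_sum m y))"
    using dfn_param[OF dfn_mono[OF dfn_swap[OF Q empty_subsetI] _ subset_refl, of M] m M] by simp
  have "Q (case_sum m b) \<longleftrightarrow> Q (case_sum m (\<lambda>x. g (b x)))" by (rule emap_over_dfn[OF g(1) P]) auto
  also have "\<dots> \<longleftrightarrow> Q (case_sum m h)"
    by (rule dfn_same[OF P]) (use g(2) emap_overD(5)[OF g(1)] in auto)
  finally show ?thesis by blast
qed

lemma copy_over_extension:
  assumes M: "elem_sub L U M" and B: "small U \<kappa> B" and b: "b ` B \<subseteq> V" and D: "small U \<kappa> D" "M \<subseteq> D"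
  obtains h where "copy_over M B b h" and "def_indep (h ` B) M D"
proof -
  have "small U \<kappa> (b ` B)" by (rule small_image[OF small_card[OF B] b])
  from def_indep_extension[OF M this D] obtain g where
    g: "emap_over M (b ` B) g" "def_indep (g ` b ` B) M D" by blast
  show ?thesis
  proof (rule that)
    show "copy_over M B b (\<lambda>x. g (b x))" unfolding copy_over_def using g(1) by blast
    show "def_indep ((\<lambda>x. g (b x)) ` B) M D" using g(2) by (simp add: image_image)
  qed
qed

text \<open>The last member realises the definable extension, so the definition of the type of
  \<open>b\<close> over \<open>M\<close> turns a formula about all members into one about the
  earlier members. On these the two sequences agree by induction.\<close>

lemma morley_type_unique:
  assumes M: "elem_sub L U M" and b: "b ` B \<subseteq> V" and "morley M B b n h" and "morley M B b n h'"
  shows "same_type L U M ({..<n} \<times> B) (\<lambda>(i, x). h i x) (\<lambda>(i, x). h' i x)"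
  using assms(3,4)
proof (induction n)
  case 0
  show ?case
  proof (rule same_typeI)
    fix P assume P: "dfn M ({..<0::nat} \<times> B) P" "P (\<lambda>(i, x). h i x)"
    from dfn_same[OF P(1), of "\<lambda>(i, x). h i x" "\<lambda>(i, x). h' i x"] P(2)
    show "P (\<lambda>(i, x). h' i x)" by simp
  qed
next
  case (Suc n)
  have MV: "M \<subseteq> V" using M by (rule elem_subset)
  have IH: "same_type L U M ({..<n} \<times> B) (\<lambda>(i, x). h i x) (\<lambda>(i, x). h' i x)"
    using Suc.prems by (intro Suc.IH) (auto simp: morley_def)
  have c: "copy_over M B b (h i)" "copy_over M B b (h' i)" if "i \<le> n" for i
    using Suc.prems that by (auto simp: morley_def)
  have V: "h i ` B \<subseteq> V" "h' i ` B \<subseteq> V" if "i \<le> n" for i using copy_over_V c[OF that] by blast+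
  have DI: "def_indep (h n ` B) M (M \<union> (\<Union>j<n. h j ` B))"
    "def_indep (h' n ` B) M (M \<union> (\<Union>j<n. h' j ` B))" using Suc.prems by (auto simp: morley_def)
  let ?J = "{..<n} \<times> B"
  show ?case
  proof (rule same_typeI)
    fix P assume P: "dfn M ({..<Suc n} \<times> B) P" "P (\<lambda>(i, x). h i x)"
    let ?s = "\<lambda>(i, x). if i = n then Inr x else Inl (i, x)"
    have s: "(\<lambda>p. case_sum (\<lambda>(i, x). k i x) (k n) (?s p)) = (\<lambda>(i, x). k i x)" for k :: "nat \<Rightarrow> 'a \<Rightarrow> 'a"
      by auto
    have "?s ` ({..<Suc n} \<times> B) \<subseteq> ?J <+> B" by (auto simp: less_Suc_eq)
    from dfn_reindex[OF P(1) this MV]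
    have "dfn ({} \<union> M) (?J <+> B) (\<lambda>e. P (\<lambda>p. e (?s p)))" by simp
    then obtain Q where Q: "dfn {} ((?J <+> B) <+> M) Q"
      "\<And>e. e ` (?J <+> B) \<subseteq> V \<Longrightarrow> P (\<lambda>p. e (?s p)) \<longleftrightarrow> Q (case_sum e id)"
      by (rule dfn_abstract) (rule that)
    \<comment> \<open>Regroups the variables: the earlier members and the parameters from
      \<open>M\<close> on one side, the last member on the other.\<close>
    let ?t = "\<lambda>k. case k of Inl (Inl p) \<Rightarrow> Inl (Inl p) | Inl (Inr x) \<Rightarrow> Inr x | Inr c \<Rightarrow> Inl (Inr c)"
    have t: "(\<lambda>k. case_sum (case_sum u id) v (?t k)) = case_sum (case_sum u v) id"
      for u :: "nat \<times> 'a \<Rightarrow> 'a" and v by (auto split: sum.split)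
    have W: "dfn {} ((?J <+> M) <+> B) (\<lambda>e. Q (\<lambda>k. e (?t k)))"
      by (rule dfn_reindex[OF Q(1)]) auto
    obtain d where d: "dfn M (?J <+> M) d" "\<And>m. m ` (?J <+> M) \<subseteq> M \<Longrightarrow>
        Q (\<lambda>k. case_sum m b (?t k)) \<longleftrightarrow> d m"
      by (rule definable_type_swap[OF M b W]) (rule that)
    have d': "Q (\<lambda>k. case_sum m g (?t k)) \<longleftrightarrow> d m"
      if "m ` (?J <+> M) \<subseteq> M" "copy_over M B b g" for m g
      using copy_over_eval[OF that(2) b W that(1) MV] d(2)[OF that(1)] by simp
    have e: "P (\<lambda>(i, x). k i x) \<longleftrightarrow> d (case_sum (\<lambda>(i, x). k i x) id)"
      if k: "\<And>i. i \<le> n \<Longrightarrow> copy_over M B b (k i)" "def_indep (k n ` B) M (M \<union> (\<Union>j<n. k j ` B))"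
      for k
    proof -
      have kV: "k i ` B \<subseteq> V" if "i \<le> n" for i using copy_over_V k(1)[OF that] by blast
      have D: "M \<union> (\<Union>j<n. k j ` B) \<subseteq> V" using kV by (intro Un_least MV UN_least) simp
      have "k i x \<in> V" if "i \<le> n" "x \<in> B" for i x using kV[OF that(1)] that(2) by blast
      then have eV: "case_sum (\<lambda>(i, x). k i x) (k n) ` (?J <+> B) \<subseteq> V" by auto
      have "P (\<lambda>(i, x). k i x) \<longleftrightarrow> Q (case_sum (case_sum (\<lambda>(i, x). k i x) (k n)) id)"
        using Q(2)[OF eV] unfolding s .
      also have "\<dots> \<longleftrightarrow> Q (\<lambda>k'. case_sum (case_sum (\<lambda>(i, x). k i x) id) (k n) (?t k'))"
        unfolding t ..
      also have "\<dots> \<longleftrightarrow> d (case_sum (\<lambda>(i, x). k i x) id)"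
        by (rule def_indep_eval[OF k(2) MV D W d(1) _ d']) (use k(1) in auto)
      finally show ?thesis .
    qed
    have "dfn M ?J (\<lambda>a. d (case_sum a id))" by (rule dfn_param[OF d(1) _ MV]) simp
    moreover have "(\<lambda>(i, x). h i x) ` ?J \<subseteq> V" "(\<lambda>(i, x). h' i x) ` ?J \<subseteq> V"
      using V by (auto simp: image_subset_iff)
    ultimately have "d (case_sum (\<lambda>(i, x). h i x) id) \<longleftrightarrow> d (case_sum (\<lambda>(i, x). h' i x) id)"
      by (rule same_type_dfn[OF IH])
    then show "P (\<lambda>(i, x). h' i x)" using e[OF c(1) DI(1)] e[OF c(2) DI(2)] P(2) by blast
  qed
qed

lemma morley_exists:
  assumes M: "elem_sub L U M" "small U \<kappa> M" and B: "small U \<kappa> B" and b: "b ` B \<subseteq> V"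
  obtains h where "\<And>n. morley M B b n h"
proof -
  define S where "S = (\<lambda>(z :: nat \<Rightarrow> 'a \<Rightarrow> 'a) i h. copy_over M B b h \<and>
    def_indep (h ` B) M (M \<union> (\<Union>j<i. z j ` B)))"
  have "\<exists>z. \<forall>n. S z n (z n)"
  proof (rule dependent_wellorder_choice)
    fix r :: "'a \<Rightarrow> 'a" and f g :: "nat \<Rightarrow> 'a \<Rightarrow> 'a" and n :: nat assume "\<And>k. k < n \<Longrightarrow> f k = g k"
    then show "S f n r = S g n r" by (simp add: S_def)
  next
    fix n z assume z: "\<And>k. k < n \<Longrightarrow> S z k (z k)"
    have "small U \<kappa> (z k ` B)" if "k < n" for k
    proof -
      have "copy_over M B b (z k)" using z[OF that] by (simp add: S_def)
      from small_image[OF small_card[OF B] copy_over_V[OF this]] show ?thesis .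
    qed
    then have "small U \<kappa> (M \<union> (\<Union>j<n. z j ` B))" by (intro small_Un M small_UN_finite) auto
    from copy_over_extension[OF M(1) B b this] show "\<exists>r. S z n r" unfolding S_def by blast
  qed
  then show ?thesis using that unfolding S_def morley_def by blast
qed

lemma morley_subsequence:
  assumes h: "\<And>n. morley M B b n h" and M: "M \<subseteq> V" and e: "\<And>i j. i < j \<Longrightarrow> j < n \<Longrightarrow> e i < (e j :: nat)"
  shows "morley M B b n (\<lambda>i. h (e i))"
  unfolding morley_def
proof (intro allI impI conjI)
  fix i assume i: "i < n"
  note hD = morleyD[OF h lessI]
  show "copy_over M B b (h (e i))" by (rule hD)
  have "M \<union> (\<Union>j<e i. h j ` B) \<subseteq> V" using hD(3) by (intro Un_least M UN_least)
  moreover have "M \<union> (\<Union>j<i. h (e j) ` B) \<subseteq> M \<union> (\<Union>j<e i. h j ` B)" using e[OF _ i] by blast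
  ultimately show "def_indep (h (e i) ` B) M (M \<union> (\<Union>j<i. h (e j) ` B))"
    by (rule def_indep_mono[OF hD(2) M _ subset_refl])
qed

text \<open>Otherwise every realisation \<open>x\<close> of \<open>\<theta>\<close> omits \<open>d\<close>, so \<open>Q(x, h)\<close> fails for all copies \<open>h\<close>
  of \<open>B\<close> that are independent from \<open>x\<close> over \<open>M\<close>. But non-dividing makes \<open>\<theta>(x)\<close> and \<open>Q(x, h\<^sub>i)\<close>,
  \<open>i < n\<close>, consistent for every Morley sequence \<open>h\<close>, and a ladder arises.\<close>

lemma nf_indep_consistent_definition:
  assumes nf: "nf_indep L U A C B" and CB: "C \<subseteq> B" and A: "small U \<kappa> A" and B: "small U \<kappa> B"
    and M: "elem_sub L U M" "small U \<kappa> M" "C \<subseteq> M" and b: "emap_over C B b"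
    and Q: "dfn {} (A <+> B) Q" "Q (case_sum id id)"
    and d: "dfn M A d" "\<And>m. m ` A \<subseteq> M \<Longrightarrow> Q (case_sum m b) \<longleftrightarrow> d m"
    and \<theta>: "dfn C A \<theta>" "\<theta> id"
  shows "\<exists>x. x ` A \<subseteq> V \<and> \<theta> x \<and> d x"
proof (rule ccontr)
  assume neg: "\<not> ?thesis"
  have V: "A \<subseteq> V" "B \<subseteq> V" "M \<subseteq> V" "b ` B \<subseteq> V" "C \<subseteq> V"
    using A B M small_V emap_overD(5)[OF b] CB by auto
  \<comment> \<open>Non-dividing needs copies of \<open>B\<close> itself over \<open>C\<close>, so
    the map over \<open>M\<close> is composed with \<open>b\<close>.\<close>
  have copyC: "emap_over C B h" if h: "copy_over M B b h" for h
  proof -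
    obtain g where g: "emap_over M (b ` B) g" "\<forall>x\<in>B. h x = g (b x)"
      using h unfolding copy_over_def by blast
    have e: "emap_over C B (\<lambda>x. g (b x))"
      by (rule emap_over_comp[OF b emap_over_mono[OF g(1) M(3)]]) auto
    have "g (b x) = h x" if "x \<in> C \<union> B" for x using g(2) that CB by auto
    from emap_cong[OF emap_overD(1)[OF e] this] show ?thesis
      using emap_overD(2)[OF e] g(2) CB by (auto simp: emap_over_def)
  qed
  have eval: "Q (case_sum x h) \<longleftrightarrow> d x"
    if h: "copy_over M B b h" "def_indep (h ` B) M D" and D: "D \<subseteq> V" "x ` A \<subseteq> D" for x h D
  proof (rule def_indep_eval[OF h(2) V(3) D(1) Q(1) d(1) D(2)])
    fix m assume m: "m ` A \<subseteq> M"
    show "Q (case_sum m h) \<longleftrightarrow> d m" using copy_over_eval[OF h(1) V(4) Q(1) m V(3)] d(2)[OF m] by simp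
  qed
  from \<theta>(1) have "dfn ({} \<union> C) A \<theta>" by simp
  then obtain \<theta>' where \<theta>': "dfn {} (A <+> C) \<theta>'" "\<And>x. x ` A \<subseteq> V \<Longrightarrow> \<theta> x \<longleftrightarrow> \<theta>' (case_sum x id)"
    by (rule dfn_abstract) (rule that)
  \<comment> \<open>Every copy fixes \<open>C\<close>, so \<open>\<theta>'\<close> stays equivalent
    to \<open>\<theta>\<close> at each of them and can be carried along as a conjunct.\<close>
  let ?W = "\<lambda>e. Q e \<and> \<theta>' e"
  have W: "dfn {} (A <+> B) ?W"
    by (intro dfn_conj Q(1) dfn_mono[OF \<theta>'(1)]) (use CB in auto)
  have W1: "?W (case_sum id id)" using Q(2) \<theta>(2) \<theta>'(2)[of id] V(1) by simp
  have "id ` A \<subseteq> V" using V(1) by simp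
  have \<theta>W: "\<theta>' (case_sum x h) \<longleftrightarrow> \<theta> x" if "x ` A \<subseteq> V" "copy_over M B b h" for x h
  proof -
    have "\<theta>' (case_sum x h) \<longleftrightarrow> \<theta>' (case_sum x id)"
    proof (rule dfn_same[OF \<theta>'(1)])
      have hc: "h c = c" if "c \<in> C" for c using emap_overD(2)[OF copyC[OF \<open>copy_over M B b h\<close>] that] .
      show "case_sum x h i = case_sum x id i" if "i \<in> A <+> C" for i using that hc by auto
      show "case_sum x h ` (A <+> C) \<subseteq> V" using \<open>x ` A \<subseteq> V\<close> hc V(5) by auto
    qed
    then show ?thesis using \<theta>'(2)[OF that(1)] by simp
  qed
  obtain h0 where h0: "\<And>n. morley M B b n h0" by (rule morley_exists[OF M(1,2) B V(4)]) (rule that)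
  have c0: "copy_over M B b (h0 n)" for n using h0[of "Suc n"] by (auto simp: morley_def)
  let ?E = "\<lambda>n h. \<exists>x. x ` A \<subseteq> V \<and> (\<theta> x \<and> (\<forall>i\<in>{..<n}. Q (case_sum x (h i))))"
  \<comment> \<open>Non-dividing selects \<open>n\<close> members of the fixed sequence
    \<open>h0\<close>. In increasing order they form a Morley sequence again, and the existence of
    \<open>x\<close> depends only on its type over \<open>M\<close>; so it holds for every Morley
    sequence of length \<open>n\<close>.\<close>
  have E: "?E n h" if h: "morley M B b n h" for n h
  proof -
    from nf_indep_nondividing[where h = h0 and k = n, OF nf CB V(1,2) W W1 copyC[OF c0]] obtain S x where
      S: "finite S" "card S = n" and xV: "x ` A \<subseteq> V" and x0: "\<forall>s\<in>S. ?W (case_sum x (h0 s))"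
      by (elim exE conjE) (rule that)
    have x: "x ` A \<subseteq> V" "?W (case_sum x (h0 s))" if "s \<in> S" for s
      using xV bspec[OF x0 that] by simp_all
    let ?l = "sorted_list_of_set S"
    have l: "length ?l = n" "set ?l = S" using S by auto
    have inc: "?l ! i < ?l ! j" if "i < j" "j < n" for i j
      using strict_sorted_list_of_set[of S] that l(1) sorted_wrt_nth_less by blast
    have h1: "morley M B b n (\<lambda>i. h0 (?l ! i))" by (rule morley_subsequence[OF h0 V(3) inc])
    have Qx: "Q (case_sum x (h0 (?l ! i)))" if "i < n" for i
      using x(2)[of "?l ! i"] l that nth_mem[of i ?l] by simp
    have \<theta>x: "\<theta> x \<or> n = 0"
    proof (cases n)
      case (Suc k)
      then have "?l ! 0 \<in> S" using l nth_mem[of 0 ?l] by simp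
      from x(2)[OF this] \<theta>W[OF xV c0] show ?thesis by blast
    qed simp
    \<comment> \<open>An empty selection gives no information on \<open>\<theta>\<close>; for
      \<open>n = 0\<close> the identity is a solution.\<close>
    have E1: "?E n (\<lambda>i. h0 (?l ! i))"
    proof (cases n)
      case 0
      then show ?thesis using \<theta>(2) V(1) by (intro exI[of _ id]) auto
    next
      case (Suc k)
      then show ?thesis using \<theta>x xV Qx by (intro exI[of _ x]) auto
    qed
    have "dfn M ({..<n} \<times> B <+> A) (\<lambda>e. \<theta> (\<lambda>a. e (Inr a)) \<and>
        (\<forall>i\<in>{..<n}. Q (case_sum (\<lambda>a. e (Inr a)) (\<lambda>x. e (Inl (i, x))))))"
    proof (intro dfn_conj dfn_ball)
      show "dfn M ({..<n} \<times> B <+> A) (\<lambda>e. \<theta> (\<lambda>a. e (Inr a)))"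
        by (rule dfn_mono[OF dfn_reindex[OF \<theta>(1), of Inr "{..<n} \<times> B <+> A"]]) (use V(5) M(3) in auto)
      fix i assume i: "i \<in> {..<n}"
      have eq: "(\<lambda>k. e (case_sum Inr (\<lambda>x. Inl (i, x)) k)) = case_sum (\<lambda>a. e (Inr a)) (\<lambda>x. e (Inl (i, x)))"
        for e :: "nat \<times> 'a + 'a \<Rightarrow> 'a" by (auto split: sum.split)
      have "case_sum Inr (\<lambda>x. Inl (i, x)) ` (A <+> B) \<subseteq> {..<n} \<times> B <+> A" using i by auto
      from dfn_reindex[OF Q(1) this] have "dfn {} ({..<n} \<times> B <+> A)
          (\<lambda>e. Q (case_sum (\<lambda>a. e (Inr a)) (\<lambda>x. e (Inl (i, x)))))" unfolding eq by simp
      then show "dfn M ({..<n} \<times> B <+> A) (\<lambda>e. Q (case_sum (\<lambda>a. e (Inr a)) (\<lambda>x. e (Inl (i, x)))))"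
        by (rule dfn_mono) auto
    qed simp
    from dfn_ex_family[OF this V(3)]
    have D: "dfn M ({..<n} \<times> B) (\<lambda>p. ?E n (\<lambda>i x. p (i, x)))" by (simp only: sum.case)
    have pV: "(\<lambda>(i, x). k i x) ` ({..<n} \<times> B) \<subseteq> V" if k: "morley M B b n k" for k
    proof -
      have "k i x \<in> V" if "i < n" "x \<in> B" for i x using morleyD(3)[OF k that(1)] that(2) by blast
      then show ?thesis by auto
    qed
    from same_type_dfn[OF morley_type_unique[OF M(1) V(4) h1 h] D pV[OF h1] pV[OF h]] E1
    show ?thesis by simp
  qed
  \<comment> \<open>\<open>x\<^sub>n\<close> satisfies \<open>Q\<close> with all earlier copies. The
    new copy is independent from all \<open>x\<^sub>i\<close> with i \<le> n, so there
    \<open>Q\<close> is decided by \<open>d\<close>, which no \<open>x\<^sub>i\<close>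
    satisfies.\<close>
  define S where "S = (\<lambda>(z :: nat \<Rightarrow> ('a \<Rightarrow> 'a) \<times> ('a \<Rightarrow> 'a)) n (x, h).
    x ` A \<subseteq> V \<and> \<theta> x \<and> (\<forall>j<n. Q (case_sum x (snd (z j)))) \<and> copy_over M B b h \<and>
    def_indep (h ` B) M (M \<union> (\<Union>j<n. snd (z j) ` B) \<union> (\<Union>j<n. fst (z j) ` A) \<union> x ` A) \<and>
    M \<union> (\<Union>j<n. snd (z j) ` B) \<union> (\<Union>j<n. fst (z j) ` A) \<union> x ` A \<subseteq> V)"
  have "\<exists>z. \<forall>n. S z n (z n)"
  proof (rule dependent_wellorder_choice)
    fix r and f g :: "nat \<Rightarrow> ('a \<Rightarrow> 'a) \<times> ('a \<Rightarrow> 'a)" and n :: nat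
    assume "\<And>k. k < n \<Longrightarrow> f k = g k"
    then show "S f n r = S g n r" by (cases r) (simp add: S_def)
  next
    fix n z assume z: "\<And>k. k < n \<Longrightarrow> S z k (z k)"
    have zk: "fst (z k) ` A \<subseteq> V" "copy_over M B b (snd (z k))"
      "def_indep (snd (z k) ` B) M (M \<union> (\<Union>j<k. snd (z j) ` B) \<union> (\<Union>j<k. fst (z j) ` A) \<union> fst (z k) ` A)"
      "M \<union> (\<Union>j<k. snd (z j) ` B) \<union> (\<Union>j<k. fst (z j) ` A) \<union> fst (z k) ` A \<subseteq> V"
      if "k < n" for k using z[OF that] by (auto simp: S_def split: prod.splits)
    have "morley M B b n (\<lambda>k. snd (z k))"
      unfolding morley_def
    proof (intro allI impI conjI)
      fix k assume k: "k < n"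
      show "copy_over M B b (snd (z k))" by (rule zk(2)[OF k])
      show "def_indep (snd (z k) ` B) M (M \<union> (\<Union>j<k. snd (z j) ` B))"
        by (rule def_indep_mono[OF zk(3)[OF k] V(3) zk(4)[OF k]]) auto
    qed
    from E[OF this] obtain x where x: "x ` A \<subseteq> V" "\<theta> x" "\<forall>i\<in>{..<n}. Q (case_sum x (snd (z i)))"
      by (elim exE conjE) (rule that)
    let ?D = "M \<union> (\<Union>j<n. snd (z j) ` B) \<union> (\<Union>j<n. fst (z j) ` A) \<union> x ` A"
    have "small U \<kappa> (snd (z j) ` B)" "small U \<kappa> (fst (z j) ` A)" if "j < n" for j
      using small_image[OF small_card[OF B] copy_over_V[OF zk(2)[OF that]]]
        small_image[OF small_card[OF A] zk(1)[OF that]] by auto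
    then have D: "small U \<kappa> ?D"
      using small_image[OF small_card[OF A] x(1)] by (intro small_Un M(2) small_UN_finite) auto
    obtain h where h: "copy_over M B b h" "def_indep (h ` B) M ?D"
      by (rule copy_over_extension[OF M(1) B V(4) D]) (auto intro: that)
    have "S z n (x, h)" unfolding S_def prod.case using x h small_V[OF D] by (intro conjI) simp_all
    then show "\<exists>r. S z n r" by blast
  qed
  then obtain z where z: "\<And>n. S z n (z n)" by blast
  let ?D = "\<lambda>n. M \<union> (\<Union>j<n. snd (z j) ` B) \<union> (\<Union>j<n. fst (z j) ` A) \<union> fst (z n) ` A"
  have zn: "fst (z n) ` A \<subseteq> V" "\<theta> (fst (z n))" "copy_over M B b (snd (z n))"
    "def_indep (snd (z n) ` B) M (?D n)" "?D n \<subseteq> V" for n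
    using z[of n] by (auto simp: S_def split: prod.splits)
  have pos: "Q (case_sum (fst (z n)) (snd (z j)))" if "j < n" for j n
    using z[of n] that by (auto simp: S_def split: prod.splits)
  show False
  proof (rule no_ladder_greater[OF Q(1)])
    show "fst (z i) ` A \<subseteq> V" "snd (z i) ` B \<subseteq> V" for i using zn(1) copy_over_V[OF zn(3)] by auto
    show "Q (case_sum (fst (z i)) (snd (z j))) \<longleftrightarrow> j < i" for i j
    proof (cases "j < i")
      case True
      then show ?thesis using pos by blast
    next
      case False
      have "fst (z i) ` A \<subseteq> ?D j"
      proof (cases "i = j")
        case True
        then show ?thesis by blast
      next
        case neq: False
        then have "i < j" using False by simp
        then show ?thesis by blast
      qed
      from eval[OF zn(3,4,5) this] have "Q (case_sum (fst (z i)) (snd (z j))) \<longleftrightarrow> d (fst (z i))" .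
      then show ?thesis using neg zn(1,2) False by blast
    qed
  qed
qed

end

subsection \<open>Independence over algebraically closed sets\<close>

locale strong_independence = weak_independence L U \<kappa> ind
  for L :: "('f, 'r) lang" and U :: "('f, 'r, 'a) struct" and \<kappa> :: "'k rel" and ind +
  assumes basedness: "basedness L U \<kappa> ind"
    and monotonicity: "monotonicity U \<kappa> ind"
    and base_monotonicity: "base_monotonicity U \<kappa> ind"
    and transitivity: "transitivity U \<kappa> ind"
    and weak_extension: "weak_extension L U \<kappa> ind"
begin

lemma ind_mono:
  assumes "small U \<kappa> A" "small U \<kappa> D" "C \<subseteq> A" "C \<subseteq> B" "B \<subseteq> D" "ind A C D"
  shows "ind A C B"
  using monotonicity assms unfolding monotonicity_def by blast

lemma ind_base_mono:
  assumes "small U \<kappa> A" "small U \<kappa> D" "C \<subseteq> A" "C \<subseteq> B" "B \<subseteq> D" "ind A C D"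
  shows "ind (A \<union> B) B D"
  using base_monotonicity assms unfolding base_monotonicity_def by blast

lemma ind_trans:
  assumes "small U \<kappa> A" "small U \<kappa> D" "C \<subseteq> A" "C \<subseteq> B" "B \<subseteq> D" "ind A C B" "ind (A \<union> B) B D"
  shows "ind A C D"
  using transitivity assms unfolding transitivity_def by blast

lemma weak_extension_emap:
  assumes A: "small U \<kappa> A" and B: "small U \<kappa> B" and CB: "C \<subseteq> B" and C: "acl L U C = C"
  obtains f where "emap_over C A f" and "ind (C \<union> f ` A) C B"
proof -
  obtain A' where A': "small U \<kappa> A'" "equiv_over L U C A' A" "ind (C \<union> A') C B"
    using weak_extension A B CB C unfolding weak_extension_def by blast
  have "C \<subseteq> V" using small_V[OF B] CB by blast
  then obtain f where f: "emap_over C A' f" "f ` A' = A"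
    using A'(2) equiv_over_iff[OF small_V[OF A'(1)] small_V[OF A]] by blast
  obtain g where g: "emap_over C (f ` A') g" "\<And>x. x \<in> A' \<Longrightarrow> g (f x) = x"
    by (rule emap_over_inv[OF f(1)]) (rule that)
  have "g ` A = A'" unfolding f(2)[symmetric] using g(2) by force
  then show ?thesis using that[of g] g(1) A'(3) f(2) by simp
qed

text \<open>\<open>B\<close> need not be algebraically closed, so Weak Extension is applied over its
  closure \<open>?K\<close>. Basedness gives independence from \<open>?K\<close> over
  \<open>B\<close>, and Transitivity yields independence from \<open>D\<close> over
  \<open>B\<close>. Invariance under \<open>g\<close> retains independence from \<open>B\<close>
  over \<open>C\<close>, and Transitivity joins the two over \<open>C\<close>.\<close>

lemma ind_extension:
  assumes i: "ind (C \<union> A) C B" and CB: "C \<subseteq> B" and BD: "B \<subseteq> D"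
    and A: "small U \<kappa> A" and D: "small U \<kappa> D"
  obtains g where "emap_over B A g" and "ind (C \<union> g ` A) C D"
proof -
  let ?K = "acl L U B"
  have B: "small U \<kappa> B" using small_subset[OF D BD] .
  have C: "small U \<kappa> C" using small_subset[OF B CB] .
  have BV: "B \<subseteq> V" using B by (rule small_V)
  have BK: "B \<subseteq> ?K" by (rule subset_acl[OF BV])
  have DK: "small U \<kappa> (D \<union> ?K)" by (rule small_Un[OF D small_acl[OF B]])
  obtain g where g: "emap_over ?K A g" "ind (?K \<union> g ` A) ?K (D \<union> ?K)"
    by (rule weak_extension_emap[OF A DK Un_upper2 acl_idem[OF BV]]) (rule that)
  have gB: "emap_over B A g" by (rule emap_over_mono[OF g(1) BK]) auto
  let ?A = "g ` A"
  have A': "small U \<kappa> ?A" by (rule small_image[OF small_card[OF A] emap_overD(5)[OF g(1)]])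
  have "ind (?A \<union> B) B ?K" using basedness A' B unfolding basedness_def by blast
  moreover have "?A \<union> B \<union> ?K = ?K \<union> ?A" using BK by blast
  with g(2) have "ind (?A \<union> B \<union> ?K) ?K (D \<union> ?K)" by simp
  ultimately have "ind (?A \<union> B) B (D \<union> ?K)"
    using ind_trans[OF small_Un[OF A' B] DK _ BK Un_upper2] by blast
  then have BD': "ind (?A \<union> B) B D"
    by (rule ind_mono[OF small_Un[OF A' B] DK _ BD Un_upper1, rotated]) auto
  have gx: "g x = x" if "x \<in> B" for x using emap_overD(2)[OF gB that] .
  have "g ` C = C" "g ` B = B" using gx CB by force+
  then have "ind (C \<union> ?A) C B"
    using ind_emap[OF emap_overD(1)[OF gB] _ _ CB small_Un[OF C A] B i] CB by (auto simp: image_Un)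
  then have "ind (C \<union> ?A) C D"
  proof (rule ind_trans[OF small_Un[OF C A'] D Un_upper1 CB BD])
    have "C \<union> ?A \<union> B = ?A \<union> B" using CB by blast
    then show "ind (C \<union> ?A \<union> B) B D" using BD' by simp
  qed
  then show ?thesis using that gB by blast
qed

text \<open>Base Monotonicity raises the base to the model \<open>N\<close>, where
  \<open>ind\<close> is known to give definable extensions.\<close>

lemma ind_def_indep_model:
  assumes i: "ind (C \<union> A) C D" and A: "small U \<kappa> A" and D: "small U \<kappa> D"
    and N: "elem_sub L U N" "C \<subseteq> N" "N \<subseteq> D"
  shows "def_indep A N D"
proof -
  have C: "small U \<kappa> C" using small_subset[OF D] N(2,3) by blast
  have "ind (C \<union> A \<union> N) N D"
    by (rule ind_base_mono[OF small_Un[OF C A] D Un_upper1 N(2,3) i])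
  moreover have "C \<union> A \<union> N = N \<union> A" using N(2) by blast
  ultimately show ?thesis using ind_def_indep[OF N(1) A D N(3)] by simp
qed

lemma ind_imp_nf_indep:
  assumes A: "small U \<kappa> A" and B: "small U \<kappa> B" and CB: "C \<subseteq> B" and i: "ind (C \<union> A) C B"
  shows "nf_indep L U A C B"
  unfolding nf_indep_def
proof (intro ballI conjI)
  fix a assume "a \<in> lists A"
  then have a: "set a \<subseteq> A" by (auto simp: in_lists_conv_set)
  have C: "small U \<kappa> C" by (rule small_subset[OF B CB])
  show "tp L U C a \<subseteq> tp L U B a"
    using CB by (auto simp: tp_def fms_over_def in_lists_conv_set)
  fix \<theta> assume \<theta>: "\<theta> \<in> tp L U B a"
  let ?n = "length a"
  show "\<not> forks L U C ?n \<theta>"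
  proof
    assume "forks L U C ?n \<theta>"
    then obtain \<Delta> where \<Delta>: "finite \<Delta>" "\<Delta> \<subseteq> fms_over L V ?n" "\<And>\<delta>. \<delta> \<in> \<Delta> \<Longrightarrow> divides L U C ?n \<delta>"
      "\<And>x. x \<in> tuples V ?n \<Longrightarrow> holds_at U x \<theta> \<Longrightarrow> \<exists>\<delta>\<in>\<Delta>. holds_at U x \<delta>"
      unfolding forks_def by blast
    have "\<forall>\<delta>\<in>\<Delta>. \<exists>N. elem_sub L U N \<and> C \<subseteq> N \<and> small U \<kappa> N \<and> divides L U N ?n \<delta>"
    proof
      fix \<delta> assume \<delta>: "\<delta> \<in> \<Delta>"
      obtain \<phi> c where e: "\<delta> = (\<phi>, c)" by force
      have "divides L U C ?n (\<phi>, c)" "(\<phi>, c) \<in> fms_over L V ?n" using \<Delta>(2,3) \<delta> e by auto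
      from divides_over_model[OF C this] show "\<exists>N. elem_sub L U N \<and> C \<subseteq> N \<and> small U \<kappa> N \<and>
          divides L U N ?n \<delta>" unfolding e by blast
    qed
    then obtain N where N: "\<And>\<delta>. \<delta> \<in> \<Delta> \<Longrightarrow> elem_sub L U (N \<delta>)" "\<And>\<delta>. \<delta> \<in> \<Delta> \<Longrightarrow> C \<subseteq> N \<delta>"
      "\<And>\<delta>. \<delta> \<in> \<Delta> \<Longrightarrow> small U \<kappa> (N \<delta>)" "\<And>\<delta>. \<delta> \<in> \<Delta> \<Longrightarrow> divides L U (N \<delta>) ?n \<delta>" by metis
    \<comment> \<open>Each covering formula comes with its own model. Collecting all of them in one
      set lets a single copy of \<open>A\<close> serve every formula.\<close>
    let ?D = "B \<union> (\<Union>\<delta>\<in>\<Delta>. N \<delta> \<union> set (snd \<delta>))"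
    have \<delta>V: "set (snd \<delta>) \<subseteq> V" if "\<delta> \<in> \<Delta>" for \<delta>
      using subsetD[OF \<Delta>(2) that] by (auto simp: fms_over_def)
    have "small U \<kappa> (N \<delta> \<union> set (snd \<delta>))" if "\<delta> \<in> \<Delta>" for \<delta>
      by (rule small_Un[OF N(3)[OF that] small_finite[OF _ \<delta>V[OF that]]]) simp
    then have D: "small U \<kappa> ?D" by (rule small_Un[OF B small_UN_finite[OF \<Delta>(1)]])
    obtain g where g: "emap_over B A g" "ind (C \<union> g ` A) C ?D"
      by (rule ind_extension[OF i CB Un_upper1 A D]) (rule that)
    have gA: "small U \<kappa> (g ` A)" by (rule small_image[OF small_card[OF A] emap_overD(5)[OF g(1)]])
    let ?a = "map g a"
    obtain \<phi> b where e: "\<theta> = (\<phi>, b)" by force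
    have b: "set b \<subseteq> B" "(\<phi>, b) \<in> fms_over L (B \<union> A) ?n" "holds_at U a (\<phi>, b)"
      using \<theta> unfolding e by (auto simp: tp_def fms_over_def in_lists_conv_set)
    have "map g b = b" using b(1) emap_overD(2)[OF g(1)] by (simp add: map_idI subset_iff)
    then have "holds_at U ?a \<theta>"
      using emap_holds_at[OF emap_overD(1)[OF g(1)] _ b(2)] a b(3) e by auto
    moreover have "?a \<in> tuples V ?n"
      using a emap_overD(5)[OF g(1)] by (auto simp: tuples_def in_lists_conv_set)
    ultimately obtain \<delta> where \<delta>: "\<delta> \<in> \<Delta>" "holds_at U ?a \<delta>" using \<Delta>(4) by blast
    have ND: "N \<delta> \<subseteq> ?D" using \<delta>(1) by blast
    have "def_indep (g ` A) (N \<delta>) ?D"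
      by (rule ind_def_indep_model[OF g(2) gA D N(1,2)[OF \<delta>(1)] ND])
    from def_indep_nf_indep[OF N(1)[OF \<delta>(1)] gA D ND this]
    have nf: "nf_indep L U (g ` A) (N \<delta>) ?D" .
    have "\<delta> \<in> fms_over L ?D ?n"
      using subsetD[OF \<Delta>(2) \<delta>(1)] \<delta>(1) by (cases \<delta>) (force simp: fms_over_def in_lists_conv_set)
    then have \<delta>tp: "\<delta> \<in> tp L U ?D ?a" using \<delta>(2) by (simp add: tp_def)
    have "?a \<in> lists (g ` A)" using a by (auto simp: in_lists_conv_set)
    from bspec[OF nf[unfolded nf_indep_def] this]
    have "\<forall>\<eta>\<in>tp L U ?D ?a. \<not> forks L U (N \<delta>) (length ?a) \<eta>" by (rule conjunct2)
    from bspec[OF this \<delta>tp] have "\<not> forks L U (N \<delta>) ?n \<delta>" by simp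
    moreover have "forks L U (N \<delta>) ?n \<delta>"
      unfolding forks_def using \<Delta>(2) \<delta>(1) N(4)[OF \<delta>(1)] by (intro exI[of _ "{\<delta>}"]) auto
    ultimately show False by blast
  qed
qed

text \<open>First a realisation \<open>(x, b)\<close> of \<open>Q\<close> with \<open>b\<close> independent from \<open>x\<close>, and then, after moving
  \<open>x\<close> to \<open>f\<close>, with \<open>b\<close> independent from \<open>M \<union> f ` A\<close>; symmetry over \<open>M\<close> pulls \<open>b\<close> into \<open>M\<close>.\<close>

lemma nf_indep_satisfiable_in_model:
  assumes nf: "nf_indep L U A C B" and CB: "C \<subseteq> B" and A: "small U \<kappa> A" and B: "small U \<kappa> B"
    and C: "acl L U C = C" and f: "emap_over C A f"
    and M: "elem_sub L U M" "small U \<kappa> M" "C \<subseteq> M"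
    and Q: "dfn {} (A <+> B) Q" "Q (case_sum id id)"
  shows "\<exists>y. y ` B \<subseteq> M \<and> (\<forall>c\<in>C. y c = c) \<and> Q (case_sum f y)"
proof -
  have V: "A \<subseteq> V" "B \<subseteq> V" "C \<subseteq> V" "M \<subseteq> V" using A B M(2) CB small_V by auto
  have sC: "small U \<kappa> C" by (rule small_subset[OF B CB])
  obtain b where b: "emap_over C B b" "ind (C \<union> b ` B) C M"
    by (rule weak_extension_emap[OF B M(2,3) C]) (rule that)
  have bV: "b ` B \<subseteq> V" using emap_overD(5)[OF b(1)] .
  have sb: "small U \<kappa> (b ` B)" by (rule small_image[OF small_card[OF B] bV])
  obtain d where d: "dfn M A d" "\<And>m. m ` A \<subseteq> M \<Longrightarrow> Q (case_sum m b) \<longleftrightarrow> d m"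
    by (rule definable_type_swap[OF M(1) bV Q(1)]) (rule that)
  \<comment> \<open>\<open>d\<close> is joined with the full type of \<open>A\<close> over
    \<open>C\<close>: a realisation is a copy of \<open>A\<close> over \<open>C\<close> that
    satisfies \<open>Q\<close> with every copy of \<open>b\<close> over \<open>M\<close> definably
    independent from it.\<close>
  let ?\<Sigma> = "insert d {\<theta>. dfn C A \<theta> \<and> \<theta> id}"
  have D: "dfn M A P" if "P \<in> ?\<Sigma>" for P
    using that d(1) by (auto intro: dfn_mono[OF _ M(3) subset_refl])
  have fin: "\<exists>x. x ` A \<subseteq> V \<and> (\<forall>P\<in>\<Sigma>0. P x)" if \<Sigma>0: "finite \<Sigma>0" "\<Sigma>0 \<subseteq> ?\<Sigma>" for \<Sigma>0
  proof -
    have \<theta>: "dfn C A (\<lambda>x. \<forall>P\<in>\<Sigma>0 - {d}. P x)" using \<Sigma>0 by (intro dfn_ball) auto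
    have \<theta>id: "\<forall>P\<in>\<Sigma>0 - {d}. P id" using \<Sigma>0(2) by blast
    have "\<exists>x. x ` A \<subseteq> V \<and> (\<forall>P\<in>\<Sigma>0 - {d}. P x) \<and> d x"
      by (rule nf_indep_consistent_definition[OF nf CB A B M b(1) Q d \<theta> \<theta>id])
    then obtain x where x: "x ` A \<subseteq> V" "\<forall>P\<in>\<Sigma>0 - {d}. P x" "d x" by (elim exE conjE) (rule that)
    have "P x" if "P \<in> \<Sigma>0" for P
    proof (cases "P = d")
      case False
      then show ?thesis using bspec[OF x(2), of P] that by simp
    qed (use x(3) in simp)
    then show ?thesis using x(1) by blast
  qed
  have "\<exists>x. x ` A \<subseteq> V \<and> (\<forall>P\<in>?\<Sigma>. P x)" by (rule realize[OF M(2) small_card[OF A] D fin])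
  then obtain x0 where x0: "x0 ` A \<subseteq> V" "\<forall>P\<in>?\<Sigma>. P x0" by (elim exE conjE) (rule that)
  have "same_type L U C A id x0"
  proof (rule same_typeI)
    fix P assume "dfn C A P" "P id"
    then have "P \<in> ?\<Sigma>" by blast
    from bspec[OF x0(2) this] show "P x0" .
  qed
  from same_type_emap_over[OF this V(1) x0(1) V(3)] obtain x where
    x: "emap_over C A x" "\<And>a. a \<in> A \<Longrightarrow> x a = x0 a" by blast
  have "d x0" using x0(2) by blast
  moreover have "d x0 \<longleftrightarrow> d x" by (rule dfn_same[OF d(1) _ x0(1)]) (simp add: x(2))
  ultimately have dx: "d x" by blast
  have xV: "x ` A \<subseteq> V" using emap_overD(5)[OF x(1)] .
  have sx: "small U \<kappa> (x ` A)" by (rule small_image[OF small_card[OF A] xV])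
  have D1: "small U \<kappa> (M \<union> x ` A)" by (rule small_Un[OF M(2) sx])
  \<comment> \<open>Moves \<open>b\<close> over \<open>M\<close> to become independent from
    \<open>x\<close> as well; then \<open>d\<close> decides \<open>Q\<close>, so \<open>Q\<close>
    holds of \<open>x\<close> and the moved copy.\<close>
  obtain g where g: "emap_over M (b ` B) g" "ind (C \<union> g ` b ` B) C (M \<union> x ` A)"
    by (rule ind_extension[OF b(2) M(3) Un_upper1 sb D1]) (rule that)
  let ?b1 = "\<lambda>y. g (b y)"
  have b1V: "?b1 ` B \<subseteq> V" using emap_overD(5)[OF g(1)] by (simp add: image_image)
  have sb1: "small U \<kappa> (?b1 ` B)" by (rule small_image[OF small_card[OF B] b1V])
  have i1: "ind (C \<union> ?b1 ` B) C (M \<union> x ` A)" using g(2) by (simp add: image_image)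
  have DI: "def_indep (?b1 ` B) M (M \<union> x ` A)"
    by (rule ind_def_indep_model[OF i1 sb1 D1 M(1,3) Un_upper1])
  have "copy_over M B b ?b1" unfolding copy_over_def using g(1) by blast
  from copy_over_eval[OF this bV Q(1) _ V(4)]
  have eq: "Q (case_sum m ?b1) \<longleftrightarrow> d m" if "m ` A \<subseteq> M" for m using that d(2) by blast
  have Q1: "Q (case_sum x ?b1)"
    using def_indep_eval[OF DI V(4) small_V[OF D1] Q(1) d(1) _ eq] dx by blast
  have b1C: "?b1 c = c" if "c \<in> C" for c
    using emap_overD(2)[OF b(1) that] emap_overD(2)[OF g(1)] M(3) that by auto
  obtain r where r: "emap_over C (x ` A) r" "\<And>a. a \<in> A \<Longrightarrow> r (x a) = a"
    by (rule emap_over_inv[OF x(1)]) (rule that)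
  have "r ` x ` A = A" using r(2) by force
  then have fr: "emap_over C (x ` A) (\<lambda>y. f (r y))" using emap_over_comp[OF r(1)] f by simp
  \<comment> \<open>\<open>s\<close> takes \<open>x\<close> to \<open>f\<close> and drags the copy
    of \<open>B\<close> along. It need not fix \<open>M\<close>, so what is kept is independence
    over \<open>C\<close> from the image of \<open>f\<close>, and this has to be extended to
    \<open>M\<close> once more.\<close>
  obtain s where s: "emap ((C \<union> x ` A) \<union> ?b1 ` B) s" "\<And>y. y \<in> C \<union> x ` A \<Longrightarrow> s y = f (r y)"
    by (rule emap_extend[OF emap_overD(1)[OF fr] small_Un[OF sC sx] sb1]) (rule that)
  have sC': "s c = c" if "c \<in> C" for c using s(2) emap_overD(2)[OF fr that] that by simp
  have sx': "s (x a) = f a" if "a \<in> A" for a using s(2) r(2)[OF that] that by simp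
  let ?b2 = "\<lambda>y. s (?b1 y)"
  have b2V: "?b2 ` B \<subseteq> V" using emapD(2)[OF s(1)] by auto
  have sb2: "small U \<kappa> (?b2 ` B)" by (rule small_image[OF small_card[OF B] b2V])
  have fV: "f ` A \<subseteq> V" using emap_overD(5)[OF f] .
  have sf: "small U \<kappa> (f ` A)" by (rule small_image[OF small_card[OF A] fV])
  have Q2: "Q (case_sum f ?b2)"
  proof -
    have "Q (case_sum x ?b1) \<longleftrightarrow> Q (\<lambda>k. s (case_sum x ?b1 k))"
      by (rule emap_dfn[OF s(1) _ _ Q(1)]) auto
    also have "\<dots> \<longleftrightarrow> Q (case_sum f ?b2)"
    proof (rule dfn_same[OF Q(1)])
      show "s (case_sum x ?b1 k) = case_sum f ?b2 k" if "k \<in> A <+> B" for k using that sx' by auto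
      show "(\<lambda>k. s (case_sum x ?b1 k)) ` (A <+> B) \<subseteq> V" using sx' fV b2V by auto
    qed
    finally show ?thesis using Q1 by blast
  qed
  have i2: "ind (C \<union> ?b2 ` B) C (C \<union> f ` A)"
  proof -
    have "ind (C \<union> ?b1 ` B) C (C \<union> x ` A)"
      by (rule ind_mono[OF small_Un[OF sC sb1] D1 Un_upper1 Un_upper1 _ i1]) (use M(3) in auto)
    then have "ind (s ` (C \<union> ?b1 ` B)) (s ` C) (s ` (C \<union> x ` A))"
      by (intro ind_emap[OF s(1) _ Un_upper1 Un_upper1 small_Un[OF sC sb1] small_Un[OF sC sx]]) auto
    moreover have "s ` C = C" "s ` x ` A = f ` A" using sC' sx' by force+
    ultimately show ?thesis by (simp add: image_Un image_image)
  qed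
  have D3: "small U \<kappa> (M \<union> f ` A)" by (rule small_Un[OF M(2) sf])
  have "C \<union> f ` A \<subseteq> M \<union> f ` A" using M(3) by blast
  then obtain h where h: "emap_over (C \<union> f ` A) (?b2 ` B) h" "ind (C \<union> h ` ?b2 ` B) C (M \<union> f ` A)"
    by (rule ind_extension[OF i2 Un_upper1 _ sb2 D3]) (rule that)
  let ?b3 = "\<lambda>y. h (?b2 y)"
  have b3V: "?b3 ` B \<subseteq> V" using emap_overD(5)[OF h(1)] by (simp add: image_image)
  have sb3: "small U \<kappa> (?b3 ` B)" by (rule small_image[OF small_card[OF B] b3V])
  have i3: "ind (C \<union> ?b3 ` B) C (M \<union> f ` A)" using h(2) by (simp add: image_image)
  have DI3: "def_indep (?b3 ` B) M (M \<union> f ` A)"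
    by (rule ind_def_indep_model[OF i3 sb3 D3 M(1,3) Un_upper1])
  have hf: "h (f a) = f a" if "a \<in> A" for a using emap_overD(2)[OF h(1)] that by blast
  have Q3: "Q (case_sum f ?b3)"
  proof -
    have "Q (case_sum f ?b2) \<longleftrightarrow> Q (\<lambda>k. h (case_sum f ?b2 k))"
      by (rule emap_dfn[OF emap_overD(1)[OF h(1)] _ _ Q(1)]) auto
    also have "\<dots> \<longleftrightarrow> Q (case_sum f ?b3)"
    proof (rule dfn_same[OF Q(1)])
      show "h (case_sum f ?b2 k) = case_sum f ?b3 k" if "k \<in> A <+> B" for k using that hf by auto
      show "(\<lambda>k. h (case_sum f ?b2 k)) ` (A <+> B) \<subseteq> V" using hf fV b3V by auto
    qed
    finally show ?thesis using Q2 by blast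
  qed
  have b3C: "?b3 c = c" if "c \<in> C" for c
    using b1C[OF that] sC'[OF that] emap_overD(2)[OF h(1)] that by simp
  show ?thesis
    by (rule def_indep_witness[OF M(1) DI3 small_V[OF D3] _ Q(1) Q3 M(3) b3V b3C]) auto
qed

lemma nf_indep_imp_ind_acl_closed:
  assumes A: "small U \<kappa> A" and B: "small U \<kappa> B" and CB: "C \<subseteq> B" and C: "acl L U C = C"
    and nf: "nf_indep L U A C B"
  shows "ind (C \<union> A) C B"
proof -
  have V: "A \<subseteq> V" "B \<subseteq> V" "C \<subseteq> V" using A B CB small_V by auto
  have sC: "small U \<kappa> C" by (rule small_subset[OF B CB])
  obtain M where M: "elem_sub L U M" "C \<subseteq> M" "small U \<kappa> M" by (rule small_model[OF sC]) (rule that)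
  have MV: "M \<subseteq> V" by (rule small_V[OF M(3)])
  obtain f where f: "emap_over C A f" "ind (C \<union> f ` A) C M"
    by (rule weak_extension_emap[OF A M(3,2) C]) (rule that)
  have fV: "f ` A \<subseteq> V" using emap_overD(5)[OF f(1)] .
  have sf: "small U \<kappa> (f ` A)" by (rule small_image[OF small_card[OF A] fV])
  \<comment> \<open>The second components are the definitions over \<open>M\<close>, for the type of
    \<open>f\<close>, of the formulas true of \<open>(A, B)\<close>. Finitely many of them have a
    common solution in \<open>M\<close> by \<open>nf_indep_satisfiable_in_model\<close>, because
    inside \<open>M\<close> a definition agrees with its formula at \<open>f\<close>.\<close>
  let ?T = "{(Q, d). dfn {} (A <+> B) Q \<and> Q (case_sum id id) \<and> dfn M B d \<and>
    (\<forall>m. m ` B \<subseteq> M \<longrightarrow> (Q (case_sum f m) \<longleftrightarrow> d m))}"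
  \<comment> \<open>The added equations make \<open>y\<close> fix \<open>C\<close>, so that the map
    \<open>k\<close> below fixes it too and the base is preserved.\<close>
  let ?\<Sigma> = "snd ` ?T \<union> (\<lambda>c y. y c = c) ` C"
  have D: "dfn M B P" if "P \<in> ?\<Sigma>" for P
  proof -
    have "dfn M B (\<lambda>y. y c = c)" if "c \<in> C" for c using that CB M(2) by (intro dfn_eq_param) auto
    then show ?thesis using \<open>P \<in> ?\<Sigma>\<close> by auto
  qed
  have fin: "\<exists>y. y ` B \<subseteq> V \<and> (\<forall>P\<in>\<Sigma>0. P y)" if \<Sigma>0: "finite \<Sigma>0" "\<Sigma>0 \<subseteq> ?\<Sigma>" for \<Sigma>0
  proof -
    have "finite (\<Sigma>0 \<inter> snd ` ?T)" "\<Sigma>0 \<inter> snd ` ?T \<subseteq> snd ` ?T" using \<Sigma>0(1) by auto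
    from finite_subset_image[OF this] obtain S where S: "S \<subseteq> ?T" "finite S" "\<Sigma>0 \<inter> snd ` ?T = snd ` S"
      by blast
    have S': "dfn {} (A <+> B) (fst p)" "fst p (case_sum id id)"
      "\<And>m. m ` B \<subseteq> M \<Longrightarrow> fst p (case_sum f m) \<longleftrightarrow> snd p m" if "p \<in> S" for p
      using S(1) that by auto
    have "dfn {} (A <+> B) (\<lambda>e. \<forall>p\<in>S. fst p e)" using S'(1) by (intro dfn_ball S(2))
    moreover have "\<forall>p\<in>S. fst p (case_sum id id)" using S'(2) by blast
    ultimately have "\<exists>y. y ` B \<subseteq> M \<and> (\<forall>c\<in>C. y c = c) \<and> (\<forall>p\<in>S. fst p (case_sum f y))"
      by (rule nf_indep_satisfiable_in_model[OF nf CB A B C f(1) M(1,3,2)])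
    then obtain y where y: "y ` B \<subseteq> M" "\<forall>c\<in>C. y c = c" "\<forall>p\<in>S. fst p (case_sum f y)"
      by (elim exE conjE) (rule that)
    have "P y" if P: "P \<in> \<Sigma>0" for P
    proof (cases "P \<in> snd ` ?T")
      case True
      then have "P \<in> snd ` S" using S(3) P by blast
      then obtain p where "p \<in> S" "P = snd p" by blast
      then show ?thesis using S'(3)[OF _ y(1)] y(3) by blast
    next
      case False
      then obtain c where "c \<in> C" "P = (\<lambda>y. y c = c)" using \<Sigma>0(2) P by blast
      then show ?thesis using y(2) by simp
    qed
    then show ?thesis using y(1) MV by blast
  qed
  have "\<exists>y. y ` B \<subseteq> V \<and> (\<forall>P\<in>?\<Sigma>. P y)" by (rule realize[OF M(3) small_card[OF B] D fin])
  then obtain y where y: "y ` B \<subseteq> V" "\<forall>P\<in>?\<Sigma>. P y" by (elim exE conjE) (rule that)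
  have yC: "y c = c" if "c \<in> C" for c
  proof -
    have "(\<lambda>y. y c = c) \<in> ?\<Sigma>" using that by blast
    from bspec[OF y(2) this] show ?thesis .
  qed
  have sy: "small U \<kappa> (y ` B)" by (rule small_image[OF small_card[OF B] y(1)])
  have D1: "small U \<kappa> (M \<union> y ` B)" by (rule small_Un[OF M(3) sy])
  \<comment> \<open>Only now is \<open>f\<close> made independent from \<open>y\<close>. The moved
    copy has the same definitions over \<open>M\<close>, and these hold at \<open>y\<close>; so
    together with \<open>y\<close> it has the type of the pair \<open>(A, B)\<close>.\<close>
  obtain g where g: "emap_over M (f ` A) g" "ind (C \<union> g ` f ` A) C (M \<union> y ` B)"
    by (rule ind_extension[OF f(2) M(2) Un_upper1 sf D1]) (rule that)
  let ?f1 = "\<lambda>a. g (f a)"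
  have f1V: "?f1 ` A \<subseteq> V" using emap_overD(5)[OF g(1)] by (simp add: image_image)
  have sf1: "small U \<kappa> (?f1 ` A)" by (rule small_image[OF small_card[OF A] f1V])
  have i1: "ind (C \<union> ?f1 ` A) C (M \<union> y ` B)" using g(2) by (simp add: image_image)
  have DI: "def_indep (?f1 ` A) M (M \<union> y ` B)"
    by (rule ind_def_indep_model[OF i1 sf1 D1 M(1,2) Un_upper1])
  have "same_type L U {} (A <+> B) (case_sum id id) (case_sum ?f1 y)"
  proof (rule same_typeI)
    fix Q :: "('a + 'a \<Rightarrow> 'a) \<Rightarrow> bool" assume Q: "dfn {} (A <+> B) Q" "Q (case_sum id id)"
    obtain d where d: "dfn M B d" "\<And>m. m ` B \<subseteq> M \<Longrightarrow> Q (case_sum f m) \<longleftrightarrow> d m"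
      by (rule definable_type[OF M(1) fV Q(1)]) (rule that)
    have "(Q, d) \<in> ?T" using Q d by simp
    from imageI[OF this, of snd] have "d \<in> ?\<Sigma>" by simp
    from bspec[OF y(2) this] have "d y" .
    moreover have "Q (case_sum ?f1 y) \<longleftrightarrow> d y"
    proof (rule def_indep_tuple[OF DI MV small_V[OF D1] subset_refl _ Q(1) d(1)])
      fix m assume m: "m ` B \<subseteq> M"
      have P: "dfn M A (\<lambda>x. Q (case_sum x m))" by (rule dfn_param[OF dfn_mono[OF Q(1)] m MV]) auto
      have "Q (case_sum f m) \<longleftrightarrow> Q (case_sum ?f1 m)" by (rule emap_over_dfn[OF g(1) P]) auto
      then show "Q (case_sum ?f1 m) \<longleftrightarrow> d m" using d(2)[OF m] by blast
    qed auto
    ultimately show "Q (case_sum ?f1 y)" by blast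
  qed
  from same_type_emap[OF this] V f1V y(1) obtain k where
    k0: "emap ({} \<union> case_sum id id ` (A <+> B)) k" "\<And>i. i \<in> A <+> B \<Longrightarrow> k (case_sum id id i) = case_sum ?f1 y i"
    by auto
  have k: "emap (A \<union> B) k" using k0(1) by simp
  have kA: "k a = ?f1 a" if "a \<in> A" for a using k0(2)[of "Inl a"] that by auto
  have kB: "k b = y b" if "b \<in> B" for b using k0(2)[of "Inr b"] that by auto
  have kC: "k c = c" if "c \<in> C" for c using kB yC CB that by auto
  have kV: "k ` A = ?f1 ` A" "k ` B = y ` B" "k ` C = C" using kA kB kC by force+
  have CyB: "C \<subseteq> y ` B" using yC CB by force
  \<comment> \<open>Invariance along the inverse of \<open>k\<close> takes the independent pair back
    to \<open>(A, B)\<close>.\<close>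
  let ?inv = "inv_into (A \<union> B) k"
  have inv: "?inv (k x) = x" if "x \<in> A \<union> B" for x
    using inv_into_f_f[OF emap_inj[OF k] that] .
  have invA: "?inv ` k ` X = X" if "X \<subseteq> A \<union> B" for X
    using inv that by (force simp: image_image)
  have "ind (C \<union> ?f1 ` A) C (y ` B)"
    by (rule ind_mono[OF small_Un[OF sC sf1] D1 Un_upper1 CyB Un_upper2 i1])
  then have "ind (k ` (C \<union> A)) (k ` C) (k ` B)" unfolding image_Un kV .
  then have "ind (?inv ` k ` (C \<union> A)) (?inv ` k ` C) (?inv ` k ` B)"
  proof (rule ind_emap[OF emap_inv[OF k], rotated -1])
    show "k ` (C \<union> A) \<union> k ` B \<subseteq> k ` (A \<union> B)" using CB by blast
    show "k ` C \<subseteq> k ` (C \<union> A)" "k ` C \<subseteq> k ` B" using CB by blast+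
    show "small U \<kappa> (k ` (C \<union> A))" unfolding image_Un kV by (rule small_Un[OF sC sf1])
    show "small U \<kappa> (k ` B)" unfolding kV by (rule sy)
  qed
  moreover have "C \<union> A \<subseteq> A \<union> B" "C \<subseteq> A \<union> B" "B \<subseteq> A \<union> B" using CB by auto
  ultimately show ?thesis unfolding invA by (simp only: invA)
qed

end

theorem proposition1p4:
  fixes L :: "('f, 'r) lang" and T :: "('f, 'r) fm set"
    and U :: "('f, 'r, 'a) struct" and \<kappa> :: "'k rel"
    and ind :: "'a set \<Rightarrow> 'a set \<Rightarrow> 'a set \<Rightarrow> bool"
  assumes "complete_theory L T" and "stable_theory L T"
    and "model L T U" and "sufficiently_saturated L U \<kappa>"
    and "weak_notion_of_independence L U \<kappa> ind"
    and "stationarity_over_models L U \<kappa> ind"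
  shows "(\<forall>A B M. small U \<kappa> A \<and> small U \<kappa> B \<and> elem_sub L U M \<and> M \<subseteq> B \<longrightarrow>
            (nf_indep L U A M B \<longleftrightarrow> ind (M \<union> A) M B)) \<and>
         (basedness L U \<kappa> ind \<and> monotonicity U \<kappa> ind \<and> base_monotonicity U \<kappa> ind \<and>
          transitivity U \<kappa> ind \<and> weak_extension L U \<kappa> ind \<longrightarrow>
          (\<forall>A B C. small U \<kappa> A \<and> small U \<kappa> B \<and> C \<subseteq> B \<and> acl L U C = C \<longrightarrow>
            (nf_indep L U A C B \<longleftrightarrow> ind (C \<union> A) C B)))"
proof -
  have wf: "wf_fm L \<sigma>" if "\<sigma> \<in> T" for \<sigma>
    using assms(1) that by (auto simp: complete_theory_def sentence_def)
  have no_order: "\<not> order_property L U m n \<phi>" for m n \<phi>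
    using order_property_copy[OF assms(3) wf] assms(2) unfolding stable_theory_def by blast
  interpret weak_independence L U \<kappa> ind
    by unfold_locales (use assms no_order in \<open>simp_all add: model_def\<close>)
  show ?thesis
  proof (intro conjI impI allI)
    fix A B M assume "small U \<kappa> A \<and> small U \<kappa> B \<and> elem_sub L U M \<and> M \<subseteq> B"
    then show "nf_indep L U A M B \<longleftrightarrow> ind (M \<union> A) M B"
      by (intro nf_indep_iff_ind_over_models) simp_all
  next
    fix A B C
    assume "basedness L U \<kappa> ind \<and> monotonicity U \<kappa> ind \<and> base_monotonicity U \<kappa> ind \<and>
        transitivity U \<kappa> ind \<and> weak_extension L U \<kappa> ind"
    then interpret strong_independence L U \<kappa> ind by unfold_locales simp_all
    assume "small U \<kappa> A \<and> small U \<kappa> B \<and> C \<subseteq> B \<and> acl L U C = C"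
    then show "nf_indep L U A C B \<longleftrightarrow> ind (C \<union> A) C B"
      using ind_imp_nf_indep nf_indep_imp_ind_acl_closed by blast
  qed
qed

end
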